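(* Let $a\ge2$. Suppose the regularity assumption holds with constant $L>0$, $\mathcal X$ satisfies the $\alpha$-Riemannian scaling inequality for some $\alpha>0$, and $$\nu:=\inf_{x\in\mathcal X}\|\operatorname{grad}f(x)\|_x>0.$$ Set $M_{\rm RSI}:=L/(\alpha\nu)$ and $$K_{\rm RSI}:=\max\left\{1,\left\lceil\frac{aM_{\rm RSI}}{2}-a\right\rceil\right\}.$$ Then RFW-OL($a$) either terminates at an optimizer or, for every $k\ge K_{\rm RSI}$, $$h_k\le h_{K_{\rm RSI}}\exp\left(\frac{M_{\rm RSI}a^2}{2(K_{\rm RSI}+a-1)}\right)\left(\frac{K_{\rm RSI}+a}{k+a}\right)^a\le\frac{a^2LD^2}{2(K_{\rm RSI}+a-1)}\exp\left(\frac{La^2}{2\alpha\nu(K_{\rm RSI}+a-1)}\right)\left(\frac{K_{\rm RSI}+a}{k+a}\right)^a.$$ In particular, $h_k=O(k^{-a})$.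
   Context: Setting. $\mathcal M$ is a connected, complete, finite-dimensional Riemannian manifold with distance $d$, tangent spaces $T_x\mathcal M$, inner products $\langle\cdot,\cdot\rangle_x$, norms $\|\cdot\|_x$ and exponential map $\operatorname{Exp}_x$. The set $\mathcal X\subset\mathcal M$ is nonempty and compact, with diameter $D:=\sup_{x,y\in\mathcal X}d(x,y)>0$, and is weakly minimizing-geodesically convex: for all $x,y\in\mathcal X$ there is at least one distance-minimizing geodesic from $x$ to $y$ whose image is contained in $\mathcal X$. For $x\in\mathcal X$ the set of feasible minimizing initial velocities is $$\mathcal V(x):=\{v\in T_x\mathcal M:\ \operatorname{Exp}_x(v)\in\mathcal X,\ \|v\|_x=d(x,\operatorname{Exp}_x(v)),\ \operatorname{Exp}_x(tv)\in\mathcal X\ \text{for all }t\in[0,1]\}.$$ The function $f$ is real-valued and differentiable on an open neighborhood of $\mathcal X$, with Riemannian gradient $\operatorname{grad}f$. Put $f^\star:=\min_{\mathcal X}f$, $\mathcal X^\star:=\arg\min_{\mathcal X}f$ (its elements are called optimizers), and $h(x):=f(x)-f^\star$. Regularity assumption (constant $L>0$): for all $x\in\mathcal X$, $v\in\mathcal V(x)$, $t\in[0,1]$, $f(\operatorname{Exp}_x(tv))\le(1-t)f(x)+tf(\operatorname{Exp}_x(v))$ and $f(\operatorname{Exp}_x(tv))\le f(x)+t\langle\operatorname{grad}f(x),v\rangle_x+\frac L2t^2\|v\|_x^2$. $\alpha$-Riemannian scaling inequality (RSI): for all $x\in\mathcal X$, $w\in T_x\mathcal M$ and $v\in\mathcal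 A(x,w):=\arg\max_{u\in\mathcal V(x)}\langle w,u\rangle_x$, one has $\langle w,v\rangle_x\ge\alpha\|w\|_x\|v\|_x^2$. Algorithm RFW-OL($a$). Start from an arbitrary $x_0\in\mathcal X$. For $k=0,1,2,\dots$: choose any $v_k\in\arg\min_{v\in\mathcal V(x_k)}\langle\operatorname{grad}f(x_k),v\rangle_{x_k}$, set $g_k:=-\langle\operatorname{grad}f(x_k),v_k\rangle_{x_k}$; if $g_k=0$, terminate and return $x_k$; otherwise set $\eta_k:=a/(k+a)$ and $x_{k+1}:=\operatorname{Exp}_{x_k}(\eta_kv_k)$. Write $h_k:=h(x_k)$. *)

theory Defs
  imports "HOL-Analysis.Analysis" "HOL-Library.Landau_Symbols"
begin

section \<open>Riemannian manifolds\<close>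

text \<open>
  The points of the manifold are the elements of a Hausdorff, second countable type \<open>'m\<close>;
  the model space is a Euclidean space \<open>'e\<close>. A chart is a pair (domain, coordinate map).
  A tangent vector is the family of its coordinate vectors in the charts of the atlas;
  see \<open>tangent_space\<close> for the transformation law.
\<close>

type_synonym ('m, 'e) chart = "'m set \<times> ('m \<Rightarrow> 'e)"

type_synonym ('m, 'e) tangent = "('m, 'e) chart \<Rightarrow> 'e"

record ('m, 'e) riem =
  atlas :: "('m, 'e) chart set"
  metric :: "'m \<Rightarrow> ('m, 'e) tangent \<Rightarrow> ('m, 'e) tangent \<Rightarrow> real"

text \<open>Only used on open sets \<open>S\<close>.\<close>

primrec Ck_on ::
  "nat \<Rightarrow> 'a::euclidean_space set \<Rightarrow> ('a \<Rightarrow> 'b::real_normed_vector) \<Rightarrow> bool" where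
  "Ck_on 0 S f \<longleftrightarrow> continuous_on S f"
| "Ck_on (Suc k) S f \<longleftrightarrow>
     (\<forall>x\<in>S. f differentiable (at x)) \<and>
     (\<forall>u. Ck_on k S (\<lambda>x. frechet_derivative f (at x) u))"

definition smooth_on ::
  "'a::euclidean_space set \<Rightarrow> ('a \<Rightarrow> 'b::real_normed_vector) \<Rightarrow> bool" where
  "smooth_on S f \<longleftrightarrow> (\<forall>k. Ck_on k S f)"

definition chart_inv :: "('m, 'e) chart \<Rightarrow> 'e \<Rightarrow> 'm" where
  "chart_inv c = inv_into (fst c) (snd c)"

definition transition :: "('m, 'e) chart \<Rightarrow> ('m, 'e) chart \<Rightarrow> 'e \<Rightarrow> 'e" where
  "transition c c' = snd c' \<circ> chart_inv c"

definition is_chart :: "('m::topological_space, 'e::euclidean_space) chart \<Rightarrow> bool" where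
  "is_chart c \<longleftrightarrow> open (fst c) \<and> open (snd c ` fst c) \<and>
     homeomorphism (fst c) (snd c ` fst c) (snd c) (chart_inv c)"

definition smooth_atlas :: "('m::topological_space, 'e::euclidean_space) chart set \<Rightarrow> bool" where
  "smooth_atlas A \<longleftrightarrow>
     (\<Union>c\<in>A. fst c) = UNIV \<and>
     (\<forall>c\<in>A. is_chart c) \<and>
     (\<forall>c\<in>A. \<forall>c'\<in>A. smooth_on (snd c ` (fst c \<inter> fst c')) (transition c c'))"

definition charts_at :: "('m, 'e) riem \<Rightarrow> 'm \<Rightarrow> ('m, 'e) chart set" where
  "charts_at M x = {c \<in> atlas M. x \<in> fst c}"

definition tangent_space ::
  "('m, 'e::euclidean_space) riem \<Rightarrow> 'm \<Rightarrow> ('m, 'e) tangent set" where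
  "tangent_space M x =
     {v. (\<forall>c. c \<notin> charts_at M x \<longrightarrow> v c = 0) \<and>
         (\<forall>c\<in>charts_at M x. \<forall>c'\<in>charts_at M x.
            v c' = frechet_derivative (transition c c') (at (snd c x)) (v c))}"

definition tscale :: "real \<Rightarrow> ('m, 'e::real_vector) tangent \<Rightarrow> ('m, 'e) tangent" where
  "tscale t v = (\<lambda>c. t *\<^sub>R v c)"

definition tadd ::
  "('m, 'e::real_vector) tangent \<Rightarrow> ('m, 'e) tangent \<Rightarrow> ('m, 'e) tangent" where
  "tadd u v = (\<lambda>c. u c + v c)"

text \<open>The tangent vector at \<open>x\<close> whose coordinates in the chart \<open>c\<close> are \<open>u\<close>.\<close>

definition coord_tangent ::
  "('m, 'e::euclidean_space) riem \<Rightarrow> ('m, 'e) chart \<Rightarrow> 'm \<Rightarrow> 'e \<Rightarrow> ('m, 'e) tangent" where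
  "coord_tangent M c x u =
     (\<lambda>c'. if c' \<in> charts_at M x
           then frechet_derivative (transition c c') (at (snd c x)) u else 0)"

definition metric_coord ::
  "('m, 'e::euclidean_space) riem \<Rightarrow> ('m, 'e) chart \<Rightarrow> 'e \<Rightarrow> 'e \<Rightarrow> 'e \<Rightarrow> real" where
  "metric_coord M c p u w =
     metric M (chart_inv c p)
       (coord_tangent M c (chart_inv c p) u) (coord_tangent M c (chart_inv c p) w)"

definition inner_product_on_tangent ::
  "('m, 'e::euclidean_space) riem \<Rightarrow> 'm \<Rightarrow> bool" where
  "inner_product_on_tangent M x \<longleftrightarrow>
     (\<forall>u\<in>tangent_space M x. \<forall>v\<in>tangent_space M x. metric M x u v = metric M x v u) \<and>
     (\<forall>u\<in>tangent_space M x. \<forall>v\<in>tangent_space M x. \<forall>w\<in>tangent_space M x.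
        metric M x (tadd u v) w = metric M x u w + metric M x v w) \<and>
     (\<forall>u\<in>tangent_space M x. \<forall>w\<in>tangent_space M x. \<forall>r.
        metric M x (tscale r u) w = r * metric M x u w) \<and>
     (\<forall>u\<in>tangent_space M x. u \<noteq> (\<lambda>c. 0) \<longrightarrow> metric M x u u > 0)"

definition riemannian_manifold ::
  "('m::{t2_space,second_countable_topology}, 'e::euclidean_space) riem \<Rightarrow> bool" where
  "riemannian_manifold M \<longleftrightarrow>
     smooth_atlas (atlas M) \<and>
     (\<forall>x. inner_product_on_tangent M x) \<and>
     (\<forall>c\<in>atlas M. \<forall>u w. smooth_on (snd c ` fst c) (\<lambda>p. metric_coord M c p u w))"

definition rnorm :: "('m, 'e) riem \<Rightarrow> 'm \<Rightarrow> ('m, 'e) tangent \<Rightarrow> real" where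
  "rnorm M x v = sqrt (metric M x v v)"

section \<open>Curves, distance, geodesics, exponential map\<close>

text \<open>
  Derivatives are taken within the parameter interval \<open>I\<close>, hence one-sided at its end points.
\<close>

definition velocity ::
  "('m, 'e::euclidean_space) riem \<Rightarrow> real set \<Rightarrow> (real \<Rightarrow> 'm) \<Rightarrow> real \<Rightarrow> ('m, 'e) tangent" where
  "velocity M I \<gamma> t =
     (\<lambda>c. if c \<in> charts_at M (\<gamma> t)
          then vector_derivative (snd c \<circ> \<gamma>) (at t within I) else 0)"

definition C1_curve_on ::
  "('m::topological_space, 'e::euclidean_space) riem \<Rightarrow> real set \<Rightarrow> (real \<Rightarrow> 'm) \<Rightarrow> bool" where
  "C1_curve_on M I \<gamma> \<longleftrightarrow>
     continuous_on I \<gamma> \<and>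
     (\<forall>c\<in>atlas M.
        (\<forall>t\<in>I. \<gamma> t \<in> fst c \<longrightarrow> (snd c \<circ> \<gamma>) differentiable (at t within I)) \<and>
        continuous_on {t \<in> I. \<gamma> t \<in> fst c}
          (\<lambda>t. vector_derivative (snd c \<circ> \<gamma>) (at t within I)))"

definition piecewise_C1_curve ::
  "('m::topological_space, 'e::euclidean_space) riem \<Rightarrow> (real \<Rightarrow> 'm) \<Rightarrow> bool" where
  "piecewise_C1_curve M \<gamma> \<longleftrightarrow>
     (\<exists>n (s :: nat \<Rightarrow> real). s 0 = 0 \<and> s n = 1 \<and>
        (\<forall>i<n. s i < s (Suc i) \<and> C1_curve_on M {s i..s (Suc i)} \<gamma>))"

text \<open>
  The finitely many break points of a piecewise curve do not affect the integral.
\<close>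

definition curve_length ::
  "('m, 'e::euclidean_space) riem \<Rightarrow> (real \<Rightarrow> 'm) \<Rightarrow> real" where
  "curve_length M \<gamma> = integral {0..1} (\<lambda>t. rnorm M (\<gamma> t) (velocity M {0..1} \<gamma> t))"

definition rdist ::
  "('m::topological_space, 'e::euclidean_space) riem \<Rightarrow> 'm \<Rightarrow> 'm \<Rightarrow> real" where
  "rdist M x y =
     Inf {curve_length M \<gamma> | \<gamma>. piecewise_C1_curve M \<gamma> \<and> \<gamma> 0 = x \<and> \<gamma> 1 = y}"

text \<open>
  Christoffel symbols of the first kind of the Levi-Civita connection, in the chart \<open>c\<close>:
  the product of the metric of \<open>\<Gamma>(u, v)\<close> with \<open>w\<close>.
\<close>

definition christoffel ::
  "('m, 'e::euclidean_space) riem \<Rightarrow> ('m, 'e) chart \<Rightarrow> 'e \<Rightarrow> 'e \<Rightarrow> 'e \<Rightarrow> 'e \<Rightarrow> real" where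
  "christoffel M c p u v w =
     (frechet_derivative (\<lambda>q. metric_coord M c q v w) (at p) u
      + frechet_derivative (\<lambda>q. metric_coord M c q u w) (at p) v
      - frechet_derivative (\<lambda>q. metric_coord M c q u v) (at p) w) / 2"

text \<open>
  The geodesic equation \<open>q'' + \<Gamma>(q', q') = 0\<close> of the coordinate curve \<open>q\<close>, paired by the
  (nondegenerate) metric with an arbitrary vector \<open>w\<close>. Constant curves are geodesics.
\<close>

definition geodesic_on ::
  "('m::topological_space, 'e::euclidean_space) riem \<Rightarrow> real set \<Rightarrow> (real \<Rightarrow> 'm) \<Rightarrow> bool" where
  "geodesic_on M I \<gamma> \<longleftrightarrow>
     continuous_on I \<gamma> \<and>
     (\<forall>c\<in>atlas M. \<forall>t\<in>I. \<gamma> t \<in> fst c \<longrightarrow>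
        (let q = snd c \<circ> \<gamma>;
             q' = (\<lambda>s. vector_derivative q (at s within I));
             q'' = (\<lambda>s. vector_derivative q' (at s within I))
         in q differentiable (at t within I) \<and>
            q' differentiable (at t within I) \<and>
            (\<forall>w. metric_coord M c (q t) (q'' t) w + christoffel M c (q t) (q' t) (q' t) w = 0)))"

text \<open>
  Completeness is geodesic completeness: \<open>Exp\<close> is defined on the whole tangent bundle.
  For connected manifolds this is metric completeness, by the Hopf-Rinow theorem.
\<close>

definition complete_riem ::
  "('m::topological_space, 'e::euclidean_space) riem \<Rightarrow> bool" where
  "complete_riem M \<longleftrightarrow>
     (\<forall>x. \<forall>v\<in>tangent_space M x.
        \<exists>\<gamma>. geodesic_on M UNIV \<gamma> \<and> \<gamma> 0 = x \<and> velocity M UNIV \<gamma> 0 = v)"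

definition Exp ::
  "('m::topological_space, 'e::euclidean_space) riem \<Rightarrow> 'm \<Rightarrow> ('m, 'e) tangent \<Rightarrow> 'm" where
  "Exp M x v =
     (THE y. \<exists>\<gamma>. geodesic_on M UNIV \<gamma> \<and> \<gamma> 0 = x \<and> velocity M UNIV \<gamma> 0 = v \<and> \<gamma> 1 = y)"

definition minimizing_geodesic ::
  "('m::topological_space, 'e::euclidean_space) riem \<Rightarrow> 'm \<Rightarrow> 'm \<Rightarrow> (real \<Rightarrow> 'm) \<Rightarrow> bool" where
  "minimizing_geodesic M x y \<gamma> \<longleftrightarrow>
     geodesic_on M {0..1} \<gamma> \<and> \<gamma> 0 = x \<and> \<gamma> 1 = y \<and> curve_length M \<gamma> = rdist M x y"

section \<open>Differentiable functions and the Riemannian gradient\<close>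

definition differentiable_at_point ::
  "('m, 'e::euclidean_space) riem \<Rightarrow> ('m \<Rightarrow> real) \<Rightarrow> 'm \<Rightarrow> bool" where
  "differentiable_at_point M f x \<longleftrightarrow>
     (\<forall>c\<in>charts_at M x. (f \<circ> chart_inv c) differentiable (at (snd c x)))"

definition grad ::
  "('m, 'e::euclidean_space) riem \<Rightarrow> ('m \<Rightarrow> real) \<Rightarrow> 'm \<Rightarrow> ('m, 'e) tangent" where
  "grad M f x =
     (THE u. u \<in> tangent_space M x \<and>
        (\<forall>w\<in>tangent_space M x. \<forall>c\<in>charts_at M x.
           metric M x u w = frechet_derivative (f \<circ> chart_inv c) (at (snd c x)) (w c)))"

section \<open>The feasible set and the objective\<close>

definition diam :: "('m::topological_space, 'e::euclidean_space) riem \<Rightarrow> 'm set \<Rightarrow> real" where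
  "diam M X = (SUP (x, y) \<in> X \<times> X. rdist M x y)"

definition weakly_geodesically_convex ::
  "('m::topological_space, 'e::euclidean_space) riem \<Rightarrow> 'm set \<Rightarrow> bool" where
  "weakly_geodesically_convex M X \<longleftrightarrow>
     (\<forall>x\<in>X. \<forall>y\<in>X. \<exists>\<gamma>. minimizing_geodesic M x y \<gamma> \<and> \<gamma> ` {0..1} \<subseteq> X)"

definition feasible_velocities ::
  "('m::topological_space, 'e::euclidean_space) riem \<Rightarrow> 'm set \<Rightarrow> 'm \<Rightarrow> ('m, 'e) tangent set" where
  "feasible_velocities M X x =
     {v \<in> tangent_space M x. Exp M x v \<in> X \<and> rnorm M x v = rdist M x (Exp M x v) \<and>
        (\<forall>t\<in>{0..1}. Exp M x (tscale t v) \<in> X)}"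

text \<open>
  The infimum is attained in the intended setting, \<open>f\<close> being continuous on the compact set \<open>X\<close>.
\<close>

definition fstar :: "'m set \<Rightarrow> ('m \<Rightarrow> real) \<Rightarrow> real" where
  "fstar X f = (INF y\<in>X. f y)"

definition optimizers :: "'m set \<Rightarrow> ('m \<Rightarrow> real) \<Rightarrow> 'm set" where
  "optimizers X f = {x \<in> X. \<forall>y\<in>X. f x \<le> f y}"

definition regular ::
  "('m::topological_space, 'e::euclidean_space) riem \<Rightarrow> 'm set \<Rightarrow> ('m \<Rightarrow> real) \<Rightarrow> real \<Rightarrow> bool" where
  "regular M X f L \<longleftrightarrow>
     (\<forall>x\<in>X. \<forall>v\<in>feasible_velocities M X x. \<forall>t\<in>{0..1}.
        f (Exp M x (tscale t v)) \<le> (1 - t) * f x + t * f (Exp M x v) \<and>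
        f (Exp M x (tscale t v))
          \<le> f x + t * metric M x (grad M f x) v + L / 2 * t\<^sup>2 * (rnorm M x v)\<^sup>2)"

definition linear_argmax ::
  "('m::topological_space, 'e::euclidean_space) riem \<Rightarrow> 'm set \<Rightarrow> 'm
     \<Rightarrow> ('m, 'e) tangent \<Rightarrow> ('m, 'e) tangent set" where
  "linear_argmax M X x w =
     {v \<in> feasible_velocities M X x.
        \<forall>u\<in>feasible_velocities M X x. metric M x w u \<le> metric M x w v}"

definition linear_argmin ::
  "('m::topological_space, 'e::euclidean_space) riem \<Rightarrow> 'm set \<Rightarrow> 'm
     \<Rightarrow> ('m, 'e) tangent \<Rightarrow> ('m, 'e) tangent set" where
  "linear_argmin M X x w =
     {v \<in> feasible_velocities M X x.
        \<forall>u\<in>feasible_velocities M X x. metric M x w v \<le> metric M x w u}"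

definition RSI ::
  "('m::topological_space, 'e::euclidean_space) riem \<Rightarrow> 'm set \<Rightarrow> real \<Rightarrow> bool" where
  "RSI M X \<alpha> \<longleftrightarrow>
     (\<forall>x\<in>X. \<forall>w\<in>tangent_space M x. \<forall>v\<in>linear_argmax M X x w.
        metric M x w v \<ge> \<alpha> * rnorm M x w * (rnorm M x v)\<^sup>2)"

section \<open>The algorithm RFW-OL\<close>

definition fw_gap ::
  "('m, 'e::euclidean_space) riem \<Rightarrow> ('m \<Rightarrow> real) \<Rightarrow> 'm \<Rightarrow> ('m, 'e) tangent \<Rightarrow> real" where
  "fw_gap M f x v = - metric M x (grad M f x) v"

text \<open>
  A run is given by sequences of iterates \<open>x\<close> and velocities \<open>v\<close>. It terminates at the first
  index where the gap vanishes; the entries beyond that index are unconstrained.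
\<close>

definition rfw_run ::
  "('m::topological_space, 'e::euclidean_space) riem \<Rightarrow> 'm set \<Rightarrow> ('m \<Rightarrow> real) \<Rightarrow> real
     \<Rightarrow> (nat \<Rightarrow> 'm) \<Rightarrow> (nat \<Rightarrow> ('m, 'e) tangent) \<Rightarrow> bool" where
  "rfw_run M X f a x v \<longleftrightarrow>
     x 0 \<in> X \<and>
     (\<forall>k. (\<forall>j<k. fw_gap M f (x j) (v j) \<noteq> 0) \<longrightarrow>
        v k \<in> linear_argmin M X (x k) (grad M f (x k))) \<and>
     (\<forall>k. (\<forall>j\<le>k. fw_gap M f (x j) (v j) \<noteq> 0) \<longrightarrow>
        x (Suc k) = Exp M (x k) (tscale (a / (real k + a)) (v k)))"

definition terminates_at ::
  "('m, 'e::euclidean_space) riem \<Rightarrow> ('m \<Rightarrow> real)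
     \<Rightarrow> (nat \<Rightarrow> 'm) \<Rightarrow> (nat \<Rightarrow> ('m, 'e) tangent) \<Rightarrow> nat \<Rightarrow> bool" where
  "terminates_at M f x v k \<longleftrightarrow>
     fw_gap M f (x k) (v k) = 0 \<and> (\<forall>j<k. fw_gap M f (x j) (v j) \<noteq> 0)"

end

theory Submission imports Defs begin

text \<open>
  Differentiating \<open>f\<close> along a minimizing geodesic from \<open>x\<^sub>k\<close> to an arbitrary \<open>y \<in> X\<close> and using
  geodesic convexity gives \<open>f x\<^sub>k - f y \<le> g\<^sub>k\<close>, so the gap dominates \<open>h\<^sub>k\<close> and a vanishing gap
  certifies optimality. The scaling inequality applied to \<open>- grad f x\<^sub>k\<close> gives
  \<open>\<alpha> \<nu> \<parallel>v\<^sub>k\<parallel>\<^sup>2 \<le> g\<^sub>k\<close>, which absorbs the quadratic term of the descent inequality into the gap: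
  \<open>h\<^bsub>k+1\<^esub> \<le> (1 - \<eta>\<^sub>k + M \<eta>\<^sub>k\<^sup>2 / 2) h\<^sub>k\<close> as soon as \<open>\<eta>\<^sub>k M \<le> 2\<close>, that is for \<open>k \<ge> K\<close>. The product
  of these factors decays like \<open>k\<close> to the power \<open>- a\<close>. The constant \<open>h\<^sub>K\<close> is bounded by the usual
  open-loop recursion with \<open>\<parallel>v\<^sub>k\<parallel> \<le> D\<close>.

  The geometric input consists of three facts. Minimizing geodesics are represented by \<open>Exp\<close>, which
  is uniqueness for the geodesic equation together with constancy of the speed; the gradient exists
  and represents the differential in every chart; and \<open>rdist\<close> is bounded on the compact set \<open>X\<close>.
\<close>

section \<open>Multilinear families, Lipschitz bounds and a uniqueness theorem for quadratic ODEs\<close>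


text \<open>\<open>Exp\<close> and \<open>grad\<close> are definite descriptions,
  \<open>rdist\<close> and \<open>diam\<close> an infimum and a supremum: each carries information
  only once unique existence or boundedness is proved, and most of the work goes there. The geodesic
  equation is implicit in the second derivative, which appears only paired with vectors by the
  metric; uniqueness therefore rests on an energy estimate in one chart, followed by a continuation
  argument over the interval.

  In the rate, \<eta>_k M \<le> 2 is exactly the condition under which the gap has a nonpositive
  coefficient in the descent estimate, so that h_k may replace it; solving
  \<open>a / (k + a) * M \<le> 2\<close> for k gives K. The exponential constant pays for the terms
  M \<eta>_k^2 / 2, whose sum from K on is at most \<open>M * a\<^sup>2 / (2 * (K + a - 1))\<close>.
  The bound on h_K is free of h_0 because the first step size is 1, and its recursion closes because
  a \<ge> 2.\<close>

text \<open>By linearity only the constants of the finitely many basis vectors matter, so bounds for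
  each fixed argument become uniform. The weight \<open>d\<close> is 1 when a size is bounded, and a
  distance of base points in a Lipschitz estimate.\<close>

lemma linear_family_bound:
  fixes F :: "'z \<Rightarrow> 'e::euclidean_space \<Rightarrow> real"
  assumes lin: "\<And>z. z \<in> P \<Longrightarrow> linear (F z)"
    and bound: "\<And>u. \<exists>C. \<forall>z\<in>P. \<bar>F z u\<bar> \<le> C * d z"
    and d: "\<And>z. z \<in> P \<Longrightarrow> 0 \<le> d z"
  shows "\<exists>C\<ge>0. \<forall>z\<in>P. \<forall>u. \<bar>F z u\<bar> \<le> C * d z * norm u"
proof -
  obtain C where C: "\<And>u z. z \<in> P \<Longrightarrow> \<bar>F z u\<bar> \<le> C u * d z"
    using bound by metis
  define K where "K = (\<Sum>b\<in>Basis. \<bar>C b\<bar>)"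
  have "\<bar>F z u\<bar> \<le> K * d z * norm u" if z: "z \<in> P" for z u
  proof -
    have "F z u = F z (\<Sum>b\<in>Basis. (u \<bullet> b) *\<^sub>R b)"
      by (simp add: euclidean_representation)
    also have "\<dots> = (\<Sum>b\<in>Basis. (u \<bullet> b) * F z b)"
      using lin[OF z] by (simp add: linear_sum linear_cmul)
    finally have "\<bar>F z u\<bar> \<le> (\<Sum>b\<in>Basis. \<bar>(u \<bullet> b) * F z b\<bar>)"
      by (simp add: sum_abs)
    also have "\<dots> \<le> (\<Sum>b\<in>Basis. norm u * (\<bar>C b\<bar> * d z))"
    proof (rule sum_mono)
      fix b :: 'e assume b: "b \<in> Basis"
      have "\<bar>F z b\<bar> \<le> \<bar>C b\<bar> * d z"
        by (rule order_trans[OF C[OF z]]) (simp add: d z mult_right_mono)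
      then show "\<bar>(u \<bullet> b) * F z b\<bar> \<le> norm u * (\<bar>C b\<bar> * d z)"
        unfolding abs_mult by (intro mult_mono Basis_le_norm b) auto
    qed
    also have "\<dots> = K * d z * norm u"
      by (simp add: K_def sum_distrib_left sum_distrib_right mult_ac)
    finally show ?thesis .
  qed
  moreover have "K \<ge> 0"
    by (simp add: K_def sum_nonneg)
  ultimately show ?thesis by blast
qed

text \<open>The linear case is used twice: in \<open>w\<close> for fixed \<open>u\<close>, and then
  in \<open>u\<close> with \<open>w\<close> absorbed into the index, where the weight has become
  \<open>d z * norm w\<close>.\<close>

lemma bilinear_family_bound:
  fixes F :: "'z \<Rightarrow> 'e::euclidean_space \<Rightarrow> 'e \<Rightarrow> real"
  assumes lin1: "\<And>z w. z \<in> P \<Longrightarrow> linear (\<lambda>u. F z u w)"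
    and lin2: "\<And>z u. z \<in> P \<Longrightarrow> linear (F z u)"
    and bound: "\<And>u w. \<exists>C. \<forall>z\<in>P. \<bar>F z u w\<bar> \<le> C * d z"
    and d: "\<And>z. z \<in> P \<Longrightarrow> 0 \<le> d z"
  shows "\<exists>C\<ge>0. \<forall>z\<in>P. \<forall>u w. \<bar>F z u w\<bar> \<le> C * d z * norm u * norm w"
proof -
  have "\<exists>C. \<forall>y\<in>P \<times> UNIV. \<bar>F (fst y) u (snd y)\<bar> \<le> C * (d (fst y) * norm (snd y))" for u
  proof -
    have "\<exists>C\<ge>0. \<forall>z\<in>P. \<forall>w. \<bar>F z u w\<bar> \<le> C * d z * norm w"
      by (rule linear_family_bound[OF lin2 bound d])
    then obtain C where "\<forall>z\<in>P. \<forall>w. \<bar>F z u w\<bar> \<le> C * d z * norm w"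
      by blast
    then show ?thesis
      by (intro exI[of _ C]) (auto simp: mult.assoc)
  qed
  then have "\<exists>C\<ge>0. \<forall>y\<in>P \<times> UNIV. \<forall>u. \<bar>F (fst y) u (snd y)\<bar>
      \<le> C * (d (fst y) * norm (snd y)) * norm u"
    by (intro linear_family_bound) (auto simp: lin1 d)
  then obtain C where "C \<ge> 0"
    "\<forall>y\<in>P \<times> UNIV. \<forall>u. \<bar>F (fst y) u (snd y)\<bar> \<le> C * (d (fst y) * norm (snd y)) * norm u"
    by blast
  moreover have "\<bar>F z u w\<bar> \<le> C * d z * norm u * norm w" if "z \<in> P" for z u w
    using bspec[OF calculation(2), of "(z, w)"] that by (simp add: mult_ac)
  ultimately show ?thesis
    by blast
qed

lemma trilinear_family_bound:
  fixes F :: "'z \<Rightarrow> 'e::euclidean_space \<Rightarrow> 'e \<Rightarrow> 'e \<Rightarrow> real"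
  assumes lin1: "\<And>z v w. z \<in> P \<Longrightarrow> linear (\<lambda>u. F z u v w)"
    and lin2: "\<And>z u w. z \<in> P \<Longrightarrow> linear (\<lambda>v. F z u v w)"
    and lin3: "\<And>z u v. z \<in> P \<Longrightarrow> linear (F z u v)"
    and bound: "\<And>u v w. \<exists>C. \<forall>z\<in>P. \<bar>F z u v w\<bar> \<le> C * d z"
    and d: "\<And>z. z \<in> P \<Longrightarrow> 0 \<le> d z"
  shows "\<exists>C\<ge>0. \<forall>z\<in>P. \<forall>u v w. \<bar>F z u v w\<bar> \<le> C * d z * norm u * norm v * norm w"
proof -
  have "\<exists>C. \<forall>y\<in>P \<times> UNIV \<times> UNIV. \<bar>F (fst y) u (fst (snd y)) (snd (snd y))\<bar>
      \<le> C * (d (fst y) * norm (fst (snd y)) * norm (snd (snd y)))" for u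
  proof -
    have "\<exists>C\<ge>0. \<forall>z\<in>P. \<forall>v w. \<bar>F z u v w\<bar> \<le> C * d z * norm v * norm w"
      by (rule bilinear_family_bound[OF lin2 lin3 bound d])
    then obtain C where "\<forall>z\<in>P. \<forall>v w. \<bar>F z u v w\<bar> \<le> C * d z * norm v * norm w"
      by blast
    then show ?thesis
      by (intro exI[of _ C]) (auto simp: mult.assoc)
  qed
  then have "\<exists>C\<ge>0. \<forall>y\<in>P \<times> UNIV \<times> UNIV. \<forall>u. \<bar>F (fst y) u (fst (snd y)) (snd (snd y))\<bar>
      \<le> C * (d (fst y) * norm (fst (snd y)) * norm (snd (snd y))) * norm u"
    by (intro linear_family_bound) (auto simp: lin1 d)
  then obtain C where "C \<ge> 0"
    "\<forall>y\<in>P \<times> UNIV \<times> UNIV. \<forall>u. \<bar>F (fst y) u (fst (snd y)) (snd (snd y))\<bar>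
      \<le> C * (d (fst y) * norm (fst (snd y)) * norm (snd (snd y))) * norm u"
    by blast
  moreover have "\<bar>F z u v w\<bar> \<le> C * d z * norm u * norm v * norm w" if "z \<in> P" for z u v w
    using bspec[OF calculation(2), of "(z, v, w)"] that by (simp add: mult_ac)
  ultimately show ?thesis
    by blast
qed

section \<open>Smooth functions on compact convex sets\<close>

lemma Ck_on_imp_continuous_on:
  assumes "Ck_on k S f" shows "continuous_on S f"
  using assms
  by (cases k) (auto intro!: continuous_at_imp_continuous_on differentiable_imp_continuous_within)

lemma Ck_on_bounded_on_compact:
  assumes "Ck_on k S f" "compact B" "B \<subseteq> S"
  shows "\<exists>C. \<forall>x\<in>B. norm (f x) \<le> C"
proof -
  have "compact (f ` B)"
    using assms Ck_on_imp_continuous_on continuous_on_subset compact_continuous_image by metis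
  then show ?thesis
    by (metis compact_imp_bounded bounded_iff image_eqI)
qed

text \<open>Continuity of the derivative is available one direction at a time, so the bound on its
  operator norm has to come from \<open>linear_family_bound\<close>; convexity then admits the mean
  value inequality.\<close>

lemma Ck_on_Lipschitz_on_compact_convex:
  fixes f :: "'a::euclidean_space \<Rightarrow> real"
  assumes f: "Ck_on (Suc k) S f" and B: "compact B" "convex B" "B \<subseteq> S"
  shows "\<exists>C. \<forall>x\<in>B. \<forall>y\<in>B. \<bar>f x - f y\<bar> \<le> C * norm (x - y)"
proof -
  have diff: "f differentiable (at x)" if "x \<in> B" for x
    using that f B(3) unfolding Ck_on.simps by blast
  have "\<exists>C\<ge>0. \<forall>x\<in>B. \<forall>u. \<bar>frechet_derivative f (at x) u\<bar> \<le> C * 1 * norm u"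
  proof (rule linear_family_bound[where d = "\<lambda>_. 1"])
    show "linear (frechet_derivative f (at x))" if "x \<in> B" for x
      using diff[OF that] by (rule linear_frechet_derivative)
    have "Ck_on k S (\<lambda>x. frechet_derivative f (at x) u)" for u
      using f unfolding Ck_on.simps by blast
    from Ck_on_bounded_on_compact[OF this B(1,3)]
    show "\<exists>C. \<forall>x\<in>B. \<bar>frechet_derivative f (at x) u\<bar> \<le> C * 1" for u
      by simp
  qed simp
  then obtain C where C: "C \<ge> 0" "\<And>x u. x \<in> B \<Longrightarrow> \<bar>frechet_derivative f (at x) u\<bar> \<le> C * norm u"
    by auto
  have "norm (f x - f y) \<le> C * norm (x - y)" if "x \<in> B" "y \<in> B" for x y
  proof (rule differentiable_bound[OF B(2) _ _ that])
    show "(f has_derivative frechet_derivative f (at x)) (at x within B)" if "x \<in> B" for x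
      by (rule has_derivative_at_withinI) (use diff[OF that] frechet_derivative_works in blast)
    show "onorm (frechet_derivative f (at x)) \<le> C" if "x \<in> B" for x
      using C that by (intro onorm_bound) auto
  qed
  then show ?thesis by auto
qed

section \<open>Uniqueness by energy estimates\<close>

text \<open>The integrating factor \<open>exp (- K * t)\<close> turns the inequality into
  monotonicity, for \<open>K\<close> of either sign; a nonnegative quantity that starts at 0 and
  cannot grow stays 0.\<close>

lemma Gronwall_zero:
  fixes E :: "real \<Rightarrow> real"
  assumes cont: "continuous_on {a..b} E"
    and deriv: "\<And>t. a < t \<Longrightarrow> t < b \<Longrightarrow> (E has_real_derivative E' t) (at t)"
    and le: "\<And>t. a < t \<Longrightarrow> t < b \<Longrightarrow> E' t \<le> K * E t"
    and init: "E a = 0" and nonneg: "\<And>t. t \<in> {a..b} \<Longrightarrow> E t \<ge> 0" and t: "t \<in> {a..b}"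
  shows "E t = 0"
proof -
  have "E t * exp (- K * t) \<le> E a * exp (- K * a)"
  proof (rule DERIV_nonpos_imp_decreasing_open[where f = "\<lambda>t. E t * exp (- K * t)"])
    show "a \<le> t" using t by simp
    show "continuous_on {a..t} (\<lambda>t. E t * exp (- K * t))"
      using t by (intro continuous_intros continuous_on_subset[OF cont]) auto
    fix s assume s: "a < s" "s < t"
    have "((\<lambda>t. E t * exp (- K * t)) has_real_derivative (E' s - K * E s) * exp (- K * s)) (at s)"
      using s t by (auto intro!: derivative_eq_intros deriv simp: algebra_simps)
    moreover have "(E' s - K * E s) * exp (- K * s) \<le> 0"
      using le[of s] s t by (intro mult_nonpos_nonneg) auto
    ultimately show "\<exists>y. ((\<lambda>t. E t * exp (- K * t)) has_real_derivative y) (at s) \<and> y \<le> 0"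
      by blast
  qed
  then have "E t * exp (- K * t) \<le> 0" by (simp add: init)
  then show ?thesis using nonneg[OF t] by (simp add: mult_le_0_iff)
qed

lemma second_order_uniqueness:
  fixes q q1 q2 :: "real \<Rightarrow> 'e::euclidean_space"
  assumes q: "\<And>t. t \<in> {a..b} \<Longrightarrow> (q has_vector_derivative q1 t) (at t within {a..b})"
    and q1: "\<And>t. t \<in> {a..b} \<Longrightarrow> (q1 has_vector_derivative q2 t) (at t within {a..b})"
    and init: "q a = 0" "q1 a = 0"
    and le: "\<And>t. t \<in> {a..b} \<Longrightarrow> norm (q2 t) \<le> K * (norm (q t) + norm (q1 t))"
    and K: "K \<ge> 0" and t: "t \<in> {a..b}"
  shows "q t = 0"
proof -
  define E where "E = (\<lambda>t. q t \<bullet> q t + q1 t \<bullet> q1 t)"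
  have "E t = 0"
  \<comment> \<open>Cauchy-Schwarz and \<open>2 * (m * n) \<le> m\<^sup>2 + n\<^sup>2\<close> would
    already give the factor \<open>3 * K + 1\<close>; the one chosen leaves some slack.\<close>
  proof (rule Gronwall_zero[where E = E and t = t and a = a and b = b and E' = "\<lambda>t. 2 * (q t \<bullet> q1 t) + 2 * (q1 t \<bullet> q2 t)" and K = "4 * K + 2"])
    show "continuous_on {a..b} E"
      unfolding E_def
      by (intro continuous_intros continuous_on_vector_derivative[of _ q q1]
          continuous_on_vector_derivative[of _ q1 q2] q q1)
    fix s assume s: "a < s" "s < b"
    have at: "at s within {a..b} = at s"
      using s by (simp add: at_within_Icc_at)
    have "(q has_vector_derivative q1 s) (at s)" "(q1 has_vector_derivative q2 s) (at s)"
      using q[of s] q1[of s] s unfolding at by auto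
    then show "(E has_real_derivative 2 * (q s \<bullet> q1 s) + 2 * (q1 s \<bullet> q2 s)) (at s)"
      unfolding E_def has_vector_derivative_def has_field_derivative_def
      by (auto intro!: derivative_eq_intros simp: inner_commute algebra_simps)
    define m n where "m = norm (q s)" and "n = norm (q1 s)"
    have "q1 s \<bullet> q2 s \<le> n * (K * (m + n))"
      unfolding m_def n_def using le[of s] s
      by (intro order_trans[OF norm_cauchy_schwarz] mult_left_mono) auto
    also have "\<dots> = K * (m * n) + K * n\<^sup>2"
      by (simp add: algebra_simps power2_eq_square)
    finally have "q1 s \<bullet> q2 s \<le> K * (m * n) + K * n\<^sup>2" .
    moreover have "q s \<bullet> q1 s \<le> m * n"
      unfolding m_def n_def by (rule norm_cauchy_schwarz)
    moreover have mn: "2 * (m * n) \<le> m\<^sup>2 + n\<^sup>2"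
      using sum_squares_bound[of m n] by simp
    moreover have "2 * (K * (m * n)) \<le> K * m\<^sup>2 + K * n\<^sup>2"
      using mult_left_mono[OF mn K] by (simp add: algebra_simps)
    moreover have "K * n\<^sup>2 \<ge> 0" "K * m\<^sup>2 \<ge> 0" "n\<^sup>2 \<ge> 0" "m\<^sup>2 \<ge> 0" using K by auto
    moreover have "(4 * K + 2) * (m\<^sup>2 + n\<^sup>2) = 4 * (K * m\<^sup>2) + 4 * (K * n\<^sup>2) + 2 * m\<^sup>2 + 2 * n\<^sup>2"
      by (simp add: distrib_left distrib_right)
    ultimately have "2 * (q s \<bullet> q1 s) + 2 * (q1 s \<bullet> q2 s) \<le> (4 * K + 2) * (m\<^sup>2 + n\<^sup>2)"
      by linarith
    also have "m\<^sup>2 + n\<^sup>2 = E s"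
      by (simp add: E_def m_def n_def power2_norm_eq_inner)
    finally show "2 * (q s \<bullet> q1 s) + 2 * (q1 s \<bullet> q2 s) \<le> (4 * K + 2) * E s" .
  qed (use init t in \<open>auto simp: E_def\<close>)
  then show ?thesis
    by (simp add: E_def add_nonneg_eq_0_iff)
qed

text \<open>
  The second derivatives are not assumed continuous: their boundedness and the estimate
  \<open>\<parallel>q'' - r''\<parallel> \<le> K (\<parallel>q - r\<parallel> + \<parallel>q' - r'\<parallel>)\<close> both come from testing the equation with the vector to be
  estimated and using that \<open>G\<close> is uniformly positive definite.
\<close>

lemma quadratic_ode_uniqueness:
  fixes G :: "'e::euclidean_space \<Rightarrow> 'e \<Rightarrow> 'e \<Rightarrow> real" and \<Gamma> :: "'e \<Rightarrow> 'e \<Rightarrow> 'e \<Rightarrow> 'e \<Rightarrow> real"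
    and q r q1 r1 q2 r2 :: "real \<Rightarrow> 'e"
  assumes Glin: "\<And>p w. p \<in> B \<Longrightarrow> linear (\<lambda>u. G p u w)"
    and Gpos: "\<And>p u. p \<in> B \<Longrightarrow> \<mu> * (norm u)\<^sup>2 \<le> G p u u" and \<mu>: "\<mu> > 0"
    and Glip: "\<And>p p' u w. p \<in> B \<Longrightarrow> p' \<in> B \<Longrightarrow> \<bar>G p u w - G p' u w\<bar> \<le> C * norm (p - p') * norm u * norm w"
    and \<Gamma>lin1: "\<And>p v w. p \<in> B \<Longrightarrow> linear (\<lambda>u. \<Gamma> p u v w)"
    and \<Gamma>lin2: "\<And>p u w. p \<in> B \<Longrightarrow> linear (\<lambda>v. \<Gamma> p u v w)"
    and \<Gamma>bnd: "\<And>p u v w. p \<in> B \<Longrightarrow> \<bar>\<Gamma> p u v w\<bar> \<le> C * norm u * norm v * norm w"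
    and \<Gamma>lip: "\<And>p p' u v w. p \<in> B \<Longrightarrow> p' \<in> B \<Longrightarrow>
        \<bar>\<Gamma> p u v w - \<Gamma> p' u v w\<bar> \<le> C * norm (p - p') * norm u * norm v * norm w"
    and C: "C \<ge> 0"
    and q: "\<And>t. t \<in> {a..b} \<Longrightarrow> (q has_vector_derivative q1 t) (at t within {a..b})"
      "\<And>t. t \<in> {a..b} \<Longrightarrow> (q1 has_vector_derivative q2 t) (at t within {a..b})"
      "\<And>t w. t \<in> {a..b} \<Longrightarrow> G (q t) (q2 t) w + \<Gamma> (q t) (q1 t) (q1 t) w = 0"
      "\<And>t. t \<in> {a..b} \<Longrightarrow> q t \<in> B"
    and r: "\<And>t. t \<in> {a..b} \<Longrightarrow> (r has_vector_derivative r1 t) (at t within {a..b})"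
      "\<And>t. t \<in> {a..b} \<Longrightarrow> (r1 has_vector_derivative r2 t) (at t within {a..b})"
      "\<And>t w. t \<in> {a..b} \<Longrightarrow> G (r t) (r2 t) w + \<Gamma> (r t) (r1 t) (r1 t) w = 0"
      "\<And>t. t \<in> {a..b} \<Longrightarrow> r t \<in> B"
    and init: "q a = r a" "q1 a = r1 a" and t: "t \<in> {a..b}"
  shows "q t = r t"
proof -
  have "bounded (q1 ` {a..b} \<union> r1 ` {a..b})"
    using continuous_on_vector_derivative[OF q(2)] continuous_on_vector_derivative[OF r(2)]
    by (simp add: compact_imp_bounded compact_continuous_image)
  then obtain V where V0: "V > 0" and V: "\<And>t. t \<in> {a..b} \<Longrightarrow> norm (q1 t) \<le> V"
    "\<And>t. t \<in> {a..b} \<Longrightarrow> norm (r1 t) \<le> V"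
    unfolding bounded_pos by auto
  \<comment> \<open>A bound for the acceleration of \<open>r\<close>: the equation tested with
    \<open>r2 t\<close> bounds \<open>\<mu> * (norm (r2 t))\<^sup>2\<close> by
    \<open>C * V\<^sup>2 * norm (r2 t)\<close>.\<close>
  define A where "A = C * V\<^sup>2 / \<mu>"
  have r2: "norm (r2 t) \<le> A" if t: "t \<in> {a..b}" for t
  proof (cases "r2 t = 0")
    case False
    have "\<mu> * (norm (r2 t))\<^sup>2 \<le> G (r t) (r2 t) (r2 t)"
      by (rule Gpos[OF r(4)[OF t]])
    also have "\<dots> \<le> C * norm (r1 t) * norm (r1 t) * norm (r2 t)"
      using r(3)[OF t, of "r2 t"] \<Gamma>bnd[OF r(4)[OF t], of "r1 t" "r1 t" "r2 t"] by linarith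
    also have "\<dots> \<le> C * V * V * norm (r2 t)"
      using V(2)[OF t] C V0 by (intro mult_right_mono mult_mono) auto
    finally have "\<mu> * norm (r2 t) \<le> C * V\<^sup>2"
      using False by (simp add: power2_eq_square)
    then show ?thesis
      using \<mu> by (simp add: A_def field_simps)
  qed (use \<mu> C in \<open>simp add: A_def\<close>)
  \<comment> \<open>\<open>2 * C * V\<close> comes from changing the velocity in the two slots of
    \<Gamma>, \<open>C * V\<^sup>2\<close> from changing its base point, and \<open>C * A\<close>
    from changing the base point of \<open>G\<close> at the acceleration of
    \<open>r\<close>.\<close>
  define K where "K = (2 * C * V + C * V\<^sup>2 + C * A) / \<mu>"
  have A0: "A \<ge> 0" using C \<mu> by (simp add: A_def)
  have K0: "K \<ge> 0" using C \<mu> V0 A0 by (simp add: K_def)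
  have "(\<lambda>t. q t - r t) t = 0"
  proof (rule second_order_uniqueness[where q = "\<lambda>t. q t - r t" and t = t and a = a and b = b and ?q1.0 = "\<lambda>t. q1 t - r1 t" and ?q2.0 = "\<lambda>t. q2 t - r2 t" and K = K])
    fix t assume t: "t \<in> {a..b}"
    show "((\<lambda>t. q t - r t) has_vector_derivative q1 t - r1 t) (at t within {a..b})"
      by (intro derivative_intros q r t)
    show "((\<lambda>t. q1 t - r1 t) has_vector_derivative q2 t - r2 t) (at t within {a..b})"
      by (intro derivative_intros q r t)
    define d e z where "d = norm (q t - r t)" and "e = norm (q1 t - r1 t)" and "z = q2 t - r2 t"
    have nn: "d \<ge> 0" "e \<ge> 0" by (simp_all add: d_def e_def)
    have "norm z \<le> K * (d + e)"
    proof (cases "z = 0")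
      case False
      have "\<mu> * (norm z)\<^sup>2 \<le> G (q t) z z"
        by (rule Gpos[OF q(4)[OF t]])
      also have "\<dots> = G (q t) (q2 t) z - G (q t) (r2 t) z"
        using linear_diff[OF Glin[OF q(4)[OF t], of z], of "q2 t" "r2 t"] by (simp only: z_def)
      also have "\<dots> = \<Gamma> (r t) (r1 t) (r1 t) z - \<Gamma> (q t) (q1 t) (q1 t) z
          + (G (r t) (r2 t) z - G (q t) (r2 t) z)"
        using q(3)[OF t, of z] r(3)[OF t, of z] by linarith
      \<comment> \<open>One argument is exchanged at a time: the base point, then the first
        velocity, then the second.\<close>
      also have "\<Gamma> (r t) (r1 t) (r1 t) z - \<Gamma> (q t) (q1 t) (q1 t) z
          = (\<Gamma> (r t) (r1 t) (r1 t) z - \<Gamma> (q t) (r1 t) (r1 t) z)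
          + \<Gamma> (q t) (r1 t - q1 t) (r1 t) z + \<Gamma> (q t) (q1 t) (r1 t - q1 t) z"
        using linear_diff[OF \<Gamma>lin1[OF q(4)[OF t], of "r1 t" z], of "r1 t" "q1 t"]
          linear_diff[OF \<Gamma>lin2[OF q(4)[OF t], of "q1 t" z], of "r1 t" "q1 t"] by simp
      also have "\<dots> \<le> C * d * V * V * norm z + C * e * V * norm z + C * V * e * norm z"
      proof (intro add_mono)
        have "\<Gamma> (r t) (r1 t) (r1 t) z - \<Gamma> (q t) (r1 t) (r1 t) z \<le> C * norm (r t - q t) * norm (r1 t) * norm (r1 t) * norm z"
          using \<Gamma>lip[OF r(4)[OF t] q(4)[OF t], of "r1 t" "r1 t" z] by linarith
        also have "\<dots> \<le> C * d * V * V * norm z"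
          unfolding d_def norm_minus_commute[of "r t"] using V(2)[OF t] C V0
          by (intro mult_right_mono mult_mono) auto
        finally show "\<Gamma> (r t) (r1 t) (r1 t) z - \<Gamma> (q t) (r1 t) (r1 t) z \<le> C * d * V * V * norm z" .
        have "\<Gamma> (q t) (r1 t - q1 t) (r1 t) z \<le> C * norm (r1 t - q1 t) * norm (r1 t) * norm z"
          using \<Gamma>bnd[OF q(4)[OF t], of "r1 t - q1 t" "r1 t" z] by linarith
        also have "\<dots> \<le> C * e * V * norm z"
          unfolding e_def norm_minus_commute[of "r1 t"] using V(2)[OF t] C V0
          by (intro mult_right_mono mult_mono) auto
        finally show "\<Gamma> (q t) (r1 t - q1 t) (r1 t) z \<le> C * e * V * norm z" .
        have "\<Gamma> (q t) (q1 t) (r1 t - q1 t) z \<le> C * norm (q1 t) * norm (r1 t - q1 t) * norm z"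
          using \<Gamma>bnd[OF q(4)[OF t], of "q1 t" "r1 t - q1 t" z] by linarith
        also have "\<dots> \<le> C * V * e * norm z"
          unfolding e_def norm_minus_commute[of "r1 t"] using V(1)[OF t] C V0
          by (intro mult_right_mono mult_mono) auto
        finally show "\<Gamma> (q t) (q1 t) (r1 t - q1 t) z \<le> C * V * e * norm z" .
      qed
      also have "G (r t) (r2 t) z - G (q t) (r2 t) z \<le> C * d * A * norm z"
      proof -
        have "G (r t) (r2 t) z - G (q t) (r2 t) z \<le> C * norm (r t - q t) * norm (r2 t) * norm z"
          using Glip[OF r(4)[OF t] q(4)[OF t], of "r2 t" z] by linarith
        also have "\<dots> \<le> C * d * A * norm z"
          unfolding d_def norm_minus_commute[of "r t"] using r2[OF t] C A0
          by (intro mult_right_mono mult_mono) auto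
        finally show ?thesis .
      qed
      finally have "\<mu> * (norm z * norm z) \<le> (C * d * V * V + 2 * C * e * V + C * d * A) * norm z"
        by (simp add: algebra_simps power2_eq_square)
      then have "\<mu> * norm z \<le> C * d * V * V + 2 * C * e * V + C * d * A"
        using False by (simp add: mult.assoc[symmetric])
      also have "\<dots> \<le> (2 * C * V + C * V\<^sup>2 + C * A) * (d + e)"
        using nn C V0 A0 by (simp add: algebra_simps power2_eq_square)
      finally show ?thesis
        using \<mu> by (simp add: K_def field_simps)
    qed (simp add: K0 nn)
    then show "norm (q2 t - r2 t) \<le> K * (norm (q t - r t) + norm (q1 t - r1 t))"
      by (simp add: z_def d_def e_def)
  qed (use init t K0 in auto)
  then show ?thesis by simp
qed


section \<open>Charts, tangent vectors and gradients\<close>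

lemma linear_divide_real: "linear f \<Longrightarrow> linear (\<lambda>u. f u / r :: real)"
  by (auto simp: linear_iff add_divide_distrib)

text \<open>The implication under \<open>nhds\<close> is the form in which agreement near
  \<open>t\<close> is handed to \<open>has_vector_derivative_cong_ev\<close>; it covers the end
  points of \<open>I\<close> as well.\<close>

lemma eventually_in_open:
  assumes "continuous (at t within I) \<gamma>" "open V" "\<gamma> t \<in> V"
  shows "eventually (\<lambda>s. s \<in> I \<longrightarrow> \<gamma> s \<in> V) (nhds t)"
  using assms unfolding continuous_within_topological eventually_nhds by (metis (no_types))

text \<open>\<open>T\<close> is the Gram map, which represents \<open>g\<close> by the Euclidean
  inner product. Definiteness makes it injective, and finite dimension then makes it
  surjective.\<close>

lemma positive_definite_Riesz:
  fixes g :: "'e::euclidean_space \<Rightarrow> 'e \<Rightarrow> real"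
  assumes lin1: "\<And>w. linear (\<lambda>u. g u w)" and lin2: "\<And>u. linear (g u)"
    and pos: "\<And>u. u \<noteq> 0 \<Longrightarrow> g u u > 0" and l: "linear l"
  shows "\<exists>u. \<forall>w. g u w = l w"
proof -
  define T where "T u = (\<Sum>b\<in>Basis. g u b *\<^sub>R b)" for u
  have expand: "k w = (\<Sum>b\<in>Basis. k b *\<^sub>R b) \<bullet> w" if "linear k" for k :: "'e \<Rightarrow> real" and w
  proof -
    have "k w = k (\<Sum>b\<in>Basis. (w \<bullet> b) *\<^sub>R b)"
      by (simp add: euclidean_representation)
    also have "\<dots> = (\<Sum>b\<in>Basis. (w \<bullet> b) * k b)"
      using that by (simp add: linear_sum linear_cmul)
    also have "\<dots> = (\<Sum>b\<in>Basis. k b *\<^sub>R b) \<bullet> w"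
      by (simp add: inner_sum_left inner_commute[of w] mult.commute)
    finally show ?thesis .
  qed
  have T: "g u w = T u \<bullet> w" for u w
    unfolding T_def by (rule expand[OF lin2])
  have "linear T"
    unfolding T_def
    by (intro linearI) (simp_all add: linear_add[OF lin1] linear_cmul[OF lin1] scaleR_add_left sum.distrib scaleR_sum_right)
  moreover have "inj T"
    unfolding linear_injective_0[OF \<open>linear T\<close>] using pos T by fastforce
  ultimately have "surj T"
    by (rule linear_injective_imp_surjective) (rule refl)
  then obtain u where u: "(\<Sum>b\<in>Basis. l b *\<^sub>R b) = T u"
    by (blast dest: surjD)
  have "g u w = l w" for w
    unfolding T expand[OF l, of w] u by (rule refl)
  then show ?thesis by blast
qed

text \<open>Indexed by the point of the manifold instead of its coordinates, so that the cocycle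
  identity \<open>jac_jac\<close> reads without chart maps.\<close>

definition jac :: "('m, 'e::euclidean_space) chart \<Rightarrow> ('m, 'e) chart \<Rightarrow> 'm \<Rightarrow> 'e \<Rightarrow> 'e" where
  "jac c c' y = frechet_derivative (transition c c') (at (snd c y))"

locale riemannian =
  fixes M :: "('m::{t2_space,second_countable_topology}, 'e::euclidean_space) riem"
  assumes riemannian_manifold: "riemannian_manifold M"
begin

section \<open>Charts and changes of coordinates\<close>

lemma charts_at_nonempty: "\<exists>c. c \<in> charts_at M x"
  using riemannian_manifold unfolding riemannian_manifold_def smooth_atlas_def charts_at_def by blast

lemma charts_atD: "c \<in> charts_at M x \<Longrightarrow> c \<in> atlas M" "c \<in> charts_at M x \<Longrightarrow> x \<in> fst c"
  by (simp_all add: charts_at_def)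

lemma charts_atI: "c \<in> atlas M \<Longrightarrow> x \<in> fst c \<Longrightarrow> c \<in> charts_at M x"
  by (simp add: charts_at_def)

context
  fixes c assumes c: "c \<in> atlas M"
begin

lemma is_chart: "is_chart c"
  using c riemannian_manifold unfolding riemannian_manifold_def smooth_atlas_def by blast

lemma open_chart_domain: "open (fst c)" and open_chart_image: "open (snd c ` fst c)"
  using is_chart by (simp_all add: is_chart_def)

lemma chart_inv_chart: "y \<in> fst c \<Longrightarrow> chart_inv c (snd c y) = y"
  using is_chart by (auto simp: is_chart_def homeomorphism_def)

lemma chart_chart_inv: "p \<in> snd c ` fst c \<Longrightarrow> snd c (chart_inv c p) = p"
  using is_chart by (auto simp: is_chart_def homeomorphism_def)

lemma chart_inv_in_domain: "p \<in> snd c ` fst c \<Longrightarrow> chart_inv c p \<in> fst c"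
  using is_chart by (auto simp: is_chart_def homeomorphism_def)

lemma continuous_on_chart: "continuous_on (fst c) (snd c)"
  and continuous_on_chart_inv: "continuous_on (snd c ` fst c) (chart_inv c)"
  using is_chart by (auto simp: is_chart_def homeomorphism_def)

lemma open_chart_image_Int:
  assumes "open V" shows "open (snd c ` (fst c \<inter> V))"
proof -
  have "snd c ` (fst c \<inter> V) = snd c ` fst c \<inter> chart_inv c -` V"
    using chart_inv_chart by force
  then show ?thesis
    using continuous_open_preimage[OF continuous_on_chart_inv open_chart_image assms] by simp
qed

lemma metric_coord_Ck_on: "Ck_on k (snd c ` fst c) (\<lambda>p. metric_coord M c p u w)"
  using riemannian_manifold c by (simp add: riemannian_manifold_def smooth_on_def)

end

lemma transition_Ck_on:
  assumes "c \<in> atlas M" "c' \<in> atlas M"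
  shows "Ck_on k (snd c ` (fst c \<inter> fst c')) (transition c c')"
  using riemannian_manifold assms
  by (auto simp: riemannian_manifold_def smooth_atlas_def smooth_on_def)

lemma transition_chart:
  assumes "c \<in> atlas M" "y \<in> fst c" shows "transition c c' (snd c y) = snd c' y"
  using assms by (simp add: transition_def chart_inv_chart)

lemma transition_has_derivative:
  assumes "c \<in> charts_at M y" "c' \<in> charts_at M y"
  shows "(transition c c' has_derivative jac c c' y) (at (snd c y))"
proof -
  have "Ck_on (Suc 0) (snd c ` (fst c \<inter> fst c')) (transition c c')"
    using assms charts_atD transition_Ck_on by blast
  then have "transition c c' differentiable (at (snd c y))"
    unfolding Ck_on.simps using assms charts_atD(2) by blast
  then show ?thesis
    unfolding jac_def using frechet_derivative_works by blast
qed

lemma linear_jac: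
  assumes "c \<in> charts_at M y" "c' \<in> charts_at M y" shows "linear (jac c c' y)"
  using transition_has_derivative[OF assms] by (rule has_derivative_linear)

text \<open>Chain rule. The composite of the two transitions is identified with
  \<open>transition c c''\<close> on the coordinate image of the overlap of \<open>c\<close> and
  \<open>c'\<close>, whose openness lets the derivative be transferred.\<close>

lemma jac_jac:
  assumes c: "c \<in> charts_at M y" "c' \<in> charts_at M y" "c'' \<in> charts_at M y"
  shows "jac c' c'' y (jac c c' y u) = jac c c'' y u"
proof -
  note D = charts_atD[OF c(1)] charts_atD[OF c(2)] charts_atD[OF c(3)]
  have "((\<lambda>p. transition c' c'' (transition c c' p)) has_derivative (\<lambda>u. jac c' c'' y (jac c c' y u)))
      (at (snd c y))"
    by (rule has_derivative_compose[OF transition_has_derivative[OF c(1,2)]])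
      (use transition_has_derivative[OF c(2,3)] in \<open>simp add: transition_chart D\<close>)
  then have "(transition c c'' has_derivative (\<lambda>u. jac c' c'' y (jac c c' y u))) (at (snd c y))"
  proof (rule has_derivative_transform_within_open)
    show "open (snd c ` (fst c \<inter> fst c'))"
      using D by (intro open_chart_image_Int open_chart_domain)
  qed (use D in \<open>auto simp: transition_chart\<close>)
  from has_derivative_unique[OF this transition_has_derivative[OF c(1,3)]]
  show ?thesis by (rule fun_cong)
qed

lemma jac_self:
  assumes c: "c \<in> charts_at M y" shows "jac c c y u = u"
proof -
  note D = charts_atD[OF c]
  have "(transition c c has_derivative (\<lambda>u. u)) (at (snd c y))"
  proof (rule has_derivative_transform_within_open[OF has_derivative_ident])
    show "open (snd c ` fst c)" using D by (intro open_chart_image)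
  qed (use D in \<open>auto simp: transition_chart\<close>)
  from has_derivative_unique[OF this transition_has_derivative[OF c c]]
  show ?thesis by metis
qed

section \<open>Tangent vectors and the metric in coordinates\<close>

lemma tangent_spaceI:
  assumes "\<And>c. c \<notin> charts_at M x \<Longrightarrow> v c = 0"
    "\<And>c c'. c \<in> charts_at M x \<Longrightarrow> c' \<in> charts_at M x \<Longrightarrow> v c' = jac c c' x (v c)"
  shows "v \<in> tangent_space M x"
  using assms unfolding tangent_space_def jac_def by blast

lemma tangent_spaceD:
  assumes "v \<in> tangent_space M x"
  shows "c \<notin> charts_at M x \<Longrightarrow> v c = 0"
    "c \<in> charts_at M x \<Longrightarrow> c' \<in> charts_at M x \<Longrightarrow> v c' = jac c c' x (v c)"
  using assms unfolding tangent_space_def jac_def by blast+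

lemma coord_tangent_eq:
  "coord_tangent M c x u c' = (if c' \<in> charts_at M x then jac c c' x u else 0)"
  by (simp add: coord_tangent_def jac_def)

lemma coord_tangent_in_tangent_space:
  "c \<in> charts_at M x \<Longrightarrow> coord_tangent M c x u \<in> tangent_space M x"
  by (rule tangent_spaceI) (simp_all add: coord_tangent_eq jac_jac)

lemma coord_tangent_self: "c \<in> charts_at M x \<Longrightarrow> coord_tangent M c x u c = u"
  by (simp add: coord_tangent_eq jac_self)

lemma coord_tangent_coord:
  assumes "v \<in> tangent_space M x" "c \<in> charts_at M x"
  shows "coord_tangent M c x (v c) = v"
proof
  show "coord_tangent M c x (v c) c' = v c'" for c'
    unfolding coord_tangent_eq
    using tangent_spaceD(1)[OF assms(1)] tangent_spaceD(2)[OF assms, of c'] by metis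
qed

lemma tangent_eqI:
  assumes "u \<in> tangent_space M x" "v \<in> tangent_space M x" "c \<in> charts_at M x" "u c = v c"
  shows "u = v"
  using assms coord_tangent_coord by metis

lemma coord_tangent_add:
  "c \<in> charts_at M x \<Longrightarrow> coord_tangent M c x (u + w) = tadd (coord_tangent M c x u) (coord_tangent M c x w)"
  by (auto simp: tadd_def coord_tangent_eq linear_jac linear_add)

lemma coord_tangent_scale:
  "c \<in> charts_at M x \<Longrightarrow> coord_tangent M c x (r *\<^sub>R u) = tscale r (coord_tangent M c x u)"
  by (auto simp: tscale_def coord_tangent_eq linear_jac linear_cmul)

lemma tscale_in_tangent_space: "u \<in> tangent_space M x \<Longrightarrow> tscale r u \<in> tangent_space M x"
  using charts_at_nonempty[of x] coord_tangent_coord coord_tangent_scale coord_tangent_in_tangent_space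
  by metis

lemma inner_product: "inner_product_on_tangent M x"
  using riemannian_manifold by (simp add: riemannian_manifold_def)

lemma metric_sym:
  "u \<in> tangent_space M x \<Longrightarrow> v \<in> tangent_space M x \<Longrightarrow> metric M x u v = metric M x v u"
  using inner_product by (simp add: inner_product_on_tangent_def)

lemma metric_add:
  "u \<in> tangent_space M x \<Longrightarrow> v \<in> tangent_space M x \<Longrightarrow> w \<in> tangent_space M x \<Longrightarrow>
    metric M x (tadd u v) w = metric M x u w + metric M x v w"
  using inner_product by (simp add: inner_product_on_tangent_def)

lemma metric_scale:
  "u \<in> tangent_space M x \<Longrightarrow> w \<in> tangent_space M x \<Longrightarrow> metric M x (tscale r u) w = r * metric M x u w"
  using inner_product by (simp add: inner_product_on_tangent_def)

lemma metric_pos: "u \<in> tangent_space M x \<Longrightarrow> u \<noteq> (\<lambda>c. 0) \<Longrightarrow> metric M x u u > 0"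
  using inner_product by (simp add: inner_product_on_tangent_def)

lemma metric_scale_right:
  "u \<in> tangent_space M x \<Longrightarrow> w \<in> tangent_space M x \<Longrightarrow> metric M x u (tscale r w) = r * metric M x u w"
  using metric_sym metric_scale tscale_in_tangent_space by metis

context
  fixes c p assumes c: "c \<in> atlas M" and p: "p \<in> snd c ` fst c"
begin

lemma chart_inv_charts_at: "c \<in> charts_at M (chart_inv c p)"
  using c p by (simp add: charts_at_def chart_inv_in_domain)

lemma metric_coord_sym: "metric_coord M c p u w = metric_coord M c p w u"
  unfolding metric_coord_def
  by (intro metric_sym coord_tangent_in_tangent_space chart_inv_charts_at)

lemma linear_metric_coord_left: "linear (\<lambda>u. metric_coord M c p u w)"
  unfolding metric_coord_def using chart_inv_charts_at
  by (intro linearI)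
    (simp_all add: coord_tangent_add coord_tangent_scale metric_add metric_scale
      coord_tangent_in_tangent_space)

lemma linear_metric_coord_right: "linear (metric_coord M c p u)"
proof -
  have "metric_coord M c p u = (\<lambda>w. metric_coord M c p w u)"
    by (rule ext) (rule metric_coord_sym)
  then show ?thesis
    by (simp only: linear_metric_coord_left)
qed

lemma metric_coord_pos:
  assumes "u \<noteq> 0" shows "metric_coord M c p u u > 0"
  unfolding metric_coord_def
proof (intro metric_pos coord_tangent_in_tangent_space chart_inv_charts_at)
  have "coord_tangent M c (chart_inv c p) u c = u"
    by (rule coord_tangent_self[OF chart_inv_charts_at])
  then show "coord_tangent M c (chart_inv c p) u \<noteq> (\<lambda>c. 0)"
    using assms by auto
qed

lemma metric_coord_nonneg: "metric_coord M c p u u \<ge> 0"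
  using metric_coord_pos[of u] linear_0[OF linear_metric_coord_left] by (cases "u = 0") auto

lemma metric_coord_has_derivative:
  "((\<lambda>q. metric_coord M c q u w) has_derivative
     frechet_derivative (\<lambda>q. metric_coord M c q u w) (at p)) (at p)"
proof -
  have "Ck_on (Suc 0) (snd c ` fst c) (\<lambda>p. metric_coord M c p u w)"
    by (rule metric_coord_Ck_on[OF c])
  then show ?thesis
    unfolding Ck_on.simps using p frechet_derivative_works by blast
qed

end

lemma metric_coord_nondegenerate:
  assumes "c \<in> atlas M" "p \<in> snd c ` fst c" "\<And>w. metric_coord M c p u w = metric_coord M c p u' w"
  shows "u = u'"
proof (rule ccontr)
  assume "u \<noteq> u'"
  then have "metric_coord M c p (u - u') (u - u') > 0"
    using metric_coord_pos assms(1,2) by simp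
  also have "metric_coord M c p (u - u') (u - u')
      = metric_coord M c p u (u - u') - metric_coord M c p u' (u - u')"
    using linear_diff[OF linear_metric_coord_left[OF assms(1,2)]] .
  finally show False using assms(3) by simp
qed

lemma metric_eq_coord:
  assumes "c \<in> charts_at M x" "u \<in> tangent_space M x" "w \<in> tangent_space M x"
  shows "metric M x u w = metric_coord M c (snd c x) (u c) (w c)"
  using assms by (simp add: metric_coord_def chart_inv_chart charts_atD coord_tangent_coord)

lemma metric_nonneg: "u \<in> tangent_space M x \<Longrightarrow> metric M x u u \<ge> 0"
  using charts_at_nonempty[of x] metric_eq_coord charts_atD metric_coord_nonneg imageI by metis

lemma rnorm_nonneg: "u \<in> tangent_space M x \<Longrightarrow> rnorm M x u \<ge> 0"
  by (simp add: rnorm_def metric_nonneg)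

lemma rnorm_tscale: "u \<in> tangent_space M x \<Longrightarrow> rnorm M x (tscale r u) = \<bar>r\<bar> * rnorm M x u"
  by (simp add: rnorm_def metric_scale metric_scale_right tscale_in_tangent_space real_sqrt_mult
      flip: mult.assoc)

text \<open>Bilinearity of \<open>metric_coord\<close> holds on the chart image, so linearity of its
  derivative in a parameter cannot come from an identity of functions; \<open>tr\<close> allows any
  function agreeing there to be differentiated instead.\<close>

lemma linear_frechet_metric_coord_left:
  assumes c: "c \<in> atlas M" and p: "p \<in> snd c ` fst c"
  shows "linear (\<lambda>v. frechet_derivative (\<lambda>q. metric_coord M c q v w) (at p) u)"
proof (rule linearI)
  let ?D = "\<lambda>v. frechet_derivative (\<lambda>q. metric_coord M c q v w) (at p)"
  have tr: "?D v = D" if "(g has_derivative D) (at p)"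
    and "\<And>q. q \<in> snd c ` fst c \<Longrightarrow> g q = metric_coord M c q v w" for v g D
    using has_derivative_transform_within_open[OF that(1) open_chart_image[OF c] p that(2)]
    by (rule frechet_derivative_at[symmetric])
  show "?D (v + v') u = ?D v u + ?D v' u" for v v'
    by (subst tr[OF has_derivative_add[OF metric_coord_has_derivative[OF c p, of v w]
          metric_coord_has_derivative[OF c p, of v' w]]])
      (simp_all add: linear_add[OF linear_metric_coord_left[OF c]])
  show "?D (r *\<^sub>R v) u = r *\<^sub>R ?D v u" for r v
    by (subst tr[OF has_derivative_scaleR_right[OF metric_coord_has_derivative[OF c p, of v w], of r]])
      (simp_all add: linear_cmul[OF linear_metric_coord_left[OF c]])
qed

lemma frechet_metric_coord_sym:
  assumes c: "c \<in> atlas M" and p: "p \<in> snd c ` fst c"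
  shows "frechet_derivative (\<lambda>q. metric_coord M c q v w) (at p)
    = frechet_derivative (\<lambda>q. metric_coord M c q w v) (at p)"
  using has_derivative_transform_within_open[OF metric_coord_has_derivative[OF c p, of v w]
      open_chart_image[OF c] p metric_coord_sym[OF c]]
  by (rule frechet_derivative_at)

lemma linear_frechet_metric_coord_right:
  assumes c: "c \<in> atlas M" and p: "p \<in> snd c ` fst c"
  shows "linear (\<lambda>w. frechet_derivative (\<lambda>q. metric_coord M c q v w) (at p) u)"
  unfolding frechet_metric_coord_sym[OF assms, of v] by (rule linear_frechet_metric_coord_left[OF assms])

lemma linear_frechet_metric_coord:
  assumes c: "c \<in> atlas M" and p: "p \<in> snd c ` fst c"
  shows "linear (\<lambda>u. frechet_derivative (\<lambda>q. metric_coord M c q v w) (at p) u)"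
  by (rule has_derivative_linear[OF metric_coord_has_derivative[OF assms]])

lemma christoffel_linear:
  assumes "c \<in> atlas M" "p \<in> snd c ` fst c"
  shows "linear (\<lambda>u. christoffel M c p u v w)"
    "linear (\<lambda>v. christoffel M c p u v w)"
    "linear (\<lambda>w. christoffel M c p u v w)"
  unfolding christoffel_def
  by (intro linear_divide_real linear_compose_add linear_compose_sub
      linear_frechet_metric_coord_left linear_frechet_metric_coord_right
      linear_frechet_metric_coord assms)+

text \<open>Two of the three derivative terms cancel on the diagonal. What remains is half the
  change of the metric along \<open>u\<close>, the source of constant speed.\<close>

lemma christoffel_diagonal:
  assumes "c \<in> atlas M" "p \<in> snd c ` fst c"
  shows "christoffel M c p u u u = frechet_derivative (\<lambda>q. metric_coord M c q u u) (at p) u / 2"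
  by (simp add: christoffel_def)

section \<open>Velocities and gradients\<close>

text \<open>Continuity keeps \<gamma> in the domain of \<open>c\<close> near \<open>t\<close>, where
  the two coordinate curves differ by the transition map; the rest is the chain rule.\<close>

lemma chart_change_has_vector_derivative:
  assumes u: "(snd c \<circ> \<gamma> has_vector_derivative u) (at t within I)" and t: "t \<in> I"
    and c: "c \<in> charts_at M (\<gamma> t)" "c' \<in> charts_at M (\<gamma> t)" and cont: "continuous (at t within I) \<gamma>"
  shows "(snd c' \<circ> \<gamma> has_vector_derivative jac c c' (\<gamma> t) u) (at t within I)"
proof -
  have "((\<lambda>s. transition c c' ((snd c \<circ> \<gamma>) s)) has_derivative (\<lambda>r. jac c c' (\<gamma> t) (r *\<^sub>R u)))
      (at t within I)"
    by (rule has_derivative_compose[OF u[unfolded has_vector_derivative_def]])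
      (simp add: transition_has_derivative[OF c])
  then have "((\<lambda>s. transition c c' ((snd c \<circ> \<gamma>) s)) has_vector_derivative jac c c' (\<gamma> t) u)
      (at t within I)"
    by (simp add: has_vector_derivative_def linear_cmul[OF linear_jac[OF c]])
  moreover have ev: "eventually (\<lambda>s. s \<in> I \<longrightarrow> transition c c' ((snd c \<circ> \<gamma>) s) = (snd c' \<circ> \<gamma>) s) (nhds t)"
    using eventually_in_open[OF cont open_chart_domain[OF charts_atD(1)[OF c(1)]] charts_atD(2)[OF c(1)]]
    by (rule eventually_mono) (simp add: transition_chart[OF charts_atD(1)[OF c(1)]])
  moreover have "transition c c' ((snd c \<circ> \<gamma>) t) = (snd c' \<circ> \<gamma>) t"
    using eventually_nhds_x_imp_x[OF ev] t by blast
  ultimately show ?thesis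
    using has_vector_derivative_cong_ev[OF ev] by blast
qed

lemma velocity_in_tangent_space:
  assumes "t \<in> I" "at t within I \<noteq> bot" "continuous (at t within I) \<gamma>"
    and diff: "\<And>c. c \<in> charts_at M (\<gamma> t) \<Longrightarrow> (snd c \<circ> \<gamma>) differentiable (at t within I)"
  shows "velocity M I \<gamma> t \<in> tangent_space M (\<gamma> t)"
proof (rule tangent_spaceI)
  fix c c' assume c: "c \<in> charts_at M (\<gamma> t)" "c' \<in> charts_at M (\<gamma> t)"
  have "(snd c' \<circ> \<gamma> has_vector_derivative jac c c' (\<gamma> t) (vector_derivative (snd c \<circ> \<gamma>) (at t within I)))
      (at t within I)"
    using assms c diff[OF c(1)]
    by (intro chart_change_has_vector_derivative) (auto simp: vector_derivative_works)
  then show "velocity M I \<gamma> t c' = jac c c' (\<gamma> t) (velocity M I \<gamma> t c)"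
    using c by (simp add: velocity_def vector_derivative_within[OF assms(2)])
qed (simp add: velocity_def)

text \<open>The description in \<open>grad\<close> is resolved in a single chart: the Riesz lemma
  produces a candidate and nondegeneracy makes it unique. That all charts give the same answer is
  \<open>l_change\<close>, the transformation law of a covector.\<close>

lemma grad:
  assumes f: "differentiable_at_point M f x"
  shows grad_in_tangent_space: "grad M f x \<in> tangent_space M x"
    and metric_grad: "\<And>w c. w \<in> tangent_space M x \<Longrightarrow> c \<in> charts_at M x \<Longrightarrow>
      metric M x (grad M f x) w = frechet_derivative (f \<circ> chart_inv c) (at (snd c x)) (w c)"
proof -
  let ?P = "\<lambda>u. u \<in> tangent_space M x \<and>
        (\<forall>w\<in>tangent_space M x. \<forall>c\<in>charts_at M x.
           metric M x u w = frechet_derivative (f \<circ> chart_inv c) (at (snd c x)) (w c))"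
  let ?l = "\<lambda>c. frechet_derivative (f \<circ> chart_inv c) (at (snd c x))"
  have l: "(f \<circ> chart_inv c has_derivative ?l c) (at (snd c x))" if "c \<in> charts_at M x" for c
    using f that unfolding differentiable_at_point_def frechet_derivative_works by blast
  have l_change: "?l c u = ?l c' (jac c c' x u)" if c: "c \<in> charts_at M x" "c' \<in> charts_at M x" for c c' u
  proof -
    note D = charts_atD[OF c(1)] charts_atD[OF c(2)]
    have "((\<lambda>p. (f \<circ> chart_inv c') (transition c c' p)) has_derivative (\<lambda>u. ?l c' (jac c c' x u)))
        (at (snd c x))"
      by (rule has_derivative_compose[OF transition_has_derivative[OF c]])
        (simp only: transition_chart[OF D(1,2)] l[OF c(2)])
    then have "(f \<circ> chart_inv c has_derivative (\<lambda>u. ?l c' (jac c c' x u))) (at (snd c x))"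
    proof (rule has_derivative_transform_within_open)
      show "open (snd c ` (fst c \<inter> fst c'))"
        using D by (intro open_chart_image_Int open_chart_domain)
    qed (use D in \<open>auto simp: transition_chart chart_inv_chart\<close>)
    from has_derivative_unique[OF this l[OF c(1)]] show ?thesis by metis
  qed
  obtain c where c: "c \<in> charts_at M x"
    using charts_at_nonempty by blast
  note D = charts_atD[OF c]
  have p: "snd c x \<in> snd c ` fst c" using D by simp
  obtain u where u: "\<And>w. metric_coord M c (snd c x) u w = ?l c w"
    using positive_definite_Riesz[of "metric_coord M c (snd c x)" "?l c"]
      linear_metric_coord_left[OF D(1) p] linear_metric_coord_right[OF D(1) p]
      metric_coord_pos[OF D(1) p] has_derivative_linear[OF l[OF c]] by blast
  let ?u = "coord_tangent M c x u"
  have "?P ?u"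
  proof (intro conjI ballI)
    fix w c' assume w: "w \<in> tangent_space M x" and c': "c' \<in> charts_at M x"
    have "metric M x ?u w = ?l c (w c)"
      using metric_eq_coord[OF c coord_tangent_in_tangent_space[OF c] w]
      by (simp add: coord_tangent_self c u)
    also have "\<dots> = ?l c' (w c')"
      using l_change[OF c c'] tangent_spaceD(2)[OF w c c'] by simp
    finally show "metric M x ?u w = ?l c' (w c')" .
  qed (rule coord_tangent_in_tangent_space[OF c])
  moreover have "v = ?u" if "?P v" for v
  proof (rule tangent_eqI[OF _ _ c])
    show "v c = ?u c"
    proof (rule metric_coord_nondegenerate[OF D(1) p])
      fix w
      let ?w = "coord_tangent M c x w"
      have w: "?w \<in> tangent_space M x" by (rule coord_tangent_in_tangent_space[OF c])
      have "metric M x v ?w = metric M x ?u ?w"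
        using that \<open>?P ?u\<close> w c by metis
      then show "metric_coord M c (snd c x) (v c) w = metric_coord M c (snd c x) (?u c) w"
        using that \<open>?P ?u\<close> w c by (simp add: metric_eq_coord[OF c] coord_tangent_self)
    qed
  qed (use that \<open>?P ?u\<close> in blast)+
  ultimately have "?P (grad M f x)"
    unfolding grad_def by (rule theI)
  then show "grad M f x \<in> tangent_space M x"
    and "\<And>w c. w \<in> tangent_space M x \<Longrightarrow> c \<in> charts_at M x \<Longrightarrow>
      metric M x (grad M f x) w = ?l c (w c)"
    by blast+
qed


section \<open>Geodesics and the exponential map\<close>

lemma geodesic_on_continuous: "geodesic_on M I \<gamma> \<Longrightarrow> t \<in> I \<Longrightarrow> continuous (at t within I) \<gamma>"
  by (simp add: geodesic_on_def continuous_on_eq_continuous_within)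

lemma geodesic_onD:
  assumes "geodesic_on M I \<gamma>" "t \<in> I" "c \<in> charts_at M (\<gamma> t)"
  defines "q1 \<equiv> \<lambda>s. vector_derivative (snd c \<circ> \<gamma>) (at s within I)"
  shows "(snd c \<circ> \<gamma> has_vector_derivative q1 t) (at t within I)"
    and "(q1 has_vector_derivative vector_derivative q1 (at t within I)) (at t within I)"
    and "metric_coord M c ((snd c \<circ> \<gamma>) t) (vector_derivative q1 (at t within I)) w
      + christoffel M c ((snd c \<circ> \<gamma>) t) (q1 t) (q1 t) w = 0"
  using assms(1,2) charts_atD[OF assms(3)]
  unfolding geodesic_on_def Let_def vector_derivative_works q1_def by blast+

text \<open>Allows derivatives to be exhibited by candidates in place of
  \<open>vector_derivative\<close>. A candidate \<open>q1 c\<close> is the derivative only while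
  \<gamma> stays in the domain of \<open>c\<close>, so the second derivative is compared near
  \<open>t\<close> only.\<close>

lemma geodesic_onI:
  assumes cont: "continuous_on I \<gamma>" and nontriv: "\<And>t. t \<in> I \<Longrightarrow> at t within I \<noteq> bot"
    and q: "\<And>c t. c \<in> atlas M \<Longrightarrow> t \<in> I \<Longrightarrow> \<gamma> t \<in> fst c \<Longrightarrow>
      (snd c \<circ> \<gamma> has_vector_derivative q1 c t) (at t within I)"
    and q1: "\<And>c t. c \<in> atlas M \<Longrightarrow> t \<in> I \<Longrightarrow> \<gamma> t \<in> fst c \<Longrightarrow>
      (q1 c has_vector_derivative q2 c t) (at t within I)"
    and eq: "\<And>c t w. c \<in> atlas M \<Longrightarrow> t \<in> I \<Longrightarrow> \<gamma> t \<in> fst c \<Longrightarrow>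
      metric_coord M c ((snd c \<circ> \<gamma>) t) (q2 c t) w + christoffel M c ((snd c \<circ> \<gamma>) t) (q1 c t) (q1 c t) w = 0"
  shows "geodesic_on M I \<gamma>"
  unfolding geodesic_on_def Let_def
proof (intro conjI ballI allI impI cont)
  fix c t assume c: "c \<in> atlas M" and t: "t \<in> I" and dom: "\<gamma> t \<in> fst c"
  have q1_eq: "vector_derivative (snd c \<circ> \<gamma>) (at s within I) = q1 c s" if "s \<in> I" "\<gamma> s \<in> fst c" for s
    using vector_derivative_within[OF nontriv q] c that by blast
  have ev: "eventually (\<lambda>s. s \<in> I \<longrightarrow> vector_derivative (snd c \<circ> \<gamma>) (at s within I) = q1 c s) (nhds t)"
  proof (rule eventually_mono)
    show "eventually (\<lambda>s. s \<in> I \<longrightarrow> \<gamma> s \<in> fst c) (nhds t)"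
      using cont t dom
      by (intro eventually_in_open open_chart_domain c) (simp_all add: continuous_on_eq_continuous_within)
  qed (simp add: q1_eq)
  have q1': "((\<lambda>s. vector_derivative (snd c \<circ> \<gamma>) (at s within I)) has_vector_derivative q2 c t) (at t within I)"
    using has_vector_derivative_cong_ev[OF ev q1_eq[OF t dom]] q1[OF c t dom] by blast
  note q2_eq = vector_derivative_within[OF nontriv[OF t] q1']
  show "(snd c \<circ> \<gamma>) differentiable (at t within I)"
    using q[OF c t dom] by (rule differentiableI_vector)
  show "(\<lambda>s. vector_derivative (snd c \<circ> \<gamma>) (at s within I)) differentiable (at t within I)"
    using q1' by (rule differentiableI_vector)
  show "metric_coord M c ((snd c \<circ> \<gamma>) t)
          (vector_derivative (\<lambda>s. vector_derivative (snd c \<circ> \<gamma>) (at s within I)) (at t within I)) w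
       + christoffel M c ((snd c \<circ> \<gamma>) t) (vector_derivative (snd c \<circ> \<gamma>) (at t within I))
          (vector_derivative (snd c \<circ> \<gamma>) (at t within I)) w = 0" for w
    unfolding q2_eq q1_eq[OF t dom] by (rule eq[OF c t dom])
qed

text \<open>\<open>nontriv\<close> excludes isolated points of \<open>J\<close>, at which a
  derivative within \<open>J\<close> is not determined.\<close>

lemma geodesic_on_subset:
  assumes \<gamma>: "geodesic_on M I \<gamma>" and J: "J \<subseteq> I" and nontriv: "\<And>t. t \<in> J \<Longrightarrow> at t within J \<noteq> bot"
  shows "geodesic_on M J \<gamma>"
    and "t \<in> J \<Longrightarrow> velocity M J \<gamma> t = velocity M I \<gamma> t"
proof -
  let ?q1 = "\<lambda>c s. vector_derivative (snd c \<circ> \<gamma>) (at s within I)"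
  have q: "(snd c \<circ> \<gamma> has_vector_derivative ?q1 c t) (at t within J)"
    if "c \<in> charts_at M (\<gamma> t)" "t \<in> J" for c t
    using geodesic_onD(1)[OF \<gamma> _ that(1)] that(2) J has_vector_derivative_within_subset by blast
  show "geodesic_on M J \<gamma>"
  proof (rule geodesic_onI[where ?q1.0 = ?q1 and ?q2.0 = "\<lambda>c t. vector_derivative (?q1 c) (at t within I)"])
    show "continuous_on J \<gamma>"
      using \<gamma> J continuous_on_subset by (auto simp: geodesic_on_def)
    fix c t assume c: "c \<in> atlas M" "\<gamma> t \<in> fst c" and t: "t \<in> J"
    have c': "c \<in> charts_at M (\<gamma> t)" using c by (simp add: charts_at_def)
    have t': "t \<in> I" using t J by blast
    show "(snd c \<circ> \<gamma> has_vector_derivative ?q1 c t) (at t within J)"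
      by (rule q[OF c' t])
    show "(?q1 c has_vector_derivative vector_derivative (?q1 c) (at t within I)) (at t within J)"
      using geodesic_onD(2)[OF \<gamma> t' c'] J by (rule has_vector_derivative_within_subset)
    show "metric_coord M c ((snd c \<circ> \<gamma>) t) (vector_derivative (?q1 c) (at t within I)) w
      + christoffel M c ((snd c \<circ> \<gamma>) t) (?q1 c t) (?q1 c t) w = 0" for w
      by (rule geodesic_onD(3)[OF \<gamma> t' c'])
  qed (rule nontriv)
  show "velocity M J \<gamma> t = velocity M I \<gamma> t" if "t \<in> J"
    using vector_derivative_within[OF nontriv q] that by (auto simp: velocity_def fun_eq_iff)
qed

text \<open>Both terms of the geodesic equation are homogeneous of degree two under a change of
  speed. The case \<open>s = 0\<close> is included and yields a constant curve.\<close>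

lemma geodesic_on_scale:
  assumes \<gamma>: "geodesic_on M UNIV \<gamma>"
  shows "geodesic_on M UNIV (\<lambda>t. \<gamma> (s * t))"
    and "velocity M UNIV (\<lambda>t. \<gamma> (s * t)) 0 = tscale s (velocity M UNIV \<gamma> 0)"
proof -
  let ?q1 = "\<lambda>c s. vector_derivative (snd c \<circ> \<gamma>) (at s)"
  have chain: "((\<lambda>t. g (s * t)) has_vector_derivative s *\<^sub>R g') (at t)"
    if "(g has_vector_derivative g') (at (s * t))" for g :: "real \<Rightarrow> 'e" and g' t
  proof -
    have "((\<lambda>t. s * t) has_vector_derivative s) (at t)"
      unfolding has_real_derivative_iff_has_vector_derivative[symmetric]
      by (auto intro!: derivative_eq_intros)
    from vector_diff_chain_at[OF this that] show ?thesis by (simp add: o_def)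
  qed
  have q: "(snd c \<circ> (\<lambda>t. \<gamma> (s * t)) has_vector_derivative s *\<^sub>R ?q1 c (s * t)) (at t)"
    if "c \<in> charts_at M (\<gamma> (s * t))" for c t
    using chain[OF geodesic_onD(1)[OF \<gamma> UNIV_I that]] by (simp add: o_def)
  show "geodesic_on M UNIV (\<lambda>t. \<gamma> (s * t))"
  proof (rule geodesic_onI[where ?q1.0 = "\<lambda>c t. s *\<^sub>R ?q1 c (s * t)"
        and ?q2.0 = "\<lambda>c t. s *\<^sub>R s *\<^sub>R vector_derivative (?q1 c) (at (s * t))"])
    have "continuous_on UNIV \<gamma>"
      using \<gamma> by (simp add: geodesic_on_def)
    then show "continuous_on UNIV (\<lambda>t. \<gamma> (s * t))"
      by (rule continuous_on_compose2) (auto intro!: continuous_intros)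
    fix c t assume c: "c \<in> atlas M" "\<gamma> (s * t) \<in> fst c"
    have c': "c \<in> charts_at M (\<gamma> (s * t))" using c by (simp add: charts_at_def)
    have p: "(snd c \<circ> \<gamma>) (s * t) \<in> snd c ` fst c" using c(2) by simp
    show "(snd c \<circ> (\<lambda>t. \<gamma> (s * t)) has_vector_derivative s *\<^sub>R ?q1 c (s * t)) (at t)"
      by (rule q[OF c'])
    show "((\<lambda>t. s *\<^sub>R ?q1 c (s * t)) has_vector_derivative
        s *\<^sub>R s *\<^sub>R vector_derivative (?q1 c) (at (s * t))) (at t)"
      by (intro bounded_linear.has_vector_derivative[OF bounded_linear_scaleR_right] chain
          geodesic_onD(2)[OF \<gamma> UNIV_I c'])
    fix w
    note lins = linear_cmul[OF linear_metric_coord_left[OF c(1) p]]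
      linear_cmul[OF christoffel_linear(1)[OF c(1) p]] linear_cmul[OF christoffel_linear(2)[OF c(1) p]]
    have "metric_coord M c ((snd c \<circ> \<gamma>) (s * t)) (s *\<^sub>R s *\<^sub>R vector_derivative (?q1 c) (at (s * t))) w
      + christoffel M c ((snd c \<circ> \<gamma>) (s * t)) (s *\<^sub>R ?q1 c (s * t)) (s *\<^sub>R ?q1 c (s * t)) w
      = s * s * (metric_coord M c ((snd c \<circ> \<gamma>) (s * t)) (vector_derivative (?q1 c) (at (s * t))) w
          + christoffel M c ((snd c \<circ> \<gamma>) (s * t)) (?q1 c (s * t)) (?q1 c (s * t)) w)"
      unfolding lins by (simp add: distrib_left)
    also have "\<dots> = 0"
      unfolding geodesic_onD(3)[OF \<gamma> UNIV_I c'] by simp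
    finally show "metric_coord M c ((snd c \<circ> (\<lambda>t. \<gamma> (s * t))) t) (s *\<^sub>R s *\<^sub>R vector_derivative (?q1 c) (at (s * t))) w
      + christoffel M c ((snd c \<circ> (\<lambda>t. \<gamma> (s * t))) t) (s *\<^sub>R ?q1 c (s * t)) (s *\<^sub>R ?q1 c (s * t)) w = 0"
      unfolding o_def .
  qed simp
  show "velocity M UNIV (\<lambda>t. \<gamma> (s * t)) 0 = tscale s (velocity M UNIV \<gamma> 0)"
  proof
    show "velocity M UNIV (\<lambda>t. \<gamma> (s * t)) 0 c = tscale s (velocity M UNIV \<gamma> 0) c" for c
      using vector_derivative_at[OF q[of c 0]] by (simp add: velocity_def tscale_def)
  qed
qed

lemma geodesic_velocity_in_tangent_space:
  assumes \<gamma>: "geodesic_on M I \<gamma>" and t: "t \<in> I" "at t within I \<noteq> bot"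
  shows "velocity M I \<gamma> t \<in> tangent_space M (\<gamma> t)"
  using geodesic_onD(1)[OF \<gamma> t(1)] geodesic_on_continuous[OF \<gamma> t(1)] t
  by (intro velocity_in_tangent_space) (auto intro: differentiableI_vector)

section \<open>Constancy of the speed\<close>

text \<open>Separates the point from the vectors: the coefficients depend on \<open>p\<close> alone
  and are smooth, which gives access to the product rule and to joint continuity.\<close>

lemma metric_coord_expand:
  assumes "c \<in> atlas M" "p \<in> snd c ` fst c"
  shows "metric_coord M c p u w = (\<Sum>i\<in>Basis. \<Sum>j\<in>Basis. (u \<bullet> i) * ((w \<bullet> j) * metric_coord M c p i j))"
proof -
  have "metric_coord M c p u w
      = metric_coord M c p (\<Sum>i\<in>Basis. (u \<bullet> i) *\<^sub>R i) (\<Sum>j\<in>Basis. (w \<bullet> j) *\<^sub>R j)"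
    by (simp add: euclidean_representation)
  also have "\<dots> = (\<Sum>i\<in>Basis. \<Sum>j\<in>Basis. (u \<bullet> i) * ((w \<bullet> j) * metric_coord M c p i j))"
    by (simp only: linear_sum[OF linear_metric_coord_left[OF assms]]
        linear_cmul[OF linear_metric_coord_left[OF assms]])
      (simp add: linear_sum[OF linear_metric_coord_right[OF assms]] linear_cmul[OF linear_metric_coord_right[OF assms]]
        sum_distrib_left)
  finally show ?thesis .
qed

lemma frechet_metric_coord_expand:
  assumes "c \<in> atlas M" "p \<in> snd c ` fst c"
  shows "frechet_derivative (\<lambda>q. metric_coord M c q u w) (at p) v
    = (\<Sum>i\<in>Basis. \<Sum>j\<in>Basis. (u \<bullet> i) * ((w \<bullet> j) *
        frechet_derivative (\<lambda>q. metric_coord M c q i j) (at p) v))"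
proof -
  let ?D = "\<lambda>u w. frechet_derivative (\<lambda>q. metric_coord M c q u w) (at p) v"
  have "?D u w = ?D (\<Sum>i\<in>Basis. (u \<bullet> i) *\<^sub>R i) (\<Sum>j\<in>Basis. (w \<bullet> j) *\<^sub>R j)"
    by (simp add: euclidean_representation)
  also have "\<dots> = (\<Sum>i\<in>Basis. \<Sum>j\<in>Basis. (u \<bullet> i) * ((w \<bullet> j) * ?D i j))"
    by (simp only: linear_sum[OF linear_frechet_metric_coord_left[OF assms]]
        linear_cmul[OF linear_frechet_metric_coord_left[OF assms]])
      (simp add: linear_sum[OF linear_frechet_metric_coord_right[OF assms]]
        linear_cmul[OF linear_frechet_metric_coord_right[OF assms]]
        sum_distrib_left)
  finally show ?thesis .
qed

text \<open>Product rule in the expanded sum, valid near \<open>t\<close> because \<open>q\<close>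
  stays in the chart image there. Symmetry merges the two terms containing \<open>u'\<close> into
  the factor 2.\<close>

lemma metric_coord_along_curve:
  assumes c: "c \<in> atlas M" and t: "t \<in> I" and p: "q t \<in> snd c ` fst c"
    and q: "(q has_vector_derivative q') (at t within I)"
    and u: "(u has_vector_derivative u') (at t within I)"
  shows "((\<lambda>s. metric_coord M c (q s) (u s) (u s)) has_real_derivative
      2 * metric_coord M c (q t) u' (u t) + frechet_derivative (\<lambda>p. metric_coord M c p (u t) (u t)) (at (q t)) q')
      (at t within I)"
proof -
  let ?g = "\<lambda>i j p. metric_coord M c p i j"
  let ?D = "\<lambda>i j. frechet_derivative (?g i j) (at (q t))"
  have "((\<lambda>s. \<Sum>i\<in>Basis. \<Sum>j\<in>Basis. (u s \<bullet> i) * ((u s \<bullet> j) * ?g i j (q s))) has_derivative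
      (\<lambda>r. \<Sum>i\<in>Basis. \<Sum>j\<in>Basis. (u t \<bullet> i) * ((u t \<bullet> j) * ?D i j (r *\<^sub>R q') + (r *\<^sub>R u' \<bullet> j) * ?g i j (q t))
        + (r *\<^sub>R u' \<bullet> i) * ((u t \<bullet> j) * ?g i j (q t)))) (at t within I)"
    by (intro has_derivative_sum has_derivative_mult has_derivative_inner_left
        u[unfolded has_vector_derivative_def]
        has_derivative_compose[OF q[unfolded has_vector_derivative_def] metric_coord_has_derivative[OF c p]])
  moreover have "(\<Sum>i\<in>Basis. \<Sum>j\<in>Basis. (u t \<bullet> i) * ((u t \<bullet> j) * ?D i j (r *\<^sub>R q') + (r *\<^sub>R u' \<bullet> j) * ?g i j (q t))
        + (r *\<^sub>R u' \<bullet> i) * ((u t \<bullet> j) * ?g i j (q t)))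
      = (2 * metric_coord M c (q t) u' (u t) + ?D (u t) (u t) q') * r" for r
  proof -
    have "(\<Sum>i\<in>Basis. \<Sum>j\<in>Basis. (u t \<bullet> i) * ((u t \<bullet> j) * ?D i j (r *\<^sub>R q') + (r *\<^sub>R u' \<bullet> j) * ?g i j (q t))
        + (r *\<^sub>R u' \<bullet> i) * ((u t \<bullet> j) * ?g i j (q t)))
      = r * (\<Sum>i\<in>Basis. \<Sum>j\<in>Basis. (u t \<bullet> i) * ((u t \<bullet> j) * ?D i j q'))
      + r * (\<Sum>i\<in>Basis. \<Sum>j\<in>Basis. (u t \<bullet> i) * ((u' \<bullet> j) * ?g i j (q t)))
      + r * (\<Sum>i\<in>Basis. \<Sum>j\<in>Basis. (u' \<bullet> i) * ((u t \<bullet> j) * ?g i j (q t)))"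
      by (simp add: linear_cmul[OF linear_frechet_metric_coord[OF c p]] sum_distrib_left
          flip: sum.distrib) (simp add: algebra_simps)
    also have "\<dots> = r * ?D (u t) (u t) q' + r * metric_coord M c (q t) (u t) u' + r * metric_coord M c (q t) u' (u t)"
      by (simp only: metric_coord_expand[OF c p, symmetric] frechet_metric_coord_expand[OF c p, symmetric])
    finally show ?thesis
      using metric_coord_sym[OF c p, of u' "u t"] by (simp add: algebra_simps)
  qed
  ultimately have der: "((\<lambda>s. \<Sum>i\<in>Basis. \<Sum>j\<in>Basis. (u s \<bullet> i) * ((u s \<bullet> j) * ?g i j (q s))) has_real_derivative
      2 * metric_coord M c (q t) u' (u t) + ?D (u t) (u t) q') (at t within I)"
    by (simp add: has_field_derivative_def)
  have "continuous (at t within I) q"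
    using q has_vector_derivative_continuous by blast
  then have "eventually (\<lambda>s. s \<in> I \<longrightarrow> q s \<in> snd c ` fst c) (nhds t)"
    by (rule eventually_in_open) (rule open_chart_image[OF c] p)+
  then have ev: "eventually (\<lambda>s. s \<in> I \<longrightarrow> metric_coord M c (q s) (u s) (u s)
      = (\<Sum>i\<in>Basis. \<Sum>j\<in>Basis. (u s \<bullet> i) * ((u s \<bullet> j) * ?g i j (q s)))) (nhds t)"
    by (rule eventually_mono) (blast intro: metric_coord_expand[OF c])
  have "metric_coord M c (q t) (u t) (u t)
      = (\<Sum>i\<in>Basis. \<Sum>j\<in>Basis. (u t \<bullet> i) * ((u t \<bullet> j) * ?g i j (q t)))"
    by (rule metric_coord_expand[OF c p])
  from has_vector_derivative_cong_ev[OF ev this] der show ?thesis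
    unfolding has_real_derivative_iff_has_vector_derivative by blast
qed

text \<open>Testing the geodesic equation with the velocity itself makes the two terms of
  \<open>metric_coord_along_curve\<close> cancel. The squared speed is independent of the chart, so
  this may be checked in whichever chart contains the point.\<close>

lemma geodesic_constant_speed:
  assumes \<gamma>: "geodesic_on M {0..1} \<gamma>"
  shows "\<exists>r. \<forall>t\<in>{0..1}. rnorm M (\<gamma> t) (velocity M {0..1} \<gamma> t) = r"
proof -
  let ?v = "velocity M {0..1} \<gamma>"
  let ?s = "\<lambda>t. metric M (\<gamma> t) (?v t) (?v t)"
  have nontriv: "at t within {0..1} \<noteq> bot" if "t \<in> {0..1}" for t :: real
    using that by (simp add: trivial_limit_within)
  have "(?s has_real_derivative 0) (at t within {0..1})" if t: "t \<in> {0..1}" for t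
  proof -
    obtain c where c: "c \<in> charts_at M (\<gamma> t)" using charts_at_nonempty by blast
    define q where "q = snd c \<circ> \<gamma>"
    define q1 where "q1 = (\<lambda>s. vector_derivative q (at s within {0..1}))"
    define q2 where "q2 = vector_derivative q1 (at t within {0..1})"
    note D = charts_atD[OF c]
    have p: "q t \<in> snd c ` fst c" using D by (simp add: q_def)
    have q: "(q has_vector_derivative q1 t) (at t within {0..1})"
      "(q1 has_vector_derivative q2) (at t within {0..1})"
      "\<And>w. metric_coord M c (q t) q2 w + christoffel M c (q t) (q1 t) (q1 t) w = 0"
      unfolding q2_def q1_def q_def by (rule geodesic_onD[OF \<gamma> t c])+
    have "2 * metric_coord M c (q t) q2 (q1 t)
        + frechet_derivative (\<lambda>p. metric_coord M c p (q1 t) (q1 t)) (at (q t)) (q1 t) = 0"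
      using q(3)[of "q1 t"] christoffel_diagonal[OF D(1) p, of "q1 t"] by simp
    then have der: "((\<lambda>s. metric_coord M c (q s) (q1 s) (q1 s)) has_real_derivative 0) (at t within {0..1})"
      using metric_coord_along_curve[OF D(1) t p q(1,2)] by simp
    have eq: "?s s = metric_coord M c (q s) (q1 s) (q1 s)" if "s \<in> {0..1}" "\<gamma> s \<in> fst c" for s
    proof -
      have c': "c \<in> charts_at M (\<gamma> s)" using D(1) that(2) by (rule charts_atI)
      note v = geodesic_velocity_in_tangent_space[OF \<gamma> that(1) nontriv[OF that(1)]]
      have "?v s c = q1 s"
        using c' by (simp add: velocity_def q1_def q_def)
      then show ?thesis
        using metric_eq_coord[OF c' v v] by (simp add: q_def)
    qed
    have "eventually (\<lambda>s. s \<in> {0..1} \<longrightarrow> \<gamma> s \<in> fst c) (nhds t)"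
      by (rule eventually_in_open[OF geodesic_on_continuous[OF \<gamma> t] open_chart_domain[OF D(1)] D(2)])
    then have ev: "eventually (\<lambda>s. s \<in> {0..1} \<longrightarrow> ?s s = metric_coord M c (q s) (q1 s) (q1 s)) (nhds t)"
      by (rule eventually_mono) (blast intro: eq)
    from has_vector_derivative_cong_ev[OF ev eq[OF t D(2)]] der show ?thesis
      unfolding has_real_derivative_iff_has_vector_derivative by blast
  qed
  then have "\<exists>r. \<forall>t\<in>{0..1}. ?s t = r"
    by (rule has_field_derivative_zero_constant[OF convex_real_interval(5)])
  then show ?thesis
    unfolding rnorm_def by metis
qed

lemma metric_coord_le:
  assumes c: "c \<in> atlas M" and B: "compact B" "B \<subseteq> snd c ` fst c"
  shows "\<exists>C\<ge>0. \<forall>p\<in>B. \<forall>u. metric_coord M c p u u \<le> C * (norm u)\<^sup>2"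
proof -
  have "\<exists>C. \<forall>p\<in>B. \<bar>metric_coord M c p u w\<bar> \<le> C" for u w
    using Ck_on_bounded_on_compact[OF metric_coord_Ck_on[OF c] B] by simp
  then have "\<exists>C\<ge>0. \<forall>p\<in>B. \<forall>u w. \<bar>metric_coord M c p u w\<bar> \<le> C * 1 * norm u * norm w"
    by (intro bilinear_family_bound linear_metric_coord_left linear_metric_coord_right c
        subsetD[OF B(2)]) simp_all
  then obtain C where C: "C \<ge> 0" "\<And>p u w. p \<in> B \<Longrightarrow> \<bar>metric_coord M c p u w\<bar> \<le> C * norm u * norm w"
    by auto
  have "metric_coord M c p u u \<le> C * (norm u)\<^sup>2" if "p \<in> B" for p u
    using C(2)[OF that, of u u] by (simp add: power2_eq_square mult.assoc)
  then show ?thesis using C(1) by blast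
qed

section \<open>Uniqueness of geodesics\<close>

text \<open>Supplies the constants required by \<open>quadratic_ode_uniqueness\<close>. The upper
  bounds come from smoothness in \<open>p\<close> for fixed vectors and the multilinear family
  bounds, the lower one from compactness.\<close>

lemma geodesic_equation_bounds:
  assumes c: "c \<in> atlas M" and B: "compact B" "convex B" "B \<subseteq> snd c ` fst c"
  shows "\<exists>\<mu> C. \<mu> > 0 \<and> C \<ge> 0 \<and>
    (\<forall>p\<in>B. \<forall>u. \<mu> * (norm u)\<^sup>2 \<le> metric_coord M c p u u) \<and>
    (\<forall>p\<in>B. \<forall>p'\<in>B. \<forall>u w. \<bar>metric_coord M c p u w - metric_coord M c p' u w\<bar>
      \<le> C * norm (p - p') * norm u * norm w) \<and>
    (\<forall>p\<in>B. \<forall>u v w. \<bar>christoffel M c p u v w\<bar> \<le> C * norm u * norm v * norm w) \<and>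
    (\<forall>p\<in>B. \<forall>p'\<in>B. \<forall>u v w. \<bar>christoffel M c p u v w - christoffel M c p' u v w\<bar>
      \<le> C * norm (p - p') * norm u * norm v * norm w)"
proof -
  note im = subsetD[OF B(3)]
  let ?g = "\<lambda>u w p. metric_coord M c p u w"
  have Ck: "Ck_on k (snd c ` fst c) (?g u w)" for k u w
    by (rule metric_coord_Ck_on[OF c])
  have dCk: "Ck_on k (snd c ` fst c) (\<lambda>p. frechet_derivative (?g u w) (at p) v)" for k u v w
    using Ck[of "Suc k" u w] by simp
  have lip: "\<exists>C. \<forall>z\<in>B \<times> B. \<bar>?g u w (fst z) - ?g u w (snd z)\<bar> \<le> C * norm (fst z - snd z)" for u w
  proof -
    obtain C where "\<forall>p\<in>B. \<forall>p'\<in>B. \<bar>?g u w p - ?g u w p'\<bar> \<le> C * norm (p - p')"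
      using Ck_on_Lipschitz_on_compact_convex[OF Ck B] by blast
    then show ?thesis by (intro exI[of _ C]) auto
  qed
  have dbnd: "\<exists>C. \<forall>p\<in>B. \<bar>christoffel M c p u v w\<bar> \<le> C" for u v w
  proof -
    obtain C1 C2 C3 where C: "\<forall>p\<in>B. \<bar>frechet_derivative (?g v w) (at p) u\<bar> \<le> C1"
      "\<forall>p\<in>B. \<bar>frechet_derivative (?g u w) (at p) v\<bar> \<le> C2"
      "\<forall>p\<in>B. \<bar>frechet_derivative (?g u v) (at p) w\<bar> \<le> C3"
      using Ck_on_bounded_on_compact[OF dCk B(1,3)] by (simp only: real_norm_def) metis
    have "\<bar>christoffel M c p u v w\<bar> \<le> C1 + C2 + C3" if "p \<in> B" for p
      using bspec[OF C(1) that] bspec[OF C(2) that] bspec[OF C(3) that] unfolding christoffel_def by argo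
    then show ?thesis by blast
  qed
  have dlip: "\<exists>C. \<forall>z\<in>B \<times> B. \<bar>christoffel M c (fst z) u v w - christoffel M c (snd z) u v w\<bar>
      \<le> C * norm (fst z - snd z)" for u v w
  proof -
    note L = Ck_on_Lipschitz_on_compact_convex[OF dCk B]
    obtain C1 C2 C3 where C:
      "\<forall>p\<in>B. \<forall>p'\<in>B. \<bar>frechet_derivative (?g v w) (at p) u - frechet_derivative (?g v w) (at p') u\<bar> \<le> C1 * norm (p - p')"
      "\<forall>p\<in>B. \<forall>p'\<in>B. \<bar>frechet_derivative (?g u w) (at p) v - frechet_derivative (?g u w) (at p') v\<bar> \<le> C2 * norm (p - p')"
      "\<forall>p\<in>B. \<forall>p'\<in>B. \<bar>frechet_derivative (?g u v) (at p) w - frechet_derivative (?g u v) (at p') w\<bar> \<le> C3 * norm (p - p')"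
      using L[of v w u] L[of u w v] L[of u v w] by blast
    have "\<bar>christoffel M c p u v w - christoffel M c p' u v w\<bar> \<le> (C1 + C2 + C3) * norm (p - p')"
      if "p \<in> B" "p' \<in> B" for p p'
      using bspec[OF bspec[OF C(1) that(1)] that(2)] bspec[OF bspec[OF C(2) that(1)] that(2)]
        bspec[OF bspec[OF C(3) that(1)] that(2)]
      unfolding christoffel_def distrib_right by argo
    then show ?thesis by (intro exI[of _ "C1 + C2 + C3"]) auto
  qed
  have "\<exists>C\<ge>0. \<forall>z\<in>B \<times> B. \<forall>u w. \<bar>?g u w (fst z) - ?g u w (snd z)\<bar> \<le> C * norm (fst z - snd z) * norm u * norm w"
    using lip by (intro bilinear_family_bound linear_compose_sub linear_metric_coord_left
      linear_metric_coord_right c im) auto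
  then obtain C1 where C1: "C1 \<ge> 0" "\<And>p p' u w. p \<in> B \<Longrightarrow> p' \<in> B \<Longrightarrow>
      \<bar>?g u w p - ?g u w p'\<bar> \<le> C1 * norm (p - p') * norm u * norm w"
    by auto
  have "\<exists>C\<ge>0. \<forall>p\<in>B. \<forall>u v w. \<bar>christoffel M c p u v w\<bar> \<le> C * 1 * norm u * norm v * norm w"
    using dbnd by (intro trilinear_family_bound christoffel_linear c im) simp_all
  then obtain C2 where C2: "C2 \<ge> 0" "\<And>p u v w. p \<in> B \<Longrightarrow>
      \<bar>christoffel M c p u v w\<bar> \<le> C2 * norm u * norm v * norm w"
    by auto
  have "\<exists>C\<ge>0. \<forall>z\<in>B \<times> B. \<forall>u v w. \<bar>christoffel M c (fst z) u v w - christoffel M c (snd z) u v w\<bar>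
      \<le> C * norm (fst z - snd z) * norm u * norm v * norm w"
    using dlip by (intro trilinear_family_bound linear_compose_sub christoffel_linear c im) auto
  then obtain C3 where C3: "C3 \<ge> 0" "\<And>p p' u v w. p \<in> B \<Longrightarrow> p' \<in> B \<Longrightarrow>
      \<bar>christoffel M c p u v w - christoffel M c p' u v w\<bar> \<le> C3 * norm (p - p') * norm u * norm v * norm w"
    by auto
  \<comment> \<open>\<mu> is the minimum of the quadratic form over \<open>B\<close> times the unit
    sphere, extended to all vectors by homogeneity.\<close>
  have "\<exists>\<mu>>0. \<forall>p\<in>B. \<forall>u. \<mu> * (norm u)\<^sup>2 \<le> ?g u u p"
  proof (cases "B = {}")
    case False
    let ?S = "B \<times> sphere (0::'e) 1"
    let ?F = "\<lambda>z. ?g (snd z) (snd z) (fst z)"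
    have "continuous_on ?S (\<lambda>z. \<Sum>i\<in>Basis. \<Sum>j\<in>Basis. (snd z \<bullet> i) * ((snd z \<bullet> j) * ?g i j (fst z)))"
    proof (intro continuous_intros)
      fix i j :: 'e
      show "continuous_on ?S (\<lambda>z. ?g i j (fst z))"
        using Ck_on_imp_continuous_on[OF Ck[of 0 i j]] B(3)
        by (elim continuous_on_compose2) (auto intro!: continuous_intros)
    qed
    then have cont: "continuous_on ?S ?F"
      by (rule continuous_on_eq) (rule metric_coord_expand[OF c im, symmetric], auto)
    obtain b :: 'e where "b \<in> Basis" using nonempty_Basis by blast
    then have "?S \<noteq> {}" using False by (auto intro!: exI[of _ b])
    then obtain z where z: "z \<in> ?S" "\<And>y. y \<in> ?S \<Longrightarrow> ?F z \<le> ?F y"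
      using continuous_attains_inf[OF _ _ cont] B(1) compact_Times compact_sphere by blast
    have "?F z > 0"
      using z(1) by (intro metric_coord_pos c im) auto
    moreover have "?F z * (norm u)\<^sup>2 \<le> ?g u u p" if p: "p \<in> B" for p u
    proof (cases "u = 0")
      case True
      then show ?thesis using linear_0[OF linear_metric_coord_left[OF c im[OF p]]] by simp
    next
      case False
      let ?u = "u /\<^sub>R norm u"
      have "?F z \<le> ?g ?u ?u p"
        using z(2)[of "(p, ?u)"] p False by simp
      also have "\<dots> = ?g u u p / (norm u)\<^sup>2"
        unfolding linear_cmul[OF linear_metric_coord_left[OF c im[OF p]]]
          linear_cmul[OF linear_metric_coord_right[OF c im[OF p]]]
        by (simp add: power2_eq_square divide_simps)
      finally show ?thesis using False by (simp add: field_simps)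
    qed
    ultimately show ?thesis by blast
  qed (use zero_less_one in blast)
  then obtain \<mu> where \<mu>: "\<mu> > 0" "\<And>p u. p \<in> B \<Longrightarrow> \<mu> * (norm u)\<^sup>2 \<le> ?g u u p"
    by blast
  define C where "C = C1 + C2 + C3"
  have le: "x \<le> C * y" if "x \<le> C' * y" "C' \<le> C" "y \<ge> 0" for x y C'
    using that by (meson mult_right_mono order_trans)
  have CC: "C1 \<le> C" "C2 \<le> C" "C3 \<le> C" "0 \<le> C"
    using C1(1) C2(1) C3(1) by (auto simp: C_def)
  have "\<bar>?g u w p - ?g u w p'\<bar> \<le> C * norm (p - p') * norm u * norm w" if "p \<in> B" "p' \<in> B" for p p' u w
    using le[OF _ CC(1), of _ "norm (p - p') * norm u * norm w"] C1(2)[OF that, of u w] by (simp add: mult.assoc)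
  moreover have "\<bar>christoffel M c p u v w\<bar> \<le> C * norm u * norm v * norm w" if "p \<in> B" for p u v w
    using le[OF _ CC(2), of _ "norm u * norm v * norm w"] C2(2)[OF that, of u v w] by (simp add: mult.assoc)
  moreover have "\<bar>christoffel M c p u v w - christoffel M c p' u v w\<bar>
      \<le> C * norm (p - p') * norm u * norm v * norm w" if "p \<in> B" "p' \<in> B" for p p' u v w
    using le[OF _ CC(3), of _ "norm (p - p') * norm u * norm v * norm w"] C3(2)[OF that, of u v w]
    by (simp add: mult.assoc)
  ultimately show ?thesis
    using \<mu> CC(4) by (intro exI[of _ \<mu>] exI[of _ C]) blast
qed


lemma geodesic_local_uniqueness:
  assumes ab: "a < b" and \<gamma>: "geodesic_on M {a..b} \<gamma>" and \<delta>: "geodesic_on M {a..b} \<delta>"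
    and c: "c \<in> atlas M" and B: "compact B" "convex B" "B \<subseteq> snd c ` fst c"
    and \<gamma>B: "\<And>t. t \<in> {a..b} \<Longrightarrow> \<gamma> t \<in> fst c \<and> snd c (\<gamma> t) \<in> B"
    and \<delta>B: "\<And>t. t \<in> {a..b} \<Longrightarrow> \<delta> t \<in> fst c \<and> snd c (\<delta> t) \<in> B"
    and init: "\<gamma> a = \<delta> a" "velocity M {a..b} \<gamma> a c = velocity M {a..b} \<delta> a c"
    and t: "t \<in> {a..b}"
  shows "\<gamma> t = \<delta> t"
proof -
  obtain \<mu> C where K: "\<mu> > 0" "C \<ge> 0"
    "\<And>p u. p \<in> B \<Longrightarrow> \<mu> * (norm u)\<^sup>2 \<le> metric_coord M c p u u"
    "\<And>p p' u w. p \<in> B \<Longrightarrow> p' \<in> B \<Longrightarrow> \<bar>metric_coord M c p u w - metric_coord M c p' u w\<bar>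
      \<le> C * norm (p - p') * norm u * norm w"
    "\<And>p u v w. p \<in> B \<Longrightarrow> \<bar>christoffel M c p u v w\<bar> \<le> C * norm u * norm v * norm w"
    "\<And>p p' u v w. p \<in> B \<Longrightarrow> p' \<in> B \<Longrightarrow> \<bar>christoffel M c p u v w - christoffel M c p' u v w\<bar>
      \<le> C * norm (p - p') * norm u * norm v * norm w"
    using geodesic_equation_bounds[OF c B] by metis
  note im = subsetD[OF B(3)]
  have \<gamma>c: "c \<in> charts_at M (\<gamma> t)" and \<delta>c: "c \<in> charts_at M (\<delta> t)" if "t \<in> {a..b}" for t
    using \<gamma>B[OF that] \<delta>B[OF that] c by (simp_all add: charts_at_def)
  let ?q1 = "\<lambda>\<gamma> s. vector_derivative (snd c \<circ> \<gamma>) (at s within {a..b})"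
  let ?q2 = "\<lambda>\<gamma> s. vector_derivative (?q1 \<gamma>) (at s within {a..b})"
  have "(snd c \<circ> \<gamma>) t = (snd c \<circ> \<delta>) t"
  proof (rule quadratic_ode_uniqueness[where a = a and b = b and B = B and G = "metric_coord M c"
        and \<Gamma> = "christoffel M c" and \<mu> = \<mu> and C = C and q = "snd c \<circ> \<gamma>" and r = "snd c \<circ> \<delta>"
        and ?q1.0 = "?q1 \<gamma>" and ?r1.0 = "?q1 \<delta>" and ?q2.0 = "?q2 \<gamma>" and ?r2.0 = "?q2 \<delta>"])
    fix s assume s: "s \<in> {a..b}"
    show "(snd c \<circ> \<gamma> has_vector_derivative ?q1 \<gamma> s) (at s within {a..b})"
      "(?q1 \<gamma> has_vector_derivative ?q2 \<gamma> s) (at s within {a..b})"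
      "metric_coord M c ((snd c \<circ> \<gamma>) s) (?q2 \<gamma> s) w
        + christoffel M c ((snd c \<circ> \<gamma>) s) (?q1 \<gamma> s) (?q1 \<gamma> s) w = 0" for w
      by (rule geodesic_onD[OF \<gamma> s \<gamma>c[OF s]])+
    show "(snd c \<circ> \<delta> has_vector_derivative ?q1 \<delta> s) (at s within {a..b})"
      "(?q1 \<delta> has_vector_derivative ?q2 \<delta> s) (at s within {a..b})"
      "metric_coord M c ((snd c \<circ> \<delta>) s) (?q2 \<delta> s) w
        + christoffel M c ((snd c \<circ> \<delta>) s) (?q1 \<delta> s) (?q1 \<delta> s) w = 0" for w
      by (rule geodesic_onD[OF \<delta> s \<delta>c[OF s]])+
  next
    show "?q1 \<gamma> a = ?q1 \<delta> a"
      using init \<gamma>c[of a] \<delta>c[of a] ab by (simp add: velocity_def)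
    show "linear (\<lambda>u. metric_coord M c p u w)" if "p \<in> B" for p w
      by (rule linear_metric_coord_left[OF c im[OF that]])
    show "linear (\<lambda>u. christoffel M c p u v w)" "linear (\<lambda>u. christoffel M c p v u w)"
      if "p \<in> B" for p v w
      by (rule christoffel_linear[OF c im[OF that]])+
  qed (use K init \<gamma>B \<delta>B t in simp_all)
  then show ?thesis
    using \<gamma>B[OF t] \<delta>B[OF t] chart_inv_chart[OF c] by (metis o_apply)
qed

text \<open>Continuation: the supremum of the times of agreement is itself such a time, and if it
  were below 1, local uniqueness in a chart around the common point would extend the
  agreement.\<close>

lemma geodesic_unique:
  assumes \<gamma>: "geodesic_on M {0..1} \<gamma>" and \<delta>: "geodesic_on M {0..1} \<delta>"
    and init: "\<gamma> 0 = \<delta> 0" "velocity M {0..1} \<gamma> 0 = velocity M {0..1} \<delta> 0" and t: "t \<in> {0..1}"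
  shows "\<gamma> t = \<delta> t"
proof -
  have nontriv: "at s within {a..b} \<noteq> bot" if "a < b" "s \<in> {a..b}" for a b s :: real
    using that by (simp add: trivial_limit_within)
  \<comment> \<open>Agreement is required on a whole initial interval, so that it also determines
    the derivative from the left at the supremum.\<close>
  define A where "A = {t \<in> {0..1}. \<forall>s\<in>{0..t}. \<gamma> s = \<delta> s}"
  define \<tau> where "\<tau> = Sup A"
  have A0: "0 \<in> A" using init by (simp add: A_def)
  have Abdd: "bdd_above A" unfolding A_def by (rule bdd_aboveI[of _ 1]) simp
  have \<tau>01: "0 \<le> \<tau>" "\<tau> \<le> 1"
  proof -
    show "0 \<le> \<tau>" unfolding \<tau>_def by (rule cSup_upper[OF A0 Abdd])
    show "\<tau> \<le> 1"
      unfolding \<tau>_def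
    proof (rule cSup_least)
      show "A \<noteq> {}" using A0 by blast
    qed (simp add: A_def)
  qed
  have below: "\<gamma> s = \<delta> s" if s: "0 \<le> s" "s < \<tau>" for s
  proof -
    obtain t where "t \<in> A" "s < t" using less_cSupD[of A s] A0 s(2) unfolding \<tau>_def by blast
    then show ?thesis using s(1) by (simp add: A_def)
  qed
  \<comment> \<open>Limits from the left are unique because the manifold is Hausdorff.\<close>
  have at\<tau>: "\<gamma> \<tau> = \<delta> \<tau>"
  proof (cases "\<tau> = 0")
    case False
    then have nb: "at \<tau> within {0..<\<tau>} \<noteq> bot"
      using \<tau>01 by (simp add: trivial_limit_within)
    have lim: "(\<epsilon> \<longlongrightarrow> \<epsilon> \<tau>) (at \<tau> within {0..<\<tau>})" if "geodesic_on M {0..1} \<epsilon>" for \<epsilon>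
    proof (rule tendsto_within_subset)
      show "(\<epsilon> \<longlongrightarrow> \<epsilon> \<tau>) (at \<tau> within {0..1})"
        using geodesic_on_continuous[OF that, of \<tau>] \<tau>01 by (simp add: continuous_within)
    qed (use \<tau>01 in auto)
    have "(\<gamma> \<longlongrightarrow> \<delta> \<tau>) (at \<tau> within {0..<\<tau>})"
      using lim[OF \<delta>] by (rule Lim_transform_eventually) (auto simp: eventually_at_filter below)
    then show ?thesis
      using tendsto_unique[OF nb lim[OF \<gamma>]] by simp
  qed (simp add: init)
  have upto: "\<gamma> s = \<delta> s" if "s \<in> {0..\<tau>}" for s
    using that below[of s] at\<tau> by (cases "s = \<tau>") auto
  have "\<tau> = 1"
  proof (rule ccontr)
    assume "\<tau> \<noteq> 1"
    then have "\<tau> < 1" using \<tau>01 by simp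
    obtain c where c: "c \<in> charts_at M (\<gamma> \<tau>)" using charts_at_nonempty by blast
    note D = charts_atD[OF c]
    have c\<delta>: "c \<in> charts_at M (\<delta> \<tau>)" using c at\<tau> by simp
    obtain r where r: "r > 0" "cball (snd c (\<gamma> \<tau>)) r \<subseteq> snd c ` fst c"
      using open_chart_image[OF D(1)] D(2) open_contains_cball by blast
    \<comment> \<open>The open ball gives a neighbourhood to which continuity applies; the closed
      one around it is the compact convex set for local uniqueness.\<close>
    define V where "V = fst c \<inter> snd c -` ball (snd c (\<gamma> \<tau>)) r"
    have "open V"
      unfolding V_def
      by (rule continuous_open_preimage[OF continuous_on_chart[OF D(1)] open_chart_domain[OF D(1)] open_ball])
    have "\<gamma> \<tau> \<in> V" "\<delta> \<tau> \<in> V" using D(2) r(1) at\<tau> by (simp_all add: V_def)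
    have "\<tau> \<in> {0..1}" using \<tau>01 by simp
    have "eventually (\<lambda>s. (s \<in> {0..1} \<longrightarrow> \<gamma> s \<in> V) \<and> (s \<in> {0..1} \<longrightarrow> \<delta> s \<in> V)) (nhds \<tau>)"
      by (rule eventually_conj[OF
            eventually_in_open[OF geodesic_on_continuous[OF \<gamma> \<open>\<tau> \<in> {0..1}\<close>] \<open>open V\<close> \<open>\<gamma> \<tau> \<in> V\<close>]
            eventually_in_open[OF geodesic_on_continuous[OF \<delta> \<open>\<tau> \<in> {0..1}\<close>] \<open>open V\<close> \<open>\<delta> \<tau> \<in> V\<close>]])
    then obtain d where d: "d > 0" "\<And>s. dist s \<tau> < d \<Longrightarrow> s \<in> {0..1} \<Longrightarrow> \<gamma> s \<in> V \<and> \<delta> s \<in> V"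
      unfolding eventually_nhds_metric by blast
    define b where "b = min 1 (\<tau> + d / 2)"
    have b: "\<tau> < b" "b \<le> 1" "b < \<tau> + d" using \<open>\<tau> < 1\<close> d(1) by (auto simp: b_def)
    have inV: "\<gamma> s \<in> V \<and> \<delta> s \<in> V" if "s \<in> {\<tau>..b}" for s
      using d(2)[of s] that b \<tau>01 by (simp add: dist_real_def)
    have sub: "{\<tau>..b} \<subseteq> {0..1}" using b \<tau>01 by auto
    have \<gamma>b: "geodesic_on M {\<tau>..b} \<gamma>" "velocity M {\<tau>..b} \<gamma> \<tau> = velocity M {0..1} \<gamma> \<tau>"
      using geodesic_on_subset[OF \<gamma> sub nontriv[OF b(1)]] b(1) by auto
    have \<delta>b: "geodesic_on M {\<tau>..b} \<delta>" "velocity M {\<tau>..b} \<delta> \<tau> = velocity M {0..1} \<delta> \<tau>"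
      using geodesic_on_subset[OF \<delta> sub nontriv[OF b(1)]] b(1) by auto
    \<comment> \<open>For \<open>\<tau> > 0\<close> the derivative within \<open>{0..1}\<close> can
      be computed from the left, where the curves coincide; at \<open>\<tau> = 0\<close> it is
      prescribed.\<close>
    have vel: "velocity M {0..1} \<gamma> \<tau> c = velocity M {0..1} \<delta> \<tau> c"
    proof (cases "\<tau> = 0")
      case False
      then have "\<tau> > 0" using \<tau>01 by simp
      have "(snd c \<circ> \<gamma> has_vector_derivative velocity M {0..1} \<gamma> \<tau> c) (at \<tau> within {0..\<tau>})"
        using geodesic_onD(1)[OF \<gamma> \<open>\<tau> \<in> {0..1}\<close> c] c \<tau>01
        by (auto simp: velocity_def intro: has_vector_derivative_within_subset)
      then have "(snd c \<circ> \<delta> has_vector_derivative velocity M {0..1} \<gamma> \<tau> c) (at \<tau> within {0..\<tau>})"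
        by (rule has_vector_derivative_transform[rotated 2]) (use upto \<tau>01 in auto)
      moreover have "(snd c \<circ> \<delta> has_vector_derivative velocity M {0..1} \<delta> \<tau> c) (at \<tau> within {0..\<tau>})"
        using geodesic_onD(1)[OF \<delta> \<open>\<tau> \<in> {0..1}\<close> c\<delta>] c\<delta> \<tau>01
        by (auto simp: velocity_def intro: has_vector_derivative_within_subset)
      ultimately show ?thesis
        by (rule vector_derivative_unique_within[OF nontriv[OF \<open>\<tau> > 0\<close>], rotated]) (use \<open>\<tau> > 0\<close> in simp)
    qed (simp add: init)
    have "\<gamma> s = \<delta> s" if "s \<in> {\<tau>..b}" for s
    proof (rule geodesic_local_uniqueness[OF b(1) \<gamma>b(1) \<delta>b(1) D(1) compact_cball convex_cball r(2) _ _ at\<tau> _ that])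
      show "\<gamma> t \<in> fst c \<and> snd c (\<gamma> t) \<in> cball (snd c (\<gamma> \<tau>)) r" if "t \<in> {\<tau>..b}" for t
        using inV[OF that] by (auto simp: V_def)
      show "\<delta> t \<in> fst c \<and> snd c (\<delta> t) \<in> cball (snd c (\<gamma> \<tau>)) r" if "t \<in> {\<tau>..b}" for t
        using inV[OF that] by (auto simp: V_def)
      show "velocity M {\<tau>..b} \<gamma> \<tau> c = velocity M {\<tau>..b} \<delta> \<tau> c"
        using vel \<gamma>b(2) \<delta>b(2) by simp
    qed
    then have "\<gamma> s = \<delta> s" if "s \<in> {0..b}" for s
      using upto[of s] that by (cases "s \<le> \<tau>") auto
    then have "b \<in> A" using b \<tau>01 by (simp add: A_def)
    then have "b \<le> \<tau>" unfolding \<tau>_def by (rule cSup_upper[OF _ Abdd])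
    then show False using b(1) by simp
  qed
  then show ?thesis using upto t by simp
qed

section \<open>The exponential map and feasible velocities\<close>

lemma geodesic_on_UNIV_restrict:
  assumes \<gamma>: "geodesic_on M UNIV \<gamma>"
  shows "geodesic_on M {0..1} \<gamma>" "velocity M {0..1} \<gamma> 0 = velocity M UNIV \<gamma> 0"
  by (rule geodesic_on_subset[OF \<gamma>]; simp add: trivial_limit_within)+

lemma Exp_eq:
  assumes \<gamma>: "geodesic_on M UNIV \<gamma>"
  shows "Exp M (\<gamma> 0) (velocity M UNIV \<gamma> 0) = \<gamma> 1"
  unfolding Exp_def
proof (rule the_equality)
  fix y assume "\<exists>\<delta>. geodesic_on M UNIV \<delta> \<and> \<delta> 0 = \<gamma> 0 \<and>
    velocity M UNIV \<delta> 0 = velocity M UNIV \<gamma> 0 \<and> \<delta> 1 = y"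
  then obtain \<delta> where \<delta>: "geodesic_on M UNIV \<delta>" "\<delta> 0 = \<gamma> 0"
    "velocity M UNIV \<delta> 0 = velocity M UNIV \<gamma> 0" "\<delta> 1 = y" by blast
  have "\<delta> 1 = \<gamma> 1"
    by (rule geodesic_unique)
      (use geodesic_on_UNIV_restrict[OF \<gamma>] geodesic_on_UNIV_restrict[OF \<delta>(1)] \<delta> in simp_all)
  then show "y = \<gamma> 1" using \<delta>(4) by simp
qed (use \<gamma> in blast)

text \<open>\<gamma> lives on \<open>{0..1}\<close> whereas \<open>Exp\<close> refers to geodesics
  on the whole line. Completeness provides a global one with the same initial data, scaling
  evaluates \<open>Exp\<close> on it, and uniqueness leads back to \<gamma>.\<close>

lemma Exp_geodesic:
  assumes complete: "complete_riem M" and \<gamma>: "geodesic_on M {0..1} \<gamma>" and s: "s \<in> {0..1}"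
  shows "Exp M (\<gamma> 0) (tscale s (velocity M {0..1} \<gamma> 0)) = \<gamma> s"
proof -
  let ?v = "velocity M {0..1} \<gamma> 0"
  have "?v \<in> tangent_space M (\<gamma> 0)"
    by (rule geodesic_velocity_in_tangent_space[OF \<gamma>]) (simp_all add: trivial_limit_within)
  then obtain \<delta> where \<delta>: "geodesic_on M UNIV \<delta>" "\<delta> 0 = \<gamma> 0" "velocity M UNIV \<delta> 0 = ?v"
    using complete unfolding complete_riem_def by blast
  have "Exp M (\<delta> (s * 0)) (velocity M UNIV (\<lambda>t. \<delta> (s * t)) 0) = \<delta> (s * 1)"
    by (rule Exp_eq) (rule geodesic_on_scale(1)[OF \<delta>(1)])
  then have "Exp M (\<gamma> 0) (tscale s ?v) = \<delta> s"
    using geodesic_on_scale(2)[OF \<delta>(1), of s] \<delta>(2,3) by simp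
  also have "\<delta> s = \<gamma> s"
    by (rule geodesic_unique[OF _ \<gamma> _ _ s]) (use geodesic_on_UNIV_restrict[OF \<delta>(1)] \<delta> in simp_all)
  finally show ?thesis .
qed

lemma feasible_velocity_of_geodesic:
  assumes complete: "complete_riem M" and \<gamma>: "minimizing_geodesic M x y \<gamma>" "\<gamma> ` {0..1} \<subseteq> X"
  shows "velocity M {0..1} \<gamma> 0 \<in> feasible_velocities M X x"
proof -
  let ?v = "velocity M {0..1} \<gamma> 0"
  have geo: "geodesic_on M {0..1} \<gamma>" and ends: "\<gamma> 0 = x" "\<gamma> 1 = y"
    and len: "curve_length M \<gamma> = rdist M x y"
    using \<gamma>(1) by (simp_all add: minimizing_geodesic_def)
  have v: "?v \<in> tangent_space M x"
    using geodesic_velocity_in_tangent_space[OF geo, of 0] ends by (simp add: trivial_limit_within)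
  have Exp: "Exp M x (tscale s ?v) = \<gamma> s" if "s \<in> {0..1}" for s
    using Exp_geodesic[OF complete geo that] ends by simp
  have Exp1: "Exp M x ?v = y"
    using Exp[of 1] ends by (simp add: tscale_def)
  obtain r where r: "\<And>t. t \<in> {0..1} \<Longrightarrow> rnorm M (\<gamma> t) (velocity M {0..1} \<gamma> t) = r"
    using geodesic_constant_speed[OF geo] by blast
  \<comment> \<open>At constant speed over a unit interval the length is the initial speed, which
    turns minimality into the norm condition on feasible velocities.\<close>
  have "curve_length M \<gamma> = integral {0..1} (\<lambda>t::real. r)"
    unfolding curve_length_def by (rule integral_cong) (rule r)
  then have "rnorm M x ?v = rdist M x y"
    using r[of 0] ends len by simp
  moreover have "\<gamma> s \<in> X" if "s \<in> {0..1}" for s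
    using \<gamma>(2) that by blast
  moreover from this[of 1] have "y \<in> X"
    using ends by simp
  ultimately show ?thesis
    using v Exp Exp1 by (simp add: feasible_velocities_def)
qed

text \<open>One feasible velocity for each \<open>y\<close> suffices, since the direction chosen by
  the algorithm minimizes over all of them.\<close>

lemma grad_le_difference:
  assumes complete: "complete_riem M" and conv: "weakly_geodesically_convex M X"
    and f: "differentiable_at_point M f x" and reg: "regular M X f L" and xy: "x \<in> X" "y \<in> X"
  shows "\<exists>u\<in>feasible_velocities M X x. metric M x (grad M f x) u \<le> f y - f x"
proof -
  obtain \<gamma> where \<gamma>: "minimizing_geodesic M x y \<gamma>" "\<gamma> ` {0..1} \<subseteq> X"
    using conv xy unfolding weakly_geodesically_convex_def by blast
  let ?v = "velocity M {0..1} \<gamma> 0"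
  have geo: "geodesic_on M {0..1} \<gamma>" and ends: "\<gamma> 0 = x" "\<gamma> 1 = y"
    using \<gamma>(1) by (simp_all add: minimizing_geodesic_def)
  have v: "?v \<in> feasible_velocities M X x"
    by (rule feasible_velocity_of_geodesic[OF complete \<gamma>])
  then have vT: "?v \<in> tangent_space M x" by (simp add: feasible_velocities_def)
  have Exp: "Exp M x (tscale s ?v) = \<gamma> s" if "s \<in> {0..1}" for s
    using Exp_geodesic[OF complete geo that] ends by simp
  have Exp1: "Exp M x ?v = y"
    using Exp[of 1] ends by (simp add: tscale_def)
  have f_le: "f (\<gamma> s) \<le> (1 - s) * f x + s * f y" if "s \<in> {0..1}" for s
    using reg xy(1) v that Exp[OF that] Exp1 unfolding regular_def by metis
  obtain c where c: "c \<in> charts_at M x" using charts_at_nonempty by blast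
  note D = charts_atD[OF c]
  let ?m = "metric M x (grad M f x) ?v"
  have "((\<lambda>t. (f \<circ> chart_inv c) ((snd c \<circ> \<gamma>) t)) has_derivative
      (\<lambda>r. frechet_derivative (f \<circ> chart_inv c) (at (snd c x)) (r *\<^sub>R ?v c))) (at 0 within {0..1})"
  proof (rule has_derivative_compose[where f = "snd c \<circ> \<gamma>" and g = "f \<circ> chart_inv c"])
    show "(snd c \<circ> \<gamma> has_derivative (\<lambda>r. r *\<^sub>R ?v c)) (at 0 within {0..1})"
      using geodesic_onD(1)[OF geo, of 0 c] c ends
      by (simp add: velocity_def has_vector_derivative_def)
    show "(f \<circ> chart_inv c has_derivative frechet_derivative (f \<circ> chart_inv c) (at (snd c x)))
        (at ((snd c \<circ> \<gamma>) 0))"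
      using f c ends unfolding differentiable_at_point_def frechet_derivative_works by simp
  qed
  moreover have "frechet_derivative (f \<circ> chart_inv c) (at (snd c x)) (r *\<^sub>R ?v c) = ?m * r" for r
  proof -
    have "linear (frechet_derivative (f \<circ> chart_inv c) (at (snd c x)))"
      using f c unfolding differentiable_at_point_def by (blast intro: linear_frechet_derivative)
    then show ?thesis
      using metric_grad[OF f vT c] by (simp add: linear_cmul)
  qed
  ultimately have der: "((\<lambda>t. (f \<circ> chart_inv c) ((snd c \<circ> \<gamma>) t)) has_real_derivative ?m) (at 0 within {0..1})"
    by (simp add: has_field_derivative_def)
  have "eventually (\<lambda>s. s \<in> {0..1} \<longrightarrow> \<gamma> s \<in> fst c) (nhds 0)"
    using D ends by (intro eventually_in_open open_chart_domain geodesic_on_continuous[OF geo]) simp_all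
  then have ev: "eventually (\<lambda>s. s \<in> {0..1} \<longrightarrow> (f \<circ> chart_inv c) ((snd c \<circ> \<gamma>) s) = f (\<gamma> s)) (nhds 0)"
    by (rule eventually_mono) (simp add: chart_inv_chart[OF D(1)])
  have "(f \<circ> chart_inv c) ((snd c \<circ> \<gamma>) 0) = f (\<gamma> 0)"
    using D(2) ends by (simp add: chart_inv_chart[OF D(1)])
  from has_vector_derivative_cong_ev[OF ev this] der
  have "((\<lambda>t. f (\<gamma> t)) has_real_derivative ?m) (at 0 within {0..1})"
    unfolding has_real_derivative_iff_has_vector_derivative by blast
  \<comment> \<open>The derivative at 0 is one-sided; convexity bounds every difference quotient on
    that side by \<open>f y - f x\<close>, and the bound survives the limit.\<close>
  then have lim: "((\<lambda>s. (f (\<gamma> s) - f x) / s) \<longlongrightarrow> ?m) (at 0 within {0..1})"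
    by (simp add: has_field_derivative_iff ends)
  have "?m \<le> f y - f x"
  proof (rule tendsto_upperbound[OF lim])
    show "\<forall>\<^sub>F s in at 0 within {0..1}. (f (\<gamma> s) - f x) / s \<le> f y - f x"
      unfolding eventually_at_filter
    proof (intro always_eventually allI impI)
      fix s :: real assume s: "s \<noteq> 0" "s \<in> {0..1}"
      have "f (\<gamma> s) - f x \<le> (f y - f x) * s"
        using f_le[OF s(2)] by (simp add: algebra_simps)
      then show "(f (\<gamma> s) - f x) / s \<le> f y - f x"
        using s by (simp add: divide_le_eq)
    qed
  qed (simp add: trivial_limit_within)
  then show ?thesis using v by blast
qed

end


section \<open>Length of curves and boundedness of the distance\<close>

text \<open>The exceptions will be break points of curves, where the velocity may be meaningless. A
  function that is not integrable has integral 0, so that case satisfies the bound too.\<close>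

lemma integral_nonneg_finite_exceptions:
  fixes f :: "real \<Rightarrow> real"
  assumes "finite F" "\<And>t. t \<in> S - F \<Longrightarrow> 0 \<le> f t"
  shows "0 \<le> integral S f"
proof -
  have "integral S f = integral S (\<lambda>t. max 0 (f t))"
    by (rule integral_spike[OF negligible_finite[OF assms(1)]]) (use assms(2) in \<open>simp add: max_absorb2\<close>)
  also have "\<dots> \<ge> 0"
    by (cases "(\<lambda>t. max 0 (f t)) integrable_on S") (simp_all add: integral_nonneg not_integrable_integral)
  finally show ?thesis .
qed

text \<open>In the application it is the speed \<open>f\<close> of the joined curve that is
  integrable; integrability of \<open>g\<close> results from inverting the substitution.\<close>

lemma integral_rescale_2:
  fixes f g :: "real \<Rightarrow> real"
  assumes F: "finite F" "\<And>t. t \<in> {a..b} - F \<Longrightarrow> f t = 2 * g (2 * t + k)" and f: "f integrable_on {a..b}"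
  shows "integral {a..b} f = integral {2 * a + k..2 * b + k} g"
proof -
  have "((\<lambda>t. 2 * g (2 * t + k)) has_integral integral {a..b} f) {a..b}"
    by (rule has_integral_spike_finite[OF F(1) _ integrable_integral[OF f]]) (simp add: F(2))
  from has_integral_affinity'[OF this[folded box_real(2)], of "1/2" "- k / 2"]
  have "((\<lambda>x. 2 * g x) has_integral 2 * integral {a..b} f) {2 * a + k..2 * b + k}"
    by (simp add: algebra_simps)
  from has_integral_mult_right[OF this, of "1/2"] show ?thesis
    by (simp add: integral_unique)
qed

lemma partition_cases:
  fixes s :: "nat \<Rightarrow> real"
  assumes "s 0 \<le> t" "t \<le> s n"
  obtains "t \<in> s ` {..n}" | i where "i < n" "s i < t" "t < s (Suc i)"
proof -
  have "t \<in> s ` {..n} \<or> (\<exists>i<n. s i < t \<and> t < s (Suc i))"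
    using assms(2)
  proof (induction n)
    case (Suc n)
    show ?case
    proof (cases "t \<le> s n")
      case True
      with Suc.IH show ?thesis by (force intro: less_SucI)
    next
      case False
      with Suc.prems have "t = s (Suc n) \<or> (s n < t \<and> t < s (Suc n))" by auto
      then show ?thesis by blast
    qed
  qed (use assms(1) in simp)
  then show thesis using that by blast
qed

lemma partition_mono:
  fixes s :: "nat \<Rightarrow> real"
  assumes "\<And>i. i < n \<Longrightarrow> s i < s (Suc i)" "i \<le> j" "j \<le> n"
  shows "s i \<le> s j"
  using assms(2,3)
proof (induction j rule: dec_induct)
  case (step m)
  then show ?case using assms(1)[of m] by simp
qed simp

context riemannian
begin

section \<open>Piecewise C1 curves and their length\<close>

lemma C1_curve_onI:
  assumes cont: "continuous_on I \<gamma>" and nontriv: "\<And>t. t \<in> I \<Longrightarrow> at t within I \<noteq> bot"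
    and p: "\<And>c t. c \<in> atlas M \<Longrightarrow> t \<in> I \<Longrightarrow> \<gamma> t \<in> fst c \<Longrightarrow>
      (snd c \<circ> \<gamma> has_vector_derivative p c t) (at t within I)"
    and p_cont: "\<And>c. c \<in> atlas M \<Longrightarrow> continuous_on {t \<in> I. \<gamma> t \<in> fst c} (p c)"
  shows "C1_curve_on M I \<gamma>"
  unfolding C1_curve_on_def
proof (intro conjI ballI impI cont)
  fix c assume c: "c \<in> atlas M"
  show "(snd c \<circ> \<gamma>) differentiable (at t within I)" if "t \<in> I" "\<gamma> t \<in> fst c" for t
    using p[OF c that] by (rule differentiableI_vector)
  show "continuous_on {t \<in> I. \<gamma> t \<in> fst c} (\<lambda>t. vector_derivative (snd c \<circ> \<gamma>) (at t within I))"
    using p_cont[OF c]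
    by (rule continuous_on_eq) (use vector_derivative_within[OF nontriv p] c in auto)
qed

lemma C1_curve_onD:
  assumes "C1_curve_on M I \<gamma>"
  shows "continuous_on I \<gamma>"
    and "c \<in> atlas M \<Longrightarrow> t \<in> I \<Longrightarrow> \<gamma> t \<in> fst c \<Longrightarrow>
      (snd c \<circ> \<gamma> has_vector_derivative vector_derivative (snd c \<circ> \<gamma>) (at t within I)) (at t within I)"
    and "c \<in> atlas M \<Longrightarrow> continuous_on {t \<in> I. \<gamma> t \<in> fst c} (\<lambda>t. vector_derivative (snd c \<circ> \<gamma>) (at t within I))"
  using assms unfolding C1_curve_on_def vector_derivative_works by blast+

text \<open>Agreement is required on \<open>{a..b}\<close> alone, because a joined path coincides
  with a rescaled piece on one half of its domain.\<close>

lemma C1_curve_on_affine: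
  assumes \<gamma>: "C1_curve_on M {m * a + k..m * b + k} \<gamma>" and ab: "a < b" and m: "m > 0"
    and \<delta>: "\<And>t. t \<in> {a..b} \<Longrightarrow> \<delta> t = \<gamma> (m * t + k)"
  shows "C1_curve_on M {a..b} \<delta>"
proof -
  let ?J = "{m * a + k..m * b + k}"
  let ?p = "\<lambda>c t. vector_derivative (snd c \<circ> \<gamma>) (at t within ?J)"
  have J: "m * t + k \<in> ?J" if "t \<in> {a..b}" for t using that m by simp
  show ?thesis
  proof (rule C1_curve_onI[where p = "\<lambda>c t. m *\<^sub>R ?p c (m * t + k)"])
    have "continuous_on {a..b} (\<lambda>t. \<gamma> (m * t + k))"
      using J by (intro continuous_on_compose2[OF C1_curve_onD(1)[OF \<gamma>]] continuous_intros) auto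
    then show "continuous_on {a..b} \<delta>"
      by (rule continuous_on_eq) (simp add: \<delta>)
    show "at t within {a..b} \<noteq> bot" if "t \<in> {a..b}" for t
      using that ab by (simp add: trivial_limit_within)
    fix c assume c: "c \<in> atlas M"
    show "(snd c \<circ> \<delta> has_vector_derivative m *\<^sub>R ?p c (m * t + k)) (at t within {a..b})"
      if t: "t \<in> {a..b}" and dom: "\<delta> t \<in> fst c" for t
    proof -
      have "((\<lambda>t. m * t + k) has_vector_derivative m) (at t within {a..b})"
        unfolding has_real_derivative_iff_has_vector_derivative[symmetric]
        by (auto intro!: derivative_eq_intros)
      moreover have "(snd c \<circ> \<gamma> has_vector_derivative ?p c (m * t + k))
          (at (m * t + k) within (\<lambda>t. m * t + k) ` {a..b})"
        using C1_curve_onD(2)[OF \<gamma> c J[OF t]] dom \<delta>[OF t] J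
        by (auto intro: has_vector_derivative_within_subset)
      ultimately have "((snd c \<circ> \<gamma>) \<circ> (\<lambda>t. m * t + k) has_vector_derivative m *\<^sub>R ?p c (m * t + k))
          (at t within {a..b})"
        by (rule vector_diff_chain_within)
      then show ?thesis
        by (rule has_vector_derivative_transform[OF t, rotated]) (simp add: \<delta>)
    qed
    show "continuous_on {t \<in> {a..b}. \<delta> t \<in> fst c} (\<lambda>t. m *\<^sub>R ?p c (m * t + k))"
    proof (intro continuous_intros continuous_on_compose2[OF C1_curve_onD(3)[OF \<gamma> c]])
      show "(\<lambda>t. m * t + k) ` {t \<in> {a..b}. \<delta> t \<in> fst c} \<subseteq> {t \<in> ?J. \<gamma> t \<in> fst c}"
        using J \<delta> by auto
    qed
  qed
qed

text \<open>Off the partition points a derivative within a piece is a two-sided derivative. Both 0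
  and 1 are partition points, so every remaining time is interior.\<close>

lemma piecewise_C1_regular:
  assumes "piecewise_C1_curve M \<gamma>"
  obtains F where "finite F" "\<And>t. t \<in> {0..1} - F \<Longrightarrow> 0 < t \<and> t < 1 \<and> continuous (at t) \<gamma> \<and>
    (\<forall>c\<in>charts_at M (\<gamma> t). (snd c \<circ> \<gamma>) differentiable (at t))"
proof -
  obtain n and s :: "nat \<Rightarrow> real" where s: "s 0 = 0" "s n = 1"
    and C1: "\<And>i. i < n \<Longrightarrow> s i < s (Suc i) \<and> C1_curve_on M {s i..s (Suc i)} \<gamma>"
    using assms unfolding piecewise_C1_curve_def by blast
  show thesis
  proof (rule that[of "s ` {..n}"])
    fix t assume t: "t \<in> {0..1} - s ` {..n}"
    then obtain i where i: "i < n" "s i < t" "t < s (Suc i)"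
      using partition_cases[of s t n] s by auto
    have at: "at t within {s i..s (Suc i)} = at t"
      using i by (simp add: at_within_Icc_at)
    note C = C1_curve_onD[OF conjunct2[OF C1[OF i(1)]]]
    have mem: "t \<in> {s i..s (Suc i)}" using i by simp
    have "continuous (at t within {s i..s (Suc i)}) \<gamma>"
      using C(1) mem continuous_on_eq_continuous_within by blast
    moreover have "(snd c \<circ> \<gamma>) differentiable (at t within {s i..s (Suc i)})"
      if "c \<in> charts_at M (\<gamma> t)" for c
      using C(2)[OF charts_atD(1)[OF that] mem charts_atD(2)[OF that]] by (rule differentiableI_vector)
    moreover have "t \<noteq> 0" "t \<noteq> 1" using t s by force+
    ultimately show "0 < t \<and> t < 1 \<and> continuous (at t) \<gamma> \<and>
        (\<forall>c\<in>charts_at M (\<gamma> t). (snd c \<circ> \<gamma>) differentiable (at t))"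
      using t unfolding at by auto
  qed simp
qed

lemma velocity_interior:
  assumes "0 < t" "t < 1" shows "velocity M {0..1} \<gamma> t = velocity M UNIV \<gamma> t"
  by (simp only: velocity_def at_within_Icc_at[OF assms])

lemma curve_length_nonneg:
  assumes "piecewise_C1_curve M \<gamma>" shows "curve_length M \<gamma> \<ge> 0"
proof -
  obtain F where F: "finite F" "\<And>t. t \<in> {0..1} - F \<Longrightarrow> 0 < t \<and> t < 1 \<and> continuous (at t) \<gamma> \<and>
    (\<forall>c\<in>charts_at M (\<gamma> t). (snd c \<circ> \<gamma>) differentiable (at t))"
    using piecewise_C1_regular[OF assms] by blast
  show ?thesis
    unfolding curve_length_def
  proof (rule integral_nonneg_finite_exceptions[OF F(1)])
    fix t assume "t \<in> {0..1} - F"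
    note t = F(2)[OF this]
    have "velocity M UNIV \<gamma> t \<in> tangent_space M (\<gamma> t)"
      by (rule velocity_in_tangent_space) (use t in auto)
    then show "0 \<le> rnorm M (\<gamma> t) (velocity M {0..1} \<gamma> t)"
      using t by (simp add: velocity_interior rnorm_nonneg)
  qed
qed

lemma velocity_affine:
  assumes cont: "continuous (at (m * t + k)) \<gamma>"
    and diff: "\<And>c. c \<in> charts_at M (\<gamma> (m * t + k)) \<Longrightarrow> (snd c \<circ> \<gamma>) differentiable (at (m * t + k))"
    and ev: "eventually (\<lambda>s. \<delta> s = \<gamma> (m * s + k)) (nhds t)"
  shows "velocity M UNIV \<delta> t = tscale m (velocity M UNIV \<gamma> (m * t + k))"
proof
  fix c
  have \<delta>t: "\<delta> t = \<gamma> (m * t + k)" using ev by (rule eventually_nhds_x_imp_x)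
  show "velocity M UNIV \<delta> t c = tscale m (velocity M UNIV \<gamma> (m * t + k)) c"
  proof (cases "c \<in> charts_at M (\<gamma> (m * t + k))")
    case True
    have "((\<lambda>t. m * t + k) has_vector_derivative m) (at t)"
      unfolding has_real_derivative_iff_has_vector_derivative[symmetric]
      by (auto intro!: derivative_eq_intros)
    from vector_diff_chain_at[OF this] diff[OF True]
    have der: "((snd c \<circ> \<gamma>) \<circ> (\<lambda>t. m * t + k) has_vector_derivative
        m *\<^sub>R vector_derivative (snd c \<circ> \<gamma>) (at (m * t + k))) (at t)"
      unfolding vector_derivative_works by blast
    have ev': "eventually (\<lambda>s. s \<in> UNIV \<longrightarrow> ((snd c \<circ> \<gamma>) \<circ> (\<lambda>t. m * t + k)) s = (snd c \<circ> \<delta>) s) (nhds t)"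
      using ev by (rule eventually_mono) simp
    have eq: "((snd c \<circ> \<gamma>) \<circ> (\<lambda>t. m * t + k)) t = (snd c \<circ> \<delta>) t"
      using \<delta>t by simp
    have "(snd c \<circ> \<delta> has_vector_derivative
        m *\<^sub>R vector_derivative (snd c \<circ> \<gamma>) (at (m * t + k))) (at t)"
      using has_vector_derivative_cong_ev[OF ev' eq] der by blast
    then show ?thesis
      using True \<delta>t by (simp add: velocity_def tscale_def vector_derivative_at)
  qed (simp add: velocity_def tscale_def \<delta>t)
qed

section \<open>Concatenation of curves\<close>

lemma piecewise_C1_curve_join:
  assumes \<gamma>: "piecewise_C1_curve M \<gamma>" and \<delta>: "piecewise_C1_curve M \<delta>" and eq: "\<gamma> 1 = \<delta> 0"
  shows "piecewise_C1_curve M (\<gamma> +++ \<delta>)"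
proof -
  obtain m and r :: "nat \<Rightarrow> real" where r: "r 0 = 0" "r m = 1"
    and rC1: "\<And>i. i < m \<Longrightarrow> r i < r (Suc i) \<and> C1_curve_on M {r i..r (Suc i)} \<gamma>"
    using \<gamma> unfolding piecewise_C1_curve_def by blast
  obtain n and s :: "nat \<Rightarrow> real" where s: "s 0 = 0" "s n = 1"
    and sC1: "\<And>i. i < n \<Longrightarrow> s i < s (Suc i) \<and> C1_curve_on M {s i..s (Suc i)} \<delta>"
    using \<delta> unfolding piecewise_C1_curve_def by blast
  have r_less: "r i < r (Suc i)" if "i < m" for i using rC1[OF that] by blast
  have s_less: "s i < s (Suc i)" if "i < n" for i using sC1[OF that] by blast
  \<comment> \<open>Both partitions are halved and the second is shifted by 1/2. At
    \<open>i = m\<close> the two formulas agree since \<open>r m = 1\<close> and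
    \<open>s 0 = 0\<close>.\<close>
  define q where "q i = (if i \<le> m then r i / 2 else 1 / 2 + s (i - m) / 2)" for i
  have q_right: "q i = 1 / 2 + s (i - m) / 2" if "i \<ge> m" for i
    using that r s by (cases "i = m") (auto simp: q_def)
  have "n > 0" using s by (cases n) auto
  show ?thesis
    unfolding piecewise_C1_curve_def
  proof (intro exI[of _ "m + n"] exI[of _ q] conjI allI impI)
    show "q 0 = 0" using r by (simp add: q_def)
    show "q (m + n) = 1" using q_right[of "m + n"] s by simp
    fix i assume i: "i < m + n"
    have "q i < q (Suc i) \<and> C1_curve_on M {q i..q (Suc i)} (\<gamma> +++ \<delta>)"
    proof (cases "i < m")
      case True
      have q: "q i = r i / 2" "q (Suc i) = r (Suc i) / 2" using True by (simp_all add: q_def)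
      have "r (Suc i) \<le> r m"
      proof (rule partition_mono[of m])
        show "r j < r (Suc j)" if "j < m" for j by (rule r_less[OF that])
        show "Suc i \<le> m" using True by simp
      qed (rule order_refl)
      then have "r (Suc i) \<le> 1" unfolding r(2) .
      have "C1_curve_on M {q i..q (Suc i)} (\<gamma> +++ \<delta>)"
      proof (rule C1_curve_on_affine[where m = 2 and k = 0 and \<gamma> = \<gamma>])
        show "C1_curve_on M {2 * q i + 0..2 * q (Suc i) + 0} \<gamma>"
          using conjunct2[OF rC1[OF True]] by (simp add: q)
        show "q i < q (Suc i)" using r_less[OF True] by (simp add: q)
        show "(\<gamma> +++ \<delta>) t = \<gamma> (2 * t + 0)" if "t \<in> {q i..q (Suc i)}" for t
          using that \<open>r (Suc i) \<le> 1\<close> by (simp add: q joinpaths_def)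
      qed simp
      then show ?thesis using r_less[OF True] by (simp add: q)
    next
      case False
      define j where "j = i - m"
      have j: "j < n" "Suc i - m = Suc j" using False i by (auto simp: j_def)
      have q: "q i = 1 / 2 + s j / 2" "q (Suc i) = 1 / 2 + s (Suc j) / 2"
        using False q_right[of i] q_right[of "Suc i"] j by (simp_all add: j_def)
      have "s 0 \<le> s j"
      proof (rule partition_mono[of n])
        show "s l < s (Suc l)" if "l < n" for l by (rule s_less[OF that])
        show "j \<le> n" using j(1) by simp
      qed simp
      then have "0 \<le> s j" unfolding s(1) .
      \<comment> \<open>At 1/2 a joined path takes its value from the first curve, and there
        \<open>eq\<close> enters.\<close>
      have join: "(\<gamma> +++ \<delta>) t = \<delta> (2 * t + - 1)" if "t \<ge> 1 / 2" for t
      proof (cases "t = 1 / 2")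
        case True
        show ?thesis unfolding True by (simp add: joinpaths_def eq)
      qed (use that in \<open>simp add: joinpaths_def\<close>)
      have "C1_curve_on M {q i..q (Suc i)} (\<gamma> +++ \<delta>)"
      proof (rule C1_curve_on_affine[where m = 2 and k = "-1" and \<gamma> = \<delta>])
        show "C1_curve_on M {2 * q i + - 1..2 * q (Suc i) + - 1} \<delta>"
          using conjunct2[OF sC1[OF j(1)]] by (simp add: q)
        show "q i < q (Suc i)" using s_less[OF j(1)] by (simp add: q)
        show "(\<gamma> +++ \<delta>) t = \<delta> (2 * t + - 1)" if "t \<in> {q i..q (Suc i)}" for t
          using that \<open>0 \<le> s j\<close> by (intro join) (simp add: q)
      qed simp
      then show ?thesis using s_less[OF j(1)] by (simp add: q)
    qed
    then show "q i < q (Suc i)" "C1_curve_on M {q i..q (Suc i)} (\<gamma> +++ \<delta>)" by blast+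
  qed
qed

text \<open>
  An inequality suffices and needs no integrability: a curve whose speed is not integrable has
  length \<open>0\<close> by convention.
\<close>

lemma curve_length_join:
  assumes \<gamma>: "piecewise_C1_curve M \<gamma>" and \<delta>: "piecewise_C1_curve M \<delta>"
  shows "curve_length M (\<gamma> +++ \<delta>) \<le> curve_length M \<gamma> + curve_length M \<delta>"
proof -
  let ?s = "\<lambda>\<gamma> t. rnorm M (\<gamma> t) (velocity M {0..1} \<gamma> t)"
  obtain F where F: "finite F" "\<And>t. t \<in> {0..1} - F \<Longrightarrow> 0 < t \<and> t < 1 \<and> continuous (at t) \<gamma> \<and>
    (\<forall>c\<in>charts_at M (\<gamma> t). (snd c \<circ> \<gamma>) differentiable (at t))"
    using piecewise_C1_regular[OF \<gamma>] by blast
  obtain F' where F': "finite F'" "\<And>t. t \<in> {0..1} - F' \<Longrightarrow> 0 < t \<and> t < 1 \<and> continuous (at t) \<delta> \<and>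
    (\<forall>c\<in>charts_at M (\<delta> t). (snd c \<circ> \<delta>) differentiable (at t))"
    using piecewise_C1_regular[OF \<delta>] by blast
  have speed: "rnorm M (\<epsilon> t) (velocity M {0..1} \<epsilon> t) = 2 * ?s \<zeta> (2 * t + k)"
    if t: "0 < t" "t < 1" and ev: "eventually (\<lambda>s. \<epsilon> s = \<zeta> (2 * s + k)) (nhds t)"
      and reg: "0 < 2 * t + k \<and> 2 * t + k < 1 \<and> continuous (at (2 * t + k)) \<zeta> \<and>
        (\<forall>c\<in>charts_at M (\<zeta> (2 * t + k)). (snd c \<circ> \<zeta>) differentiable (at (2 * t + k)))"
    for \<epsilon> \<zeta> :: "real \<Rightarrow> 'm" and t k
  proof -
    have "velocity M UNIV \<epsilon> t = tscale 2 (velocity M UNIV \<zeta> (2 * t + k))"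
      using reg ev by (intro velocity_affine) auto
    moreover have "velocity M UNIV \<zeta> (2 * t + k) \<in> tangent_space M (\<zeta> (2 * t + k))"
      using reg by (intro velocity_in_tangent_space) auto
    moreover have "\<epsilon> t = \<zeta> (2 * t + k)" using ev by (rule eventually_nhds_x_imp_x)
    ultimately show ?thesis
      using t reg by (simp add: velocity_interior rnorm_tscale)
  qed
  let ?f = "?s (\<gamma> +++ \<delta>)"
  show ?thesis
  proof (cases "?f integrable_on {0..1}")
    case True
    have "integral {0..1/2} ?f = integral {2 * 0 + 0..2 * (1/2) + 0} (?s \<gamma>)"
    proof (rule integral_rescale_2)
      \<comment> \<open>Excluded are the rescaled exceptional times of \<gamma> and the junction
        1/2, where the joined curve may have a corner.\<close>
      show "finite (insert (1/2) ((\<lambda>t. t / 2) ` F))" using F(1) by simp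
      show "?f integrable_on {0..1/2}" using True by (rule integrable_subinterval_real) simp
      fix t assume t: "t \<in> {0..1/2} - insert (1/2) ((\<lambda>t. t / 2) ` F)"
      have "2 * t \<notin> F"
      proof
        assume "2 * t \<in> F"
        then have "(2 * t) / 2 \<in> (\<lambda>t. t / 2) ` F" by (rule imageI)
        then show False using t by simp
      qed
      then have "2 * t + 0 \<in> {0..1} - F" using t by simp
      note reg = F(2)[OF this]
      have "eventually (\<lambda>s. s \<in> {..<1/2}) (nhds t)"
        using t by (intro eventually_nhds_in_open) auto
      then have "eventually (\<lambda>s. (\<gamma> +++ \<delta>) s = \<gamma> (2 * s + 0)) (nhds t)"
        by (rule eventually_mono) (simp add: joinpaths_def)
      then show "?f t = 2 * ?s \<gamma> (2 * t + 0)"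
        using reg by (intro speed) auto
    qed
    moreover have "integral {1/2..1} ?f = integral {2 * (1/2) + - 1..2 * 1 + - 1} (?s \<delta>)"
    proof (rule integral_rescale_2)
      show "finite (insert (1/2) ((\<lambda>t. (t + 1) / 2) ` F'))" using F'(1) by simp
      show "?f integrable_on {1/2..1}" using True by (rule integrable_subinterval_real) simp
      fix t assume t: "t \<in> {1/2..1} - insert (1/2) ((\<lambda>t. (t + 1) / 2) ` F')"
      have "2 * t + - 1 \<notin> F'"
      proof
        assume "2 * t + - 1 \<in> F'"
        then have "(2 * t + - 1 + 1) / 2 \<in> (\<lambda>t. (t + 1) / 2) ` F'" by (rule imageI)
        then show False using t by simp
      qed
      then have "2 * t + - 1 \<in> {0..1} - F'" using t by auto
      note reg = F'(2)[OF this]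
      have "eventually (\<lambda>s. s \<in> {1/2<..}) (nhds t)"
        using t by (intro eventually_nhds_in_open) auto
      then have "eventually (\<lambda>s. (\<gamma> +++ \<delta>) s = \<delta> (2 * s + - 1)) (nhds t)"
        by (rule eventually_mono) (simp add: joinpaths_def)
      then show "?f t = 2 * ?s \<delta> (2 * t + - 1)"
        using reg by (intro speed) auto
    qed
    moreover have "integral {0..1/2} ?f + integral {1/2..1} ?f = integral {0..1} ?f"
      by (rule Henstock_Kurzweil_Integration.integral_combine) (use True in auto)
    ultimately show ?thesis by (simp add: curve_length_def)
  next
    case False
    then show ?thesis
      using curve_length_nonneg[OF \<gamma>] curve_length_nonneg[OF \<delta>]
      by (simp add: curve_length_def not_integrable_integral)
  qed
qed

text \<open>
  Bounding \<open>rdist\<close> from above requires an actual curve, the infimum of the empty set of lengths being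
  an unspecified real number.
\<close>

definition joinable_within :: "real \<Rightarrow> 'm \<Rightarrow> 'm \<Rightarrow> bool" where
  "joinable_within B x y \<longleftrightarrow>
     (\<exists>\<gamma>. piecewise_C1_curve M \<gamma> \<and> \<gamma> 0 = x \<and> \<gamma> 1 = y \<and> curve_length M \<gamma> \<le> B)"

lemma joinable_within_mono: "joinable_within B x y \<Longrightarrow> B \<le> C \<Longrightarrow> joinable_within C x y"
  unfolding joinable_within_def by (blast intro: order_trans)

lemma joinable_within_trans:
  assumes "joinable_within B x y" "joinable_within C y z" shows "joinable_within (B + C) x z"
proof -
  obtain \<gamma> where \<gamma>: "piecewise_C1_curve M \<gamma>" "\<gamma> 0 = x" "\<gamma> 1 = y" "curve_length M \<gamma> \<le> B"
    using assms(1) unfolding joinable_within_def by blast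
  obtain \<delta> where \<delta>: "piecewise_C1_curve M \<delta>" "\<delta> 0 = y" "\<delta> 1 = z" "curve_length M \<delta> \<le> C"
    using assms(2) unfolding joinable_within_def by blast
  have "piecewise_C1_curve M (\<gamma> +++ \<delta>)"
    using \<gamma> \<delta> by (intro piecewise_C1_curve_join) auto
  moreover have "curve_length M (\<gamma> +++ \<delta>) \<le> B + C"
    using curve_length_join[OF \<gamma>(1) \<delta>(1)] \<gamma>(4) \<delta>(4) by linarith
  ultimately show ?thesis
    unfolding joinable_within_def using \<gamma> \<delta>
    by (intro exI[of _ "\<gamma> +++ \<delta>"]) (auto simp: joinpaths_def)
qed

lemma rdist_le:
  assumes "joinable_within B x y" shows "rdist M x y \<le> B"
proof -
  let ?S = "{curve_length M \<gamma> | \<gamma>. piecewise_C1_curve M \<gamma> \<and> \<gamma> 0 = x \<and> \<gamma> 1 = y}"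
  obtain \<gamma> where \<gamma>: "piecewise_C1_curve M \<gamma>" "\<gamma> 0 = x" "\<gamma> 1 = y" "curve_length M \<gamma> \<le> B"
    using assms unfolding joinable_within_def by blast
  have "curve_length M \<gamma> \<in> ?S" using \<gamma>(1-3) by blast
  moreover have "bdd_below ?S"
  proof (rule bdd_belowI[of _ 0])
    show "0 \<le> l" if "l \<in> ?S" for l using that curve_length_nonneg by blast
  qed
  ultimately have "Inf ?S \<le> curve_length M \<gamma>" by (rule cInf_lower)
  then show ?thesis
    unfolding rdist_def using \<gamma>(4) by (rule order_trans)
qed

section \<open>Joining points by geodesics and chart segments\<close>

lemma C1_curve_imp_piecewise: "C1_curve_on M {0..1} \<gamma> \<Longrightarrow> piecewise_C1_curve M \<gamma>"
  unfolding piecewise_C1_curve_def by (intro exI[of _ 1] exI[of _ real]) simp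

text \<open>The velocity of a geodesic is differentiable, hence continuous.\<close>

lemma geodesic_imp_C1_curve:
  assumes \<gamma>: "geodesic_on M {0..1} \<gamma>" shows "C1_curve_on M {0..1} \<gamma>"
proof (rule C1_curve_onI[where p = "\<lambda>c t. vector_derivative (snd c \<circ> \<gamma>) (at t within {0..1})"])
  show "continuous_on {0..1} \<gamma>" using \<gamma> by (simp add: geodesic_on_def)
  fix c assume c: "c \<in> atlas M"
  show "(snd c \<circ> \<gamma> has_vector_derivative vector_derivative (snd c \<circ> \<gamma>) (at t within {0..1})) (at t within {0..1})"
    if "t \<in> {0..1}" "\<gamma> t \<in> fst c" for t
    by (rule geodesic_onD(1)[OF \<gamma> that(1) charts_atI[OF c that(2)]])
  show "continuous_on {t \<in> {0..1}. \<gamma> t \<in> fst c} (\<lambda>t. vector_derivative (snd c \<circ> \<gamma>) (at t within {0..1}))"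
    unfolding continuous_on_eq_continuous_within
  proof
    fix t assume t: "t \<in> {t \<in> {0..1}. \<gamma> t \<in> fst c}"
    have "continuous (at t within {0..1}) (\<lambda>t. vector_derivative (snd c \<circ> \<gamma>) (at t within {0..1}))"
      using geodesic_onD(2)[OF \<gamma> _ charts_atI[OF c]] t has_vector_derivative_continuous by blast
    then show "continuous (at t within {t \<in> {0..1}. \<gamma> t \<in> fst c})
        (\<lambda>t. vector_derivative (snd c \<circ> \<gamma>) (at t within {0..1}))"
      by (rule continuous_within_subset) blast
  qed
qed (simp add: trivial_limit_within)

lemma joinable_within_geodesic:
  assumes "weakly_geodesically_convex M X" "x \<in> X" "y \<in> X"
  shows "\<exists>B. joinable_within B x y"
proof -
  obtain \<gamma> where "minimizing_geodesic M x y \<gamma>"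
    using assms unfolding weakly_geodesically_convex_def by blast
  then show ?thesis
    unfolding joinable_within_def minimizing_geodesic_def
    using geodesic_imp_C1_curve C1_curve_imp_piecewise order_refl by metis
qed

text \<open>The curve is a straight segment in the chart \<open>c\<close>. Its velocity there is the
  constant \<open>p' - p\<close>, and in another chart the image under the differential of the
  transition, continuous by smoothness of the atlas.\<close>

lemma joinable_within_chart_segment:
  assumes c: "c \<in> atlas M" and B: "convex B" "B \<subseteq> snd c ` fst c" and p: "p \<in> B" "p' \<in> B"
    and C: "\<And>p u. p \<in> B \<Longrightarrow> metric_coord M c p u u \<le> C * (norm u)\<^sup>2" "C \<ge> 0"
  shows "joinable_within (sqrt C * norm (p' - p)) (chart_inv c p) (chart_inv c p')"
proof -
  define l where "l = (\<lambda>t::real. p + t *\<^sub>R (p' - p))"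
  define \<gamma> where "\<gamma> = chart_inv c \<circ> l"
  have nontriv: "at t within {0..1} \<noteq> bot" if "t \<in> {0..1}" for t :: real
    using that by (simp add: trivial_limit_within)
  have lB: "l t \<in> B" if "t \<in> {0..1}" for t
  proof -
    have "l t = (1 - t) *\<^sub>R p + t *\<^sub>R p'" by (simp add: l_def algebra_simps)
    then show ?thesis using convexD_alt[OF B(1) p, of t] that by simp
  qed
  have l: "(l has_vector_derivative p' - p) (at t within S)" for t S
    unfolding l_def has_vector_derivative_def by (auto intro!: derivative_eq_intros)
  have dom: "\<gamma> t \<in> fst c" "snd c (\<gamma> t) = l t" if "t \<in> {0..1}" for t
    using chart_inv_in_domain[OF c] chart_chart_inv[OF c] lB[OF that] B(2) by (auto simp: \<gamma>_def)
  have cont_l: "continuous_on S l" for S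
    unfolding l_def by (intro continuous_intros)
  have cont: "continuous_on {0..1} \<gamma>"
    unfolding \<gamma>_def using lB B(2)
    by (intro continuous_on_compose cont_l continuous_on_subset[OF continuous_on_chart_inv[OF c]]) auto
  have der: "(snd c' \<circ> \<gamma> has_vector_derivative jac c c' (\<gamma> t) (p' - p)) (at t within {0..1})"
    if t: "t \<in> {0..1}" and c': "c' \<in> atlas M" "\<gamma> t \<in> fst c'" for c' t
  proof (rule chart_change_has_vector_derivative[OF _ t])
    show "(snd c \<circ> \<gamma> has_vector_derivative p' - p) (at t within {0..1})"
      using l by (rule has_vector_derivative_transform[OF t, rotated]) (simp add: dom)
    show "c \<in> charts_at M (\<gamma> t)" "c' \<in> charts_at M (\<gamma> t)"
      using c c' dom[OF t] by (simp_all add: charts_at_def)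
    show "continuous (at t within {0..1}) \<gamma>"
      using cont t by (simp add: continuous_on_eq_continuous_within)
  qed
  have "C1_curve_on M {0..1} \<gamma>"
  proof (rule C1_curve_onI[OF cont nontriv der])
    fix c' assume c': "c' \<in> atlas M"
    let ?S = "snd c ` (fst c \<inter> fst c')"
    have "continuous_on ?S (\<lambda>q. frechet_derivative (transition c c') (at q) (p' - p))"
      using transition_Ck_on[OF c c', of "Suc 0"] by simp
    then have "continuous_on {t \<in> {0..1}. \<gamma> t \<in> fst c'}
        (\<lambda>t. frechet_derivative (transition c c') (at (l t)) (p' - p))"
    proof (rule continuous_on_compose2[OF _ cont_l])
      show "l ` {t \<in> {0..1}. \<gamma> t \<in> fst c'} \<subseteq> ?S"
        using dom by (force simp: image_iff)
    qed
    then show "continuous_on {t \<in> {0..1}. \<gamma> t \<in> fst c'} (\<lambda>t. jac c c' (\<gamma> t) (p' - p))"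
      by (rule continuous_on_eq) (simp add: jac_def dom)
  qed
  then have pw: "piecewise_C1_curve M \<gamma>" by (rule C1_curve_imp_piecewise)
  let ?s = "\<lambda>t. rnorm M (\<gamma> t) (velocity M {0..1} \<gamma> t)"
  have speed: "?s t \<le> sqrt C * norm (p' - p)" if t: "t \<in> {0..1}" for t
  proof -
    have cc: "c \<in> charts_at M (\<gamma> t)" using c dom[OF t] by (simp add: charts_at_def)
    have v: "velocity M {0..1} \<gamma> t \<in> tangent_space M (\<gamma> t)"
      using t nontriv[OF t] cont der[OF t]
      by (intro velocity_in_tangent_space)
        (auto simp: continuous_on_eq_continuous_within charts_at_def intro: differentiableI_vector)
    have "velocity M {0..1} \<gamma> t c = p' - p"
      using vector_derivative_within[OF nontriv[OF t] der[OF t c]] dom[OF t] cc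
      by (simp add: velocity_def jac_self)
    then have "metric M (\<gamma> t) (velocity M {0..1} \<gamma> t) (velocity M {0..1} \<gamma> t)
        = metric_coord M c (l t) (p' - p) (p' - p)"
      using metric_eq_coord[OF cc v v] dom[OF t] by simp
    also have "\<dots> \<le> C * (norm (p' - p))\<^sup>2" by (rule C(1)[OF lB[OF t]])
    finally have "?s t \<le> sqrt (C * (norm (p' - p))\<^sup>2)"
      unfolding rnorm_def by (rule real_sqrt_le_mono)
    then show ?thesis by (simp add: real_sqrt_mult)
  qed
  \<comment> \<open>If the speed is not integrable, the length is 0 by convention and the bound
    still holds.\<close>
  have "curve_length M \<gamma> \<le> sqrt C * norm (p' - p)"
  proof (cases "?s integrable_on {0..1}")
    case True
    then have "curve_length M \<gamma> \<le> integral {0..1::real} (\<lambda>t. sqrt C * norm (p' - p))"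
      unfolding curve_length_def by (rule integral_le) (auto intro: speed)
    then show ?thesis by simp
  qed (simp add: curve_length_def not_integrable_integral C(2))
  then show ?thesis
    unfolding joinable_within_def using pw by (intro exI[of _ \<gamma>]) (simp add: \<gamma>_def l_def)
qed

text \<open>Both directions are obtained from chart segments, in place of a reversal of
  curves.\<close>

lemma joinable_within_neighbourhood:
  "\<exists>U B. open U \<and> x \<in> U \<and> (\<forall>y\<in>U. joinable_within B x y \<and> joinable_within B y x)"
proof -
  obtain c where c: "c \<in> charts_at M x" using charts_at_nonempty by blast
  note D = charts_atD[OF c]
  obtain r where r: "r > 0" "cball (snd c x) r \<subseteq> snd c ` fst c"
    using open_chart_image[OF D(1)] D(2) open_contains_cball by blast
  obtain C where C: "C \<ge> 0" "\<And>p u. p \<in> cball (snd c x) r \<Longrightarrow> metric_coord M c p u u \<le> C * (norm u)\<^sup>2"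
    using metric_coord_le[OF D(1) compact_cball r(2)] by blast
  define U where "U = fst c \<inter> snd c -` ball (snd c x) r"
  have "open U"
    unfolding U_def
    by (rule continuous_open_preimage[OF continuous_on_chart[OF D(1)] open_chart_domain[OF D(1)] open_ball])
  moreover have "x \<in> U" using D(2) r(1) by (simp add: U_def)
  moreover have "joinable_within (sqrt C * r) x y \<and> joinable_within (sqrt C * r) y x" if "y \<in> U" for y
  proof -
    have y: "y \<in> fst c" "snd c y \<in> cball (snd c x) r" using that by (auto simp: U_def)
    have x: "snd c x \<in> cball (snd c x) r" using r(1) by simp
    note seg = joinable_within_chart_segment[OF D(1) convex_cball r(2) _ _ C(2,1)]
    have "sqrt C * norm (snd c y - snd c x) \<le> sqrt C * r" "sqrt C * norm (snd c x - snd c y) \<le> sqrt C * r"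
      using y(2) C(1) by (auto intro!: mult_left_mono simp: dist_norm norm_minus_commute)
    then show ?thesis
      using joinable_within_mono[OF seg[OF x y(2)]] joinable_within_mono[OF seg[OF y(2) x]]
      unfolding chart_inv_chart[OF D] chart_inv_chart[OF D(1) y(1)] by blast
  qed
  ultimately show ?thesis by blast
qed

text \<open>The supremum defining \<open>diam\<close> is meaningful only once \<open>rdist\<close> is known to be bounded on \<open>X\<close>.\<close>

lemma rdist_le_diam:
  assumes X: "compact X" "weakly_geodesically_convex M X" and xy: "x \<in> X" "y \<in> X"
  shows "rdist M x y \<le> diam M X"
proof -
  \<comment> \<open>Around each point of \<open>X\<close>, one bound serves for joining a whole
    neighbourhood with the fixed base point \<open>x\<close>: a geodesic to the centre followed by a
    chart segment. Compactness then leaves finitely many bounds.\<close>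
  have "\<exists>U B. open U \<and> z \<in> U \<and> (\<forall>z'\<in>U. joinable_within B x z' \<and> joinable_within B z' x)" if z: "z \<in> X" for z
  proof -
    obtain U B where U: "open U" "z \<in> U" "\<And>z'. z' \<in> U \<Longrightarrow> joinable_within B z z' \<and> joinable_within B z' z"
      using joinable_within_neighbourhood[of z] by blast
    obtain B1 B2 where "joinable_within B1 x z" "joinable_within B2 z x"
      using joinable_within_geodesic[OF X(2)] xy(1) z by blast
    then have "joinable_within (B1 + B) x z'" "joinable_within (B + B2) z' x" if "z' \<in> U" for z'
      using U(3)[OF that] joinable_within_trans by blast+
    then have "joinable_within (max (B1 + B) (B + B2)) x z' \<and> joinable_within (max (B1 + B) (B + B2)) z' x"
      if "z' \<in> U" for z'
      using that joinable_within_mono[OF _ max.cobounded1] joinable_within_mono[OF _ max.cobounded2] by blast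
    then show ?thesis using U(1,2) by blast
  qed
  then obtain U B where U: "\<And>z. z \<in> X \<Longrightarrow> open (U z)" "\<And>z. z \<in> X \<Longrightarrow> z \<in> U z"
    "\<And>z z'. z \<in> X \<Longrightarrow> z' \<in> U z \<Longrightarrow> joinable_within (B z) x z' \<and> joinable_within (B z) z' x"
    by metis
  obtain Y where Y: "Y \<subseteq> X" "finite Y" "X \<subseteq> (\<Union>z\<in>Y. U z)"
    using compactE_image[OF X(1), of X U] U(1,2) by blast
  define b where "b = Max (B ` Y)"
  \<comment> \<open>Every pair is joined by way of \<open>x\<close>, which costs at most
    \<open>b\<close> on each side.\<close>
  have b: "rdist M z z' \<le> b + b" if z: "z \<in> X" "z' \<in> X" for z z'
  proof -
    obtain w w' where w: "w \<in> Y" "z \<in> U w" "w' \<in> Y" "z' \<in> U w'"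
      using Y(3) z by blast
    have "rdist M z z' \<le> B w + B w'"
    proof (rule rdist_le, rule joinable_within_trans)
      show "joinable_within (B w) z x" "joinable_within (B w') x z'"
        using U(3) w Y(1) by blast+
    qed
    moreover have "B w \<le> b" "B w' \<le> b"
      unfolding b_def using w Y(2) by simp_all
    ultimately show ?thesis by linarith
  qed
  have "bdd_above ((\<lambda>(x, y). rdist M x y) ` (X \<times> X))"
    by (rule bdd_aboveI[of _ "b + b"]) (use b in auto)
  from cSUP_upper[OF _ this, of "(x, y)"] show ?thesis
    using xy by (simp add: diam_def)
qed

end


section \<open>Convergence rate\<close>

text \<open>At \<open>k = 0\<close> the factor of \<open>h 0\<close> is
  \<open>1 - a / a = 0\<close>, so the initial value disappears and the induction can start at 1.
  Replacing \<open>a\<close> by 2 in the step leaves an elementary inequality in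
  \<open>s = k + a\<close>, with slack \<open>1 / (s\<^sup>2 * (s - 1))\<close>.\<close>

lemma open_loop_rate:
  fixes h :: "nat \<Rightarrow> real"
  assumes a: "a \<ge> 2" and C: "C \<ge> 0"
    and step: "\<And>k. h (Suc k) \<le> (1 - a / (real k + a)) * h k + C / (real k + a)\<^sup>2"
    and k: "k \<ge> 1"
  shows "h k \<le> C / (real k + a - 1)"
  using k
proof (induction k rule: dec_induct)
  case base
  have "h 1 \<le> C / a\<^sup>2" using step[of 0] a by simp
  also have "\<dots> \<le> C / a"
    using a C by (intro divide_left_mono) (auto simp: power2_eq_square)
  finally show ?case by simp
next
  case (step k)
  define s where "s = real k + a"
  have s: "s \<ge> 3" using a step.hyps by (simp add: s_def)
  have "h (Suc k) \<le> (1 - a / s) * h k + C / s\<^sup>2"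
    using assms(3)[of k] by (simp add: s_def)
  also have "(1 - a / s) * h k \<le> (1 - a / s) * (C / (s - 1))"
    using step.IH s by (intro mult_left_mono) (auto simp: s_def)
  also have "(1 - a / s) * (C / (s - 1)) + C / s\<^sup>2 = C * ((s - a) / (s * (s - 1)) + 1 / s\<^sup>2)"
    using s by (simp add: field_simps)
  also have "\<dots> \<le> C * (1 / s)"
  proof (rule mult_left_mono[OF _ C])
    have "(s - a) / (s * (s - 1)) \<le> (s - 2) / (s * (s - 1))"
      using a s by (intro divide_right_mono) auto
    also have "(s - 2) / (s * (s - 1)) + 1 / s\<^sup>2 \<le> 1 / s"
    proof -
      have "1 / s - ((s - 2) / (s * (s - 1)) + 1 / s\<^sup>2) = 1 / (s\<^sup>2 * (s - 1))"
        using s by (simp add: divide_simps) (simp add: algebra_simps power2_eq_square)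
      moreover have "1 / (s\<^sup>2 * (s - 1)) \<ge> 0" using s by simp
      ultimately show ?thesis by linarith
    qed
    finally show "(s - a) / (s * (s - 1)) + 1 / s\<^sup>2 \<le> 1 / s" by simp
  qed
  finally show ?case by (simp add: s_def)
qed

text \<open>This is \<open>ln (1 + 1 / s) \<le> 1 / s\<close>. It trades the exponential factor of a
  single step for a ratio whose product telescopes.\<close>

lemma powr_ratio_ge_exp:
  fixes s a :: real
  assumes "s > 0" "a \<ge> 0"
  shows "exp (- (a / s)) \<le> (s / (s + 1)) powr a"
proof -
  have "ln ((s + 1) / s) \<le> (s + 1) / s - 1"
    using assms by (intro ln_le_minus_one) simp
  also have "\<dots> = 1 / s"
    using assms by (simp add: field_simps)
  finally have "- (1 / s) \<le> ln (s / (s + 1))"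
    using assms by (simp add: ln_div)
  then have "a * (- (1 / s)) \<le> a * ln (s / (s + 1))"
    using assms(2) by (rule mult_left_mono)
  then show ?thesis
    using assms by (simp add: powr_def)
qed

text \<open>By \<open>1 + y \<le> exp y\<close> each factor is at most
  \<open>exp (- a / s + b / s\<^sup>2)\<close>; the first summand yields the power decay, the second
  a convergent correction. Multiplying a bound on the factor by \<open>h k\<close> uses
  nonnegativity of \<open>h\<close>.\<close>

lemma contraction_rate:
  fixes h :: "nat \<Rightarrow> real"
  assumes a: "a > 0" and m: "m \<ge> 0" and K: "K \<ge> 1" and nonneg: "\<And>k. h k \<ge> 0"
    and step: "\<And>k. k \<ge> K \<Longrightarrow>
      h (Suc k) \<le> (1 - a / (real k + a) + m / 2 * (a / (real k + a))\<^sup>2) * h k"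
    and k: "k \<ge> K"
  shows "h k \<le> h K * exp (m * a\<^sup>2 / (2 * (real K + a - 1))) * ((real K + a) / (real k + a)) powr a"
proof -
  define b where "b = m * a\<^sup>2 / 2"
  have b0: "b \<ge> 0" using m by (simp add: b_def)
  have pos: "real k + a - 1 > 0" if "k \<ge> K" for k using that K a by simp
  \<comment> \<open>The exponent telescopes: \<open>1 / s\<^sup>2 \<le> 1 / (s - 1) - 1 / s\<close> for \<open>s = k + a\<close>.\<close>
  have "h k \<le> h K * exp (b * (1 / (real K + a - 1) - 1 / (real k + a - 1)))
      * ((real K + a) / (real k + a)) powr a"
    using k
  proof (induction k rule: dec_induct)
    case base
    show ?case using a by simp
  next
    case (step k)
    define s where "s = real k + a"
    have s: "s > 1" using pos[OF step.hyps(1)] by (simp add: s_def)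
    let ?P = "\<lambda>s. ((real K + a) / s) powr a"
    let ?e = "\<lambda>s. exp (b * (1 / (real K + a - 1) - 1 / (s - 1)))"
    have "h (Suc k) \<le> (1 - a / s + b / s\<^sup>2) * h k"
      using assms(5)[OF step.hyps(1)] by (simp add: s_def b_def power_divide)
    also have "\<dots> \<le> exp (- (a / s) + b / s\<^sup>2) * h k"
      using exp_ge_add_one_self[of "- (a / s) + b / s\<^sup>2"]
      by (intro mult_right_mono nonneg) linarith
    also have "\<dots> \<le> exp (- (a / s) + b / s\<^sup>2) * (h K * ?e s * ?P s)"
      using step.IH by (intro mult_left_mono) (simp_all add: s_def)
    also have "\<dots> = h K * (exp (b / s\<^sup>2) * ?e s) * (exp (- (a / s)) * ?P s)"
      by (simp only: exp_add mult_ac)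
    also have "\<dots> \<le> h K * ?e (s + 1) * ?P (s + 1)"
    proof (intro mult_mono mult_left_mono nonneg mult_nonneg_nonneg)
      have "1 / s\<^sup>2 \<le> 1 / (s - 1) - 1 / s"
      proof -
        have "1 / (s - 1) - 1 / s - 1 / s\<^sup>2 = 1 / (s\<^sup>2 * (s - 1))"
          using s by (simp add: divide_simps) (simp add: algebra_simps power2_eq_square)
        moreover have "1 / (s\<^sup>2 * (s - 1)) \<ge> 0" using s by simp
        ultimately show ?thesis by linarith
      qed
      from mult_left_mono[OF this b0]
      have "b / s\<^sup>2 + b * (1 / (real K + a - 1) - 1 / (s - 1)) \<le> b * (1 / (real K + a - 1) - 1 / s)"
        by (simp add: algebra_simps)
      then show "exp (b / s\<^sup>2) * ?e s \<le> ?e (s + 1)"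
        by (simp flip: exp_add)
      have "exp (- (a / s)) * ?P s \<le> (s / (s + 1)) powr a * ?P s"
        using powr_ratio_ge_exp[of s a] s a by (intro mult_right_mono) auto
      also have "\<dots> = ?P (s + 1)"
        using s a by (simp flip: powr_mult)
      finally show "exp (- (a / s)) * ?P s \<le> ?P (s + 1)" .
    qed auto
    finally show ?case by (simp add: s_def algebra_simps)
  qed
  \<comment> \<open>The induction carries the exact telescoped exponent; its negative part is
    discarded only afterwards, which makes the constant independent of \<open>k\<close>.\<close>
  also have "\<dots> \<le> h K * exp (b * (1 / (real K + a - 1))) * ((real K + a) / (real k + a)) powr a"
  proof (intro mult_right_mono mult_left_mono nonneg)
    have "b * (1 / (real K + a - 1) - 1 / (real k + a - 1)) \<le> b * (1 / (real K + a - 1))"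
      using pos[OF k] b0 by (intro mult_left_mono) simp_all
    then show "exp (b * (1 / (real K + a - 1) - 1 / (real k + a - 1))) \<le> exp (b * (1 / (real K + a - 1)))"
      by simp
  qed simp
  finally show ?thesis by (simp add: b_def)
qed

lemma shifted_powr_bigo:
  fixes g :: "nat \<Rightarrow> real"
  assumes a: "a > 0" and c: "c > 0" and B: "B \<ge> 0"
    and g: "\<And>k. k \<ge> K \<Longrightarrow> 0 \<le> g k \<and> g k \<le> B * (c / (real k + a)) powr a"
  shows "g \<in> O(\<lambda>k. real k powr (- a))"
proof (rule bigoI[where c = "B * c powr a"])
  show "eventually (\<lambda>k. norm (g k) \<le> B * c powr a * norm (real k powr (- a))) at_top"
    using eventually_ge_at_top[of "max K 1"]
  proof eventually_elim
    case (elim k)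
    then have "norm (g k) \<le> B * (c / (real k + a)) powr a"
      using g[of k] by simp
    also have "(c / (real k + a)) powr a = c powr a * (real k + a) powr (- a)"
      using a c by (simp add: powr_divide powr_minus_divide)
    also have "B * (c powr a * (real k + a) powr (- a)) \<le> B * (c powr a * real k powr (- a))"
      using a c B elim by (intro mult_left_mono powr_mono2') auto
    finally show ?case by (simp add: mult.assoc)
  qed
qed

section \<open>The Frank-Wolfe gap\<close>

context riemannian
begin

lemma difference_le_fw_gap:
  assumes "complete_riem M" "weakly_geodesically_convex M X" "differentiable_at_point M f x"
    "regular M X f L" "x \<in> X" "y \<in> X" and v: "v \<in> linear_argmin M X x (grad M f x)"
  shows "f x - f y \<le> fw_gap M f x v"
  using grad_le_difference[OF assms(1-6)] v unfolding linear_argmin_def fw_gap_def by force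

text \<open>The algorithm minimizes against the gradient while \<open>RSI\<close> concerns
  maximizers, so the sign is moved into the vector by \<open>tscale (- 1)\<close>, which preserves
  the norm.\<close>

lemma RSI_le_fw_gap:
  assumes RSI: "RSI M X \<alpha>" and f: "differentiable_at_point M f x" and x: "x \<in> X"
    and v: "v \<in> linear_argmin M X x (grad M f x)"
  shows "\<alpha> * rnorm M x (grad M f x) * (rnorm M x v)\<^sup>2 \<le> fw_gap M f x v"
proof -
  let ?w = "tscale (- 1) (grad M f x)"
  note G = grad_in_tangent_space[OF f]
  have neg: "metric M x ?w u = - metric M x (grad M f x) u" if "u \<in> feasible_velocities M X x" for u
    using metric_scale[OF G, of u "-1"] that by (simp add: feasible_velocities_def)
  have v': "v \<in> feasible_velocities M X x" using v by (simp add: linear_argmin_def)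
  have "v \<in> linear_argmax M X x ?w"
    using v by (simp add: linear_argmin_def linear_argmax_def neg)
  then have "\<alpha> * rnorm M x ?w * (rnorm M x v)\<^sup>2 \<le> metric M x ?w v"
    using RSI x tscale_in_tangent_space[OF G] unfolding RSI_def by blast
  then show ?thesis
    using rnorm_tscale[OF G, of "-1"] neg[OF v'] by (simp add: fw_gap_def)
qed

end

theorem theorem5p3:
  fixes M :: "('m::{t2_space,second_countable_topology}, 'e::euclidean_space) riem"
    and X N :: "'m set" and f h :: "'m \<Rightarrow> real"
    and a L \<alpha> \<nu> D M\<^sub>R\<^sub>S\<^sub>I :: real and K :: nat
    and x :: "nat \<Rightarrow> 'm" and v :: "nat \<Rightarrow> ('m, 'e) tangent"
  assumes "riemannian_manifold M" and "connected (UNIV :: 'm set)" and "complete_riem M"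
    and "X \<noteq> {}" and "compact X" and "weakly_geodesically_convex M X"
    and "D = diam M X" and "D > 0"
    and "open N" and "X \<subseteq> N" and "\<forall>y\<in>N. differentiable_at_point M f y"
    and "h = (\<lambda>y. f y - fstar X f)"
    and "a \<ge> 2"
    and "L > 0" and "regular M X f L"
    and "\<alpha> > 0" and "RSI M X \<alpha>"
    and "\<nu> = (INF y\<in>X. rnorm M y (grad M f y))" and "\<nu> > 0"
    and "M\<^sub>R\<^sub>S\<^sub>I = L / (\<alpha> * \<nu>)"
    and "K = nat (max 1 \<lceil>a * M\<^sub>R\<^sub>S\<^sub>I / 2 - a\<rceil>)"
    and "rfw_run M X f a x v"
  shows "(\<exists>k. terminates_at M f x v k \<and> x k \<in> optimizers X f) \<or>
    ((\<forall>k. \<not> terminates_at M f x v k) \<and>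
     (\<forall>k\<ge>K.
        h (x k) \<le> h (x K) * exp (M\<^sub>R\<^sub>S\<^sub>I * a\<^sup>2 / (2 * (real K + a - 1)))
                   * ((real K + a) / (real k + a)) powr a \<and>
        h (x K) * exp (M\<^sub>R\<^sub>S\<^sub>I * a\<^sup>2 / (2 * (real K + a - 1)))
            * ((real K + a) / (real k + a)) powr a
          \<le> a\<^sup>2 * L * D\<^sup>2 / (2 * (real K + a - 1))
              * exp (L * a\<^sup>2 / (2 * \<alpha> * \<nu> * (real K + a - 1)))
              * ((real K + a) / (real k + a)) powr a) \<and>
     (\<lambda>k. h (x k)) \<in> O(\<lambda>k. real k powr (- a)))"
proof -
  interpret riemannian M by unfold_locales (rule assms(1))
  note complete = assms(3) and X0 = assms(4) and compact = assms(5) and convex = assms(6)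
    and h_def = assms(12) and a = assms(13) and L = assms(14) and reg = assms(15)
    and \<alpha> = assms(16) and RSI = assms(17) and \<nu>_def = assms(18) and \<nu> = assms(19)
    and M_def = assms(20) and K_def = assms(21) and run = assms(22)
  define g where "g k = fw_gap M f (x k) (v k)" for k
  have diff: "differentiable_at_point M f y" if "y \<in> X" for y
    using assms(10,11) that by blast
  \<comment> \<open>Entries of a run after the first vanishing gap are unconstrained, so feasibility
    is claimed only while all earlier gaps are nonzero.\<close>
  have iterate: "x k \<in> X \<and> v k \<in> linear_argmin M X (x k) (grad M f (x k))" if "\<forall>j<k. g j \<noteq> 0" for k
    using that
  proof (induction k)
    case 0
    then show ?case using run unfolding rfw_run_def g_def by blast
  next
    case (Suc k)
    then have IH: "x k \<in> X" "v k \<in> feasible_velocities M X (x k)"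
      by (auto simp: linear_argmin_def)
    have "x (Suc k) = Exp M (x k) (tscale (a / (real k + a)) (v k))"
      using run Suc.prems unfolding rfw_run_def g_def by (simp add: less_Suc_eq_le)
    moreover have "a / (real k + a) \<in> {0..1}" using a by simp
    ultimately have "x (Suc k) \<in> X"
      using IH(2) unfolding feasible_velocities_def by auto
    then show ?case using run Suc.prems unfolding rfw_run_def g_def by blast
  qed
  have gap: "f (x k) - f y \<le> g k" if "\<forall>j<k. g j \<noteq> 0" "y \<in> X" for k y
    unfolding g_def using iterate[OF that(1)] that(2)
    by (intro difference_le_fw_gap[OF complete convex diff reg]) auto
  show ?thesis
  proof (cases "\<exists>k. terminates_at M f x v k")
    case True
    then obtain k where k: "terminates_at M f x v k" by blast
    then have g: "\<forall>j<k. g j \<noteq> 0" "g k = 0" by (auto simp: terminates_at_def g_def)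
    have "f (x k) \<le> f y" if "y \<in> X" for y
      using gap[OF g(1) that] g(2) by simp
    then have "x k \<in> optimizers X f"
      using iterate[OF g(1)] by (simp add: optimizers_def)
    then show ?thesis using k by blast
  next
    case False
    \<comment> \<open>A least index with vanishing gap would be a point of termination.\<close>
    have g_nz: "g k \<noteq> 0" for k
    proof (induction k rule: less_induct)
      case (less k)
      then show ?case using False by (auto simp: terminates_at_def g_def)
    qed
    have xX: "x k \<in> X" and vk: "v k \<in> linear_argmin M X (x k) (grad M f (x k))" for k
      using iterate g_nz by blast+
    have vF: "v k \<in> feasible_velocities M X (x k)" for k
      using vk by (simp add: linear_argmin_def)
    have lower: "f (x k) - g k \<le> f y" if "y \<in> X" for k y
      using gap[of k y] g_nz that by simp
    \<comment> \<open>The gap inequality at the single iterate \<open>x 0\<close> bounds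
      \<open>f\<close> from below on \<open>X\<close>, which makes \<open>fstar\<close> a genuine
      infimum.\<close>
    have bdd: "bdd_below (f ` X)"
      using lower[of _ 0] by (intro bdd_belowI2)
    have h_nonneg: "h (x k) \<ge> 0" for k
      using cINF_lower[OF bdd xX[of k]] by (simp add: h_def fstar_def)
    have h_le_g: "h (x k) \<le> g k" for k
    proof -
      have "f (x k) - g k \<le> (INF y\<in>X. f y)" by (rule cINF_greatest[OF X0 lower])
      then show ?thesis by (simp add: h_def fstar_def)
    qed
    define r where "r k = rnorm M (x k) (v k)" for k
    have r_le: "(r k)\<^sup>2 \<le> D\<^sup>2" for k
    proof (rule power_mono)
      show "0 \<le> r k"
        unfolding r_def using vF[of k] by (intro rnorm_nonneg) (simp add: feasible_velocities_def)
      show "r k \<le> D"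
        using vF[of k] rdist_le_diam[OF compact convex xX[of k]]
        by (simp add: r_def assms(7) feasible_velocities_def)
    qed
    have descent: "h (x (Suc k)) \<le> h (x k) - a / (real k + a) * g k + L / 2 * (a / (real k + a))\<^sup>2 * (r k)\<^sup>2" for k
    proof -
      have "x (Suc k) = Exp M (x k) (tscale (a / (real k + a)) (v k))"
        using run g_nz unfolding rfw_run_def g_def by blast
      moreover have "a / (real k + a) \<in> {0..1}" using a by simp
      ultimately have "f (x (Suc k)) \<le> f (x k) + a / (real k + a) * metric M (x k) (grad M f (x k)) (v k)
          + L / 2 * (a / (real k + a))\<^sup>2 * (r k)\<^sup>2"
        using reg xX[of k] vF[of k] unfolding regular_def r_def by metis
      then show ?thesis by (simp add: h_def g_def fw_gap_def)
    qed
    have open_loop: "h (x (Suc k)) \<le> (1 - a / (real k + a)) * h (x k) + a\<^sup>2 * L * D\<^sup>2 / 2 / (real k + a)\<^sup>2" for k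
    proof -
      have "a / (real k + a) * h (x k) \<le> a / (real k + a) * g k"
        using a by (intro mult_left_mono h_le_g) simp
      moreover have "L / 2 * (a / (real k + a))\<^sup>2 * (r k)\<^sup>2 \<le> L / 2 * (a / (real k + a))\<^sup>2 * D\<^sup>2"
        using L by (intro mult_left_mono r_le) simp
      moreover have "L / 2 * (a / (real k + a))\<^sup>2 * D\<^sup>2 = a\<^sup>2 * L * D\<^sup>2 / 2 / (real k + a)\<^sup>2"
        by (simp add: power_divide)
      ultimately show ?thesis
        using descent[of k] unfolding left_diff_distrib mult_1 by linarith
    qed
    have "\<nu> \<le> rnorm M (x k) (grad M f (x k))" for k
      unfolding \<nu>_def
    proof (rule cINF_lower[OF _ xX])
      show "bdd_below ((\<lambda>y. rnorm M y (grad M f y)) ` X)"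
        using rnorm_nonneg[OF grad_in_tangent_space[OF diff]] by (intro bdd_belowI2)
    qed
    then have "\<alpha> * \<nu> * (r k)\<^sup>2 \<le> \<alpha> * rnorm M (x k) (grad M f (x k)) * (r k)\<^sup>2" for k
      using \<alpha> by (intro mult_right_mono mult_left_mono) auto
    also have "\<alpha> * rnorm M (x k) (grad M f (x k)) * (r k)\<^sup>2 \<le> g k" for k
      unfolding g_def r_def by (rule RSI_le_fw_gap[OF RSI diff[OF xX] xX vk])
    finally have RSI_gap: "\<alpha> * \<nu> * (r k)\<^sup>2 \<le> g k" for k .
    have M0: "M\<^sub>R\<^sub>S\<^sub>I \<ge> 0" using L \<alpha> \<nu> by (simp add: M_def)
    \<comment> \<open>\<open>M\<^sub>R\<^sub>S\<^sub>I\<close> is the factor that cancels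
      \<open>\<alpha> * \<nu>\<close> in \<open>RSI_gap\<close> and leaves \<open>L\<close>.\<close>
    have r_le_gap: "L * (r k)\<^sup>2 \<le> M\<^sub>R\<^sub>S\<^sub>I * g k" for k
      using mult_left_mono[OF RSI_gap[of k] M0] \<alpha> \<nu> by (simp add: M_def)
    \<comment> \<open>\<open>K1\<close> admits \<open>open_loop_rate\<close>, which speaks from
      index 1 on; \<open>K2\<close> is the step size condition
      \<open>\<eta> * M\<^sub>R\<^sub>S\<^sub>I \<le> 2\<close> solved for the index.\<close>
    have K1: "K \<ge> 1" and K2: "a * M\<^sub>R\<^sub>S\<^sub>I / 2 - a \<le> real K"
      unfolding K_def by linarith+
    have contraction: "h (x (Suc k)) \<le> (1 - a / (real k + a) + M\<^sub>R\<^sub>S\<^sub>I / 2 * (a / (real k + a))\<^sup>2) * h (x k)"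
      if k: "k \<ge> K" for k
    proof -
      define \<eta> where "\<eta> = a / (real k + a)"
      have \<eta>0: "\<eta> \<ge> 0" using a by (simp add: \<eta>_def)
      have "a * M\<^sub>R\<^sub>S\<^sub>I / 2 \<le> real k + a" using K2 k by simp
      then have \<eta>M: "\<eta> * M\<^sub>R\<^sub>S\<^sub>I / 2 \<le> 1" using a by (simp add: \<eta>_def field_simps)
      have "h (x (Suc k)) \<le> h (x k) - \<eta> * g k + \<eta>\<^sup>2 / 2 * (L * (r k)\<^sup>2)"
        using descent[of k] by (simp add: \<eta>_def mult_ac)
      also have "\<dots> \<le> h (x k) - \<eta> * g k + \<eta>\<^sup>2 / 2 * (M\<^sub>R\<^sub>S\<^sub>I * g k)"
        by (intro add_left_mono mult_left_mono r_le_gap) simp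
      also have "\<dots> = h (x k) - \<eta> * (1 - \<eta> * M\<^sub>R\<^sub>S\<^sub>I / 2) * g k"
        by (simp add: algebra_simps power2_eq_square)
      \<comment> \<open>The gap may be lowered to \<open>h (x k)\<close> because its coefficient
        \<open>\<eta> * (1 - \<eta> * M\<^sub>R\<^sub>S\<^sub>I / 2)\<close> is nonnegative by
        \<open>\<eta>M\<close>.\<close>
      also have "\<dots> \<le> h (x k) - \<eta> * (1 - \<eta> * M\<^sub>R\<^sub>S\<^sub>I / 2) * h (x k)"
        using \<eta>0 \<eta>M by (intro diff_left_mono mult_left_mono h_le_g) simp
      also have "\<dots> = (1 - \<eta> + M\<^sub>R\<^sub>S\<^sub>I / 2 * \<eta>\<^sup>2) * h (x k)"
        by (simp add: algebra_simps power2_eq_square)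
      finally show ?thesis unfolding \<eta>_def .
    qed
    let ?P = "\<lambda>k. ((real K + a) / (real k + a)) powr a"
    let ?E = "exp (M\<^sub>R\<^sub>S\<^sub>I * a\<^sup>2 / (2 * (real K + a - 1)))"
    have upper: "h (x k) \<le> h (x K) * ?E * ?P k" if "k \<ge> K" for k
      by (rule contraction_rate[where h = "\<lambda>k. h (x k)"]) (use a M0 K1 h_nonneg contraction that in auto)
    have "h (x K) \<le> a\<^sup>2 * L * D\<^sup>2 / 2 / (real K + a - 1)"
      by (rule open_loop_rate[where h = "\<lambda>k. h (x k)"]) (use a L K1 open_loop in auto)
    then have "h (x K) * ?E * ?P k \<le> a\<^sup>2 * L * D\<^sup>2 / 2 / (real K + a - 1) * ?E * ?P k" for k
      by (intro mult_right_mono) simp_all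
    moreover have "M\<^sub>R\<^sub>S\<^sub>I * a\<^sup>2 / (2 * (real K + a - 1)) = L * a\<^sup>2 / (2 * \<alpha> * \<nu> * (real K + a - 1))"
      by (simp add: M_def mult_ac)
    ultimately have explicit: "h (x K) * ?E * ?P k
        \<le> a\<^sup>2 * L * D\<^sup>2 / (2 * (real K + a - 1)) * exp (L * a\<^sup>2 / (2 * \<alpha> * \<nu> * (real K + a - 1))) * ?P k" for k
      by simp
    have "(\<lambda>k. h (x k)) \<in> O(\<lambda>k. real k powr (- a))"
      using a h_nonneg upper
      by (intro shifted_powr_bigo[where c = "real K + a" and B = "h (x K) * ?E" and K = K]) auto
    then show ?thesis
      using False upper explicit by blast
  qed
qed

end
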